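(* $$\lim_{X\to\infty}\frac{\sum_{0<n<X,\ n \text{ squarefree}} \#\mathcal{F}^{0,\mathrm{sol}}_{-n^2}}{\sum_{0<n<X,\ n\text{ squarefree}} \#\mathcal{F}^{0,\mathrm{ls}}_{-n^2}} = 0.$$ Equivalently: when the locally soluble forms in $\bigcup_{n\ge1 \text{ squarefree}}\mathcal{F}^0_{-n^2}$ are ordered by the Bhargava–Ho height, $0\%$ of them are soluble.
   Context: For integers $B,M$, $W^B_M(\mathbb{Z})$ is the set of binary quartic forms $ax^4+Bx^2y^2+cy^4$ with $a,c\in\mathbb{Z}$, $ac=M$, and $\mathcal{F}^B_M=\{ax^4+Bx^2y^2+cy^4\in W^B_M(\mathbb{Z}): 0\le\operatorname{ord}_pa\le1 \text{ for all primes } p\}$. A form $f$ is locally soluble if for every place $v$ of $\mathbb{Q}$ there are $x,y,z\in\mathbb{Q}_v$, $(x,y)\ne(0,0)$, with $z^2=f(x,y)$; it is soluble if such $x,y,z$ exist in $\mathbb{Q}$. $\mathcal{F}^{B,\mathrm{ls}}_M$ and $\mathcal{F}^{B,\mathrm{sol}}_M$ denote the locally soluble and soluble elements of $\mathcal{F}^B_M$. The Bhargava–Ho height of $ax^4+Bx^2y^2+cy^4$ is $\max\{B^2,|ac|\}$. *)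

theory Defs
  imports Complex_Main "HOL-Computational_Algebra.Computational_Algebra"
    "HOL-Number_Theory.Number_Theory"
begin

text \<open>The binary quartic form a x^4 + B x^2 y^2 + c y^4 is represented by the
  coefficient pair (a, c), the middle coefficient B being a fixed parameter.\<close>

definition quartic :: "'r::comm_ring_1 \<Rightarrow> 'r \<Rightarrow> 'r \<Rightarrow> 'r \<Rightarrow> 'r \<Rightarrow> 'r" where
  "quartic a B c x y = a * x ^ 4 + B * x\<^sup>2 * y\<^sup>2 + c * y ^ 4"

definition FB :: "int \<Rightarrow> int \<Rightarrow> (int \<times> int) set" where
  "FB B M = {(a, c). a * c = M \<and> (\<forall>p::int. prime p \<longrightarrow> multiplicity p a \<le> 1)}"

definition real_soluble :: "int \<Rightarrow> int \<Rightarrow> int \<Rightarrow> bool" where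
  "real_soluble B a c \<longleftrightarrow> (\<exists>x y z :: real. (x, y) \<noteq> (0, 0) \<and>
      z\<^sup>2 = quartic (of_int a) (of_int B) (of_int c) x y)"

text \<open>p-adic integers Z_p realised as the inverse limit of Z/p^k Z: compatible
  sequences of residues u k in [0, p^k).\<close>
definition padic_int :: "int \<Rightarrow> (nat \<Rightarrow> int) \<Rightarrow> bool" where
  "padic_int p u \<longleftrightarrow> (\<forall>k. 0 \<le> u k \<and> u k < p ^ k \<and> u (Suc k) mod p ^ k = u k)"

text \<open>Solubility over Q_p.  Since the equation z^2 = f(x,y) is weighted
  homogeneous (weights 1,1,2), a Q_p-solution can be scaled to a Z_p-solution,
  so we state it with x, y, z in Z_p, (x,y) nonzero in Z_p.\<close>
definition padic_soluble :: "int \<Rightarrow> int \<Rightarrow> int \<Rightarrow> int \<Rightarrow> bool" where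
  "padic_soluble p B a c \<longleftrightarrow> (\<exists>x y z. padic_int p x \<and> padic_int p y \<and> padic_int p z \<and>
      (\<exists>k. x k \<noteq> 0 \<or> y k \<noteq> 0) \<and>
      (\<forall>k. [(z k)\<^sup>2 = quartic a B c (x k) (y k)] (mod p ^ k)))"

definition locally_soluble :: "int \<Rightarrow> int \<Rightarrow> int \<Rightarrow> bool" where
  "locally_soluble B a c \<longleftrightarrow> real_soluble B a c \<and>
      (\<forall>p::int. prime p \<longrightarrow> padic_soluble p B a c)"

definition soluble :: "int \<Rightarrow> int \<Rightarrow> int \<Rightarrow> bool" where
  "soluble B a c \<longleftrightarrow> (\<exists>x y z :: rat. (x, y) \<noteq> (0, 0) \<and>
      z\<^sup>2 = quartic (of_int a) (of_int B) (of_int c) x y)"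

definition FB_ls :: "int \<Rightarrow> int \<Rightarrow> (int \<times> int) set" where
  "FB_ls B M = {(a, c) \<in> FB B M. locally_soluble B a c}"

definition FB_sol :: "int \<Rightarrow> int \<Rightarrow> (int \<times> int) set" where
  "FB_sol B M = {(a, c) \<in> FB B M. soluble B a c}"

end

theory Submission
  imports Defs "HOL-Analysis.Analysis" "HOL-Real_Asymp.Real_Asymp"
begin

text \<open>For squarefree \<open>n\<close> the forms are, up to sign, \<open>d x^4 - d e^2 y^4\<close> with \<open>d e = n\<close>. Local
  solubility amounts to conditions that are linear over the field of two elements in the set of primes
  dividing \<open>d\<close>: one for each prime 1 mod 4 dividing \<open>n\<close>, and two more that settle the prime 2. Hence the
  number of locally soluble forms is at least a constant times 2 to the number of prime divisors of \<open>n\<close>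
  that are 3 mod 4, and by convexity the denominator is at least \<open>X (log X)^\<delta>\<close> for some \<open>\<delta> > 0\<close>.

  A global solution can be descended once more: up to powers of 2 it yields \<open>n = D1 D2 D3 D4\<close> with two
  independent Legendre symbol conditions at every prime. Detecting these by characters, as Heath-Brown
  does for the 2-Selmer groups of the congruent number curves, gives a sum over 16 variables of Jacobi
  symbols weighted by 4 to minus the number of primes. The variables split into four classes such that
  any two variables of a class are linked by exactly one Jacobi symbol. If two linked variables exceed a large
  power of \<open>log X\<close>, bilinear cancellation makes the contribution negligible; otherwise each class contains at
  most one such variable, and the trivial estimate gives \<open>O (X (log log X)^16)\<close>. This bounds the numerator.\<close>

section \<open>Legendre symbols and local solubility\<close>

text \<open>A soluble form meets every local condition, so the first factorization cannot tell the
  two counts apart; the conditions that a second one adds have to be exploited. The comparison is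
  then robust: a positive power of \<open>ln N\<close>, however small, beats every power of
  \<open>ln (ln N)\<close>, so that on the local side a crude lower bound for the reciprocal sum of
  the primes 3 mod 4 suffices, and wasteful constants do no harm. The sixteen variables arise
  because every prime of one of the four factors of \<open>n\<close> selects one of four characters.
  They are the points of the affine plane over the field of four elements: the four factors and the
  four classes are two families of parallel lines, so a factor and a class meet in exactly one
  variable. The sum over the large variables costs no logarithm at all: with one large variable in
  each class, the weight 4 to minus the number of primes exactly offsets the number of ordered
  factorizations into four parts. Only the small variables, bounded by a power of
  \<open>ln X\<close>, leave powers of \<open>ln (ln X)\<close>.\<close>

lemmas cong_iff_mod_eq = unique_euclidean_semiring_class.cong_def

text \<open>The substitution permutes the residues. With \<open>b = 0\<close> and a multiplier of
  symbol -1 it makes a character sum equal to its negative; with \<open>a = 1\<close> it shifts a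
  full period.\<close>

lemma sum_affine_mod:
  fixes f :: "int \<Rightarrow> 'a::comm_monoid_add" and m :: int
  assumes m: "m > 0" and cop: "coprime a m"
    and per: "\<And>x y. [x = y] (mod m) \<Longrightarrow> f x = f y"
  shows "(\<Sum>x\<in>{0..<m}. f (a * x + b)) = (\<Sum>x\<in>{0..<m}. f x)"
proof -
  let ?h = "\<lambda>x. (a * x + b) mod m"
  have inj: "inj_on ?h {0..<m}"
  proof (rule inj_onI)
    fix x y assume xy: "x \<in> {0..<m}" "y \<in> {0..<m}" and hh: "?h x = ?h y"
    have "[a * x + b = a * y + b] (mod m)" using hh by (simp only: cong_iff_mod_eq)
    then have "[a * x = a * y] (mod m)" by (rule cong_add_rcancel[THEN iffD1])
    then have "[x = y] (mod m)" using cop cong_mult_lcancel by blast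
    then show "x = y" using xy by (simp add: cong_iff_mod_eq)
  qed
  have sub: "?h ` {0..<m} \<subseteq> {0..<m}" using m by auto
  have im: "?h ` {0..<m} = {0..<m}"
    using sub inj by (metis card_image card_subset_eq finite_atLeastLessThan_int)
  have "(\<Sum>x\<in>{0..<m}. f (a * x + b)) = (\<Sum>x\<in>{0..<m}. f (?h x))"
    by (intro sum.cong refl per) (simp add: cong_iff_mod_eq)
  also have "\<dots> = (\<Sum>x\<in>?h ` {0..<m}. f x)" using inj by (simp add: sum.reindex)
  finally show ?thesis by (simp only: im)
qed

lemma Legendre_cong:
  assumes "[a = b] (mod p)"
  shows "Legendre a p = Legendre b p"
proof -
  have "[y = a] (mod p) \<longleftrightarrow> [y = b] (mod p)" "[a = y] (mod p) \<longleftrightarrow> [b = y] (mod p)" for y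
    using assms by (simp_all only: cong_iff_mod_eq)
  then show ?thesis by (simp only: Legendre_def QuadRes_def)
qed

lemma small_multiple_eq_0: "int p dvd x \<Longrightarrow> \<bar>x\<bar> \<le> 2 \<Longrightarrow> 2 < p \<Longrightarrow> x = 0"
  using dvd_imp_le_int[of x "int p"] by linarith

lemma Legendre_eq_0_iff: "Legendre a p = 0 \<longleftrightarrow> p dvd a"
  by (simp add: Legendre_def cong_0_iff)

lemma Legendre_cases: "Legendre a p = -1 \<or> Legendre a p = 0 \<or> Legendre a p = 1"
  by (simp add: Legendre_def)

lemma Legendre_eq_1D: "Legendre a p = 1 \<Longrightarrow> \<not> p dvd a \<and> QuadRes p a"
  by (auto simp add: Legendre_def cong_0_iff split: if_splits)

lemma Legendre_mult:
  assumes p: "prime (p::nat)" "2 < p"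
  shows "Legendre (a * b) (int p) = Legendre a (int p) * Legendre b (int p)"
proof -
  have "[Legendre (a * b) p = (a * b) ^ ((p - 1) div 2)] (mod p)"
    using euler_criterion[OF p] .
  moreover have "[Legendre a p * Legendre b p = a ^ ((p - 1) div 2) * b ^ ((p - 1) div 2)] (mod p)"
    by (intro cong_mult euler_criterion[OF p])
  ultimately have "[Legendre (a * b) p = Legendre a p * Legendre b p] (mod p)"
    by (metis cong_sym cong_trans power_mult_distrib)
  then have d: "int p dvd Legendre (a * b) p - Legendre a p * Legendre b p"
    by (simp add: cong_iff_dvd_diff)
  have "\<bar>Legendre (a * b) p - Legendre a p * Legendre b p\<bar> \<le> 2"
    using Legendre_cases[of "a*b" p] Legendre_cases[of a p] Legendre_cases[of b p] by auto
  then show ?thesis using small_multiple_eq_0[OF d _ p(2)] by simp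
qed

lemma Legendre_1: "1 < p \<Longrightarrow> Legendre 1 p = 1"
  unfolding Legendre_def QuadRes_def using zdvd_not_zless[of 1 p] by (auto simp: cong_0_iff intro: exI[of _ 1])

lemma Legendre_power:
  assumes p: "prime (p::nat)" "2 < p"
  shows "Legendre (a ^ k) (int p) = Legendre a (int p) ^ k"
  using p by (induction k) (auto simp: Legendre_mult Legendre_1)

lemma Legendre_square:
  assumes "prime (p::int)" "\<not> p dvd a"
  shows "Legendre (a\<^sup>2) p = 1"
  using assms unfolding Legendre_def QuadRes_def
  by (auto simp: cong_0_iff prime_dvd_power_iff intro: cong_refl)

lemma Legendre_minus_1:
  assumes p: "prime (p::nat)"
  shows "p mod 4 = 1 \<Longrightarrow> Legendre (-1) (int p) = 1" "p mod 4 = 3 \<Longrightarrow> Legendre (-1) (int p) = -1"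
proof -
  have key: "Legendre (-1) (int p) = (-1) ^ ((p - 1) div 2)" if "2 < p"
  proof -
    have c: "[Legendre (-1) p = (-1) ^ ((p - 1) div 2)] (mod p)"
      using euler_criterion[OF p that] .
    then have d: "int p dvd Legendre (-1) p - (-1) ^ ((p - 1) div 2)"
      by (simp add: cong_iff_dvd_diff)
    have "\<bar>Legendre (-1) p - (-1) ^ ((p - 1) div 2)\<bar> \<le> 2"
      using Legendre_cases[of "-1" p] by (cases "even ((p - 1) div 2)") auto
    then show ?thesis using small_multiple_eq_0[OF d _ that] by simp
  qed
  show "p mod 4 = 1 \<Longrightarrow> Legendre (-1) (int p) = 1"
  proof -
    assume a: "p mod 4 = 1"
    then have "2 < p" using p prime_gt_1_nat[OF p] by (cases "p = 2") auto
    moreover have "even ((p - 1) div 2)" using a by presburger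
    ultimately show ?thesis using key by simp
  qed
  show "p mod 4 = 3 \<Longrightarrow> Legendre (-1) (int p) = -1"
  proof -
    assume a: "p mod 4 = 3"
    then have "2 < p" using p prime_gt_1_nat[OF p] by (cases "p = 2") auto
    moreover have "odd ((p - 1) div 2)" using a by presburger
    ultimately show ?thesis using key by simp
  qed
qed

section \<open>Complete character sums modulo an odd prime\<close>

lemma sum_Legendre:
  assumes p: "prime (p::nat)" "2 < p" and d: "Legendre d (int p) = -1"
  shows "(\<Sum>x\<in>{0..<int p}. Legendre x (int p)) = 0"
proof -
  have nd: "\<not> int p dvd d" using d Legendre_eq_0_iff[of d "int p"] by auto
  then have cop: "coprime d (int p)" using p
    by (metis coprime_commute prime_imp_coprime_int prime_nat_int_transfer)
  have "(\<Sum>x\<in>{0..<int p}. Legendre (d * x + 0) (int p)) = (\<Sum>x\<in>{0..<int p}. Legendre x (int p))"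
    by (rule sum_affine_mod) (use p cop in \<open>auto intro: Legendre_cong\<close>)
  then show ?thesis by (simp add: Legendre_mult[OF p] d sum_negf)
qed

text \<open>Scaling \<open>x\<close> by \<open>c\<close> shows that the correlation
  \<open>F h\<close> is the same for all \<open>h\<close> prime to \<open>p\<close>. Summed over
  every \<open>h\<close> it is a product of two vanishing character sums, so the
  \<open>p - 1\<close> equal values cancel \<open>F 0 = p - 1\<close> and each of them is
  -1.\<close>

lemma sum_Legendre_shift:
  assumes p: "prime (p::nat)" "2 < p" and d: "Legendre d (int p) = -1" and h: "\<not> int p dvd h"
  shows "(\<Sum>x\<in>{0..<int p}. Legendre x (int p) * Legendre (x + h) (int p)) = -1"
proof -
  let ?L = "\<lambda>x. Legendre x (int p)"
  define F where "F h = (\<Sum>x\<in>{0..<int p}. ?L x * ?L (x + h))" for h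
  have F0: "F 0 = int p - 1"
  proof -
    have "F 0 = (\<Sum>x\<in>{0..<int p}. if x = 0 then 0 else 1)"
      unfolding F_def
    proof (intro sum.cong refl)
      fix x assume "x \<in> {0..<int p}"
      then show "?L x * ?L (x + 0) = (if x = 0 then 0 else 1)"
        using Legendre_cases[of x p] Legendre_eq_0_iff[of x "int p"] zdvd_not_zless[of x "int p"]
        by (auto simp: Legendre_eq_0_iff)
    qed
    also have "\<dots> = (\<Sum>x\<in>{0..<int p} - {0}. 1)"
      using p by (subst sum.remove[where x=0]) auto
    also have "\<dots> = int p - 1" using p by (simp add: card_Diff_singleton)
    finally show ?thesis .
  qed
  have Fc: "F (c * h) = F h" if "\<not> int p dvd c" for c h
  proof -
    have cop: "coprime c (int p)" using p that
      by (metis coprime_commute prime_imp_coprime_int prime_nat_int_transfer)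
    have "F (c * h) = (\<Sum>x\<in>{0..<int p}. ?L (c*x+0) * ?L (c*x+0 + c * h))"
      unfolding F_def
      by (rule sum_affine_mod[symmetric, where f="\<lambda>x. ?L x * ?L (x + c*h)"])
         (use p cop in \<open>auto intro!: arg_cong2[of _ _ _ _ "(*)"] Legendre_cong cong_add\<close>)
    also have "\<dots> = (\<Sum>x\<in>{0..<int p}. ?L c ^ 2 * (?L x * ?L (x + h)))"
      by (intro sum.cong refl)
        (simp add: distrib_left[symmetric] Legendre_mult[OF p] power2_eq_square del: distrib_left)
    also have "?L c ^ 2 = 1" using that Legendre_cases[of c p] Legendre_eq_0_iff[of c "int p"] by auto
    finally show ?thesis by (simp add: F_def)
  qed
  have "(\<Sum>c\<in>{0..<int p}. F c) = (\<Sum>x\<in>{0..<int p}. ?L x * (\<Sum>c\<in>{0..<int p}. ?L (1 * c + x)))"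
    unfolding F_def by (subst sum.swap) (simp add: sum_distrib_left add.commute)
  also have "\<dots> = (\<Sum>x\<in>{0..<int p}. ?L x * (\<Sum>c\<in>{0..<int p}. ?L c))"
    by (intro sum.cong refl arg_cong2[of _ _ _ _ "(*)"] sum_affine_mod)
      (use p in \<open>auto intro: Legendre_cong\<close>)
  also have "\<dots> = 0" by (simp add: sum_Legendre[OF p d])
  finally have s: "(\<Sum>c\<in>{0..<int p}. F c) = 0" .
  have "(\<Sum>c\<in>{0..<int p}. F c) = F 0 + (\<Sum>c\<in>{0..<int p} - {0}. F c)"
    using p by (subst sum.remove[where x=0]) auto
  also have "(\<Sum>c\<in>{0..<int p} - {0}. F c) = (\<Sum>c\<in>{0..<int p} - {0}. F 1)"
    by (intro sum.cong refl, metis Diff_iff Fc atLeastLessThan_iff insertCI linorder_le_less_linear mult.right_neutral order_antisym zdvd_not_zless)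
  also have "\<dots> = (int p - 1) * F 1" using p by (simp add: card_Diff_singleton of_nat_diff)
  finally have "(int p - 1) * (1 + F 1) = 0" using s F0 by (simp add: distrib_left)
  then have "F 1 = -1" using p by auto
  then show ?thesis using Fc[OF h, of 1] by (simp add: F_def)
qed

text \<open>Supplies a local point at a prime 1 mod 4 where \<open>d\<close> and \<open>e\<close>
  are both nonresidues. If the value were never a nonresidue, the symbol of
  \<open>u\<^sup>2 - e\<^sup>2\<close> would be at least that of \<open>u\<close> for every
  \<open>u\<close>: it is 1 when \<open>u\<close> is a square, and otherwise \<open>u\<close> has
  symbol -1. Summing over \<open>u\<close> gives the contradiction 0 \<le> -1.\<close>

lemma exists_quartic_nonresidue:
  assumes p: "prime (p::nat)" "2 < p" and p4: "p mod 4 = 1"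
    and e: "Legendre e (int p) = -1"
  shows "\<exists>x. Legendre (x ^ 4 - e\<^sup>2) (int p) = -1"
proof (rule ccontr)
  let ?L = "\<lambda>x. Legendre x (int p)"
  assume no: "\<not> ?thesis"
  have ne: "\<not> int p dvd e" using e Legendre_eq_0_iff[of e "int p"] by auto
  have m1: "?L (-1) = 1" using Legendre_minus_1(1)[OF p(1) p4] .
  \<comment> \<open>A zero would make the square of \<open>x\<close> congruent to \<open>e\<close>
    or \<open>- e\<close>; since -1 is a residue, both have symbol -1.\<close>
  have n0: "?L (x ^ 4 - e\<^sup>2) \<noteq> 0" for x
  proof
    assume "?L (x ^ 4 - e\<^sup>2) = 0"
    then have "int p dvd (x\<^sup>2 - e) * (x\<^sup>2 + e)"
      by (simp add: Legendre_eq_0_iff algebra_simps power2_eq_square power4_eq_xxxx)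
    then have "int p dvd x\<^sup>2 - e \<or> int p dvd x\<^sup>2 + e"
      using p by (metis prime_dvd_mult_iff prime_nat_int_transfer)
    then have "[x\<^sup>2 = e] (mod int p) \<or> [x\<^sup>2 = - 1 * e] (mod int p)"
      by (auto simp: cong_iff_dvd_diff)
    then have "?L (x\<^sup>2) = -1"
      using Legendre_cong[of "x\<^sup>2" e p] Legendre_cong[of "x\<^sup>2" "-1*e" p] e m1
        Legendre_mult[OF p, of "-1" e] by auto
    then show False using zero_le_power2[of "?L x"] by (simp add: Legendre_power[OF p])
  qed
  have g1: "?L (x ^ 4 - e\<^sup>2) = 1" for x using no n0[of x] Legendre_cases[of "x^4-e\<^sup>2" p] by auto
  have "?L u \<le> ?L (u\<^sup>2 - e\<^sup>2)" for u
  proof (cases "?L u = -1")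
    case True then show ?thesis using Legendre_cases[of "u\<^sup>2-e\<^sup>2" p] by auto
  next
    case False
    have "\<exists>x. [x\<^sup>2 = u] (mod int p)"
    proof (cases "?L u = 0")
      case True then show ?thesis
        by (intro exI[of _ 0]) (auto simp: Legendre_eq_0_iff cong_iff_dvd_diff)
    next
      case f: False
      then have "?L u = 1" using False Legendre_cases[of u p] by auto
      then show ?thesis using Legendre_eq_1D[of u p] by (auto simp: QuadRes_def)
    qed
    then obtain x where "[x\<^sup>2 = u] (mod int p)" by blast
    then have "[(x\<^sup>2)\<^sup>2 - e\<^sup>2 = u\<^sup>2 - e\<^sup>2] (mod int p)" by (intro cong_diff cong_pow cong_refl)
    then have "?L (u\<^sup>2 - e\<^sup>2) = 1" using g1[of x] Legendre_cong by (simp add: power_mult[symmetric])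
    then show ?thesis using Legendre_cases[of u p] by auto
  qed
  then have "(\<Sum>u\<in>{0..<int p}. ?L u) \<le> (\<Sum>u\<in>{0..<int p}. ?L (u\<^sup>2 - e\<^sup>2))"
    by (intro sum_mono)
  \<comment> \<open>The factors \<open>u - e\<close> and \<open>u + e\<close> differ by
    \<open>2 e\<close>, so this is a shifted correlation with value -1.\<close>
  also have "\<dots> = (\<Sum>u\<in>{0..<int p}. ?L (1 * u + (- e)) * ?L (1 * u + (- e) + 2 * e))"
    by (intro sum.cong refl)
      (simp flip: Legendre_mult[OF p] add: algebra_simps power2_eq_square)
  also have "\<dots> = (\<Sum>u\<in>{0..<int p}. ?L u * ?L (u + 2 * e))"
    by (rule sum_affine_mod[where f="\<lambda>x. ?L x * ?L (x + 2 * e)"])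
      (use p in \<open>auto intro!: arg_cong2[of _ _ _ _ "(*)"] Legendre_cong cong_add\<close>)
  also have "\<dots> = -1"
  proof (rule sum_Legendre_shift[OF p e])
    show "\<not> int p dvd 2 * e"
      using ne p by (metis of_nat_dvd_iff of_nat_numeral prime_dvd_mult_iff prime_nat_int_transfer
          primes_dvd_imp_eq two_is_prime_nat order_less_irrefl)
  qed
  finally show False using sum_Legendre[OF p e] by simp
qed

section \<open>Solubility over the p-adic integers\<close>

lemma padic_solubleI:
  fixes p :: int
  assumes p: "p > 1"
    and x: "\<And>k. [x (Suc k) = x k] (mod p ^ k)"
    and y: "\<And>k. [y (Suc k) = y k] (mod p ^ k)"
    and z: "\<And>k. [z (Suc k) = z k] (mod p ^ k)"
    and nz: "\<not> p ^ j dvd x j \<or> \<not> p ^ j dvd y j"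
    and eq: "\<And>k. [(z k)\<^sup>2 = quartic a B c (x k) (y k)] (mod p ^ k)"
  shows "padic_soluble p B a c"
proof -
  have pad: "padic_int p (\<lambda>k. u k mod p ^ k)" if "\<And>k. [u (Suc k) = u k] (mod p ^ k)" for u
    unfolding padic_int_def
  proof (intro allI conjI)
    fix k
    show "0 \<le> u k mod p ^ k" "u k mod p ^ k < p ^ k" using p by auto
    have "u (Suc k) mod p ^ Suc k mod p ^ k = u (Suc k) mod p ^ k"
      by (rule mod_mod_cancel) simp
    then show "u (Suc k) mod p ^ Suc k mod p ^ k = u k mod p ^ k"
      using that[of k] by (simp add: cong_iff_mod_eq)
  qed
  have "[(z k mod p ^ k)\<^sup>2 = quartic a B c (x k mod p ^ k) (y k mod p ^ k)] (mod p ^ k)" for k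
  proof -
    have "[quartic a B c (x k) (y k) = quartic a B c (x k mod p ^ k) (y k mod p ^ k)] (mod p ^ k)"
      unfolding quartic_def
      by (intro cong_add cong_mult cong_pow cong_refl) (simp_all add: cong_iff_mod_eq)
    moreover have "[(z k mod p ^ k)\<^sup>2 = (z k)\<^sup>2] (mod p ^ k)"
      by (intro cong_pow) (simp add: cong_iff_mod_eq)
    ultimately show ?thesis using eq[of k] cong_trans by blast
  qed
  moreover have "x j mod p ^ j \<noteq> 0 \<or> y j mod p ^ j \<noteq> 0" using nz by (auto simp: mod_eq_0_iff_dvd)
  ultimately show ?thesis unfolding padic_soluble_def
    using pad[OF x] pad[OF y] pad[OF z] by blast
qed

text \<open>\<open>u\<close> is the square of a p-adic integer, given by compatible approximations
  that need not be reduced modulo \<open>p ^ k\<close>; the reduction is left to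
  \<open>padic_solubleI\<close>.\<close>

definition padic_square :: "int \<Rightarrow> int \<Rightarrow> bool" where
  "padic_square p u \<longleftrightarrow> (\<exists>r. (\<forall>k. [r (Suc k) = r k] (mod p ^ k)) \<and> (\<forall>k. [(r k)\<^sup>2 = u] (mod p ^ k)))"

text \<open>Hensel lifting: \<open>2 r\<close> is invertible modulo \<open>p\<close>, so a root
  modulo \<open>p ^ Suc k\<close> can be corrected by a multiple of
  \<open>p ^ Suc k\<close>.\<close>

lemma padic_square_odd:
  assumes p: "prime (p::nat)" "2 < p" and u: "Legendre u (int p) = 1"
  shows "padic_square (int p) u"
proof -
  define P where "P k r \<longleftrightarrow> [r\<^sup>2 = u] (mod int p ^ Suc k)" for k :: nat and r
  define Q where "Q k r r' \<longleftrightarrow> [r' = r] (mod int p ^ Suc k)" for k :: nat and r r' :: int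
  have nd: "\<not> int p dvd u" and qr: "QuadRes (int p) u" using Legendre_eq_1D[OF u] by auto
  have pp: "prime (int p)" using p by simp
  have "\<exists>f. \<forall>n. P n (f n) \<and> Q n (f n) (f (Suc n))"
  proof (rule dependent_nat_choice)
    show "\<exists>x. P 0 x" using qr by (auto simp: P_def QuadRes_def)
  next
    fix r k assume "P k r"
    then obtain t where t: "u - r\<^sup>2 = int p ^ Suc k * t"
      by (metis P_def cong_iff_dvd_diff cong_sym dvdE)
    have "\<not> int p dvd r"
    proof
      assume "int p dvd r"
      then have "int p dvd r\<^sup>2 + int p ^ Suc k * t" by (simp add: power2_eq_square)
      then show False using nd t by (metis add.commute diff_add_cancel)
    qed
    moreover have "\<not> int p dvd 2" using p zdvd_not_zless[of 2 "int p"] by auto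
    ultimately have "coprime (2 * r) (int p)"
      using pp by (metis coprime_commute prime_dvd_multD prime_imp_coprime_int)
    then obtain s where s: "[2 * r * s = 1] (mod int p)"
      using cong_solve_coprime_int by blast
    then have "[2 * r * s * t = 1 * t] (mod int p)" by (intro cong_mult cong_refl)
    then have d: "int p dvd t - 2 * r * s * t"
      by (simp add: cong_iff_dvd_diff dvd_diff_commute)
    \<comment> \<open>One Newton step: \<open>t\<close> is the defect divided by
      \<open>p ^ Suc k\<close>, and \<open>s\<close> is the inverse of \<open>2 r\<close> modulo
      \<open>p\<close>.\<close>
    define r' where "r' = r + int p ^ Suc k * (s * t)"
    have "u - r'\<^sup>2 = int p ^ Suc k * (t - 2 * r * s * t) - int p ^ (Suc k + Suc k) * (s * t)\<^sup>2"
      using t unfolding r'_def power_add by (simp add: algebra_simps power2_eq_square)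
    moreover have "int p ^ Suc (Suc k) dvd int p ^ Suc k * (t - 2 * r * s * t)"
      using d by (metis mult_dvd_mono dvd_refl power_Suc2)
    moreover have "int p ^ Suc (Suc k) dvd int p ^ (Suc k + Suc k)" by (rule le_imp_power_dvd) simp
    ultimately have "P (Suc k) r'"
      unfolding P_def by (metis cong_iff_dvd_diff cong_sym dvd_diff dvd_mult2)
    moreover have "Q k r r'" by (simp add: Q_def r'_def cong_iff_dvd_diff)
    ultimately show "\<exists>y. P (Suc k) y \<and> Q k r y" by blast
  qed
  then obtain f where f: "\<And>k. P k (f k)" "\<And>k. Q k (f k) (f (Suc k))" by blast
  have dv: "int p ^ k dvd int p ^ Suc k" for k by simp
  show ?thesis unfolding padic_square_def
    using f cong_dvd_modulus[OF _ dv] unfolding P_def Q_def by blast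
qed

text \<open>At 2 the derivative \<open>2 r\<close> costs one binary digit: the root is fixed modulo
  \<open>2 ^ (k + 2)\<close> when its square is right modulo \<open>2 ^ (k + 3)\<close>. As
  \<open>r\<close> is odd, adding \<open>2 ^ (k + 2)\<close> times the reduced defect
  \<open>t\<close> gains the next digit.\<close>

lemma padic_square_2:
  assumes u: "u mod 8 = 1"
  shows "padic_square 2 u"
proof -
  define P where "P k r \<longleftrightarrow> odd r \<and> [r\<^sup>2 = u] (mod 2 ^ (k + 3))" for k :: nat and r :: int
  define Q where "Q k r r' \<longleftrightarrow> [r' = r] (mod 2 ^ (k + 2))" for k :: nat and r r' :: int
  have "\<exists>f. \<forall>n. P n (f n) \<and> Q n (f n) (f (Suc n))"
  proof (rule dependent_nat_choice)
    show "\<exists>x. P 0 x" using u by (intro exI[of _ 1]) (auto simp: P_def cong_iff_mod_eq)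
  next
    fix r k assume P: "P k r"
    then obtain t where t: "u - r\<^sup>2 = 2 ^ (k + 3) * t"
      by (metis P_def cong_iff_dvd_diff cong_sym dvdE)
    define r' where "r' = r + 2 ^ (k + 2) * t"
    have "u - r'\<^sup>2 = 2 ^ (k + 3) * (t * (1 - r)) - 2 ^ (k + 4) * (2 ^ k * t\<^sup>2)"
      using t unfolding r'_def power_add by (simp add: algebra_simps power2_eq_square)
    moreover have "(2::int) ^ (k + 4) dvd 2 ^ (k + 3) * (t * (1 - r))"
    proof -
      have "(2::int) dvd t * (1 - r)" using P by (simp add: P_def)
      then have "(2::int) ^ (k + 3) * 2 dvd 2 ^ (k + 3) * (t * (1 - r))" by (intro mult_dvd_mono dvd_refl)
      then show ?thesis by (simp add: power_add)
    qed
    ultimately have "2 ^ (k + 4) dvd u - r'\<^sup>2" by (simp only:) (intro dvd_diff, auto)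
    then have "P (Suc k) r'" using P
      by (auto simp: P_def r'_def cong_iff_dvd_diff dvd_diff_commute add.commute)
    moreover have "Q k r r'" by (simp add: Q_def r'_def cong_iff_dvd_diff)
    ultimately show "\<exists>y. P (Suc k) y \<and> Q k r y" by blast
  qed
  then obtain f where f: "\<And>k. P k (f k)" "\<And>k. Q k (f k) (f (Suc k))" by blast
  have dv: "(2::int) ^ k dvd 2 ^ (k + j)" for k j by (simp add: power_add)
  show ?thesis unfolding padic_square_def
    using f cong_dvd_modulus[OF _ dv] unfolding P_def Q_def by blast
qed

lemma power_dvd_1: "p > 1 \<Longrightarrow> \<not> (p::int) ^ 1 dvd 1"
  using zdvd_not_zless[of 1 p] by auto

text \<open>The point is \<open>(1, 0)\<close>. The three lemmas that follow use
  \<open>(0, 1)\<close>, a zero of the form, and a general point \<open>(x, 1)\<close>.\<close>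

lemma padic_soluble_of_square_coeff:
  assumes "p > 1" "padic_square p d"
  shows "padic_soluble p 0 d c"
proof -
  obtain r where r: "\<And>k. [r (Suc k) = r k] (mod p ^ k)" "\<And>k. [(r k)\<^sup>2 = d] (mod p ^ k)"
    using assms unfolding padic_square_def by blast
  show ?thesis
    by (rule padic_solubleI[where x="\<lambda>_. 1" and y="\<lambda>_. 0" and z=r and j=1])
      (use assms r power_dvd_1[of p] in \<open>auto simp: quartic_def\<close>)
qed

lemma padic_soluble_of_neg_square_coeff:
  assumes "p > 1" "padic_square p (- d)"
  shows "padic_soluble p 0 d (- d * e\<^sup>2)"
proof -
  obtain r where r: "\<And>k. [r (Suc k) = r k] (mod p ^ k)" "\<And>k. [(r k)\<^sup>2 = - d] (mod p ^ k)"
    using assms unfolding padic_square_def by blast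
  have "[(e * r k)\<^sup>2 = - d * e\<^sup>2] (mod p ^ k)" for k
    using cong_mult[OF r(2)[of k] cong_refl[of "e\<^sup>2"]] by (simp add: power_mult_distrib mult.commute)
  then show ?thesis
    by (intro padic_solubleI[where x="\<lambda>_. 0" and y="\<lambda>_. 1" and z="\<lambda>k. e * r k" and j=1])
      (use assms r power_dvd_1[of p] in \<open>auto simp: quartic_def intro: cong_mult\<close>)
qed

text \<open>For \<open>f\<close> equal to \<open>e\<close> or \<open>- e\<close>, a square root
  \<open>x\<close> of \<open>f\<close> has \<open>x ^ 4 = e\<^sup>2\<close>, so the form vanishes at
  \<open>(x, 1)\<close>.\<close>

lemma padic_soluble_of_root:
  assumes "p > 1" "padic_square p f" "f\<^sup>2 = e\<^sup>2"
  shows "padic_soluble p 0 d (- d * e\<^sup>2)"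
proof -
  obtain r where r: "\<And>k. [r (Suc k) = r k] (mod p ^ k)" "\<And>k. [(r k)\<^sup>2 = f] (mod p ^ k)"
    using assms unfolding padic_square_def by blast
  have "[0\<^sup>2 = quartic d 0 (- d * e\<^sup>2) (r k) 1] (mod p ^ k)" for k
  proof -
    have "[d * ((r k)\<^sup>2)\<^sup>2 - d * e\<^sup>2 = d * f\<^sup>2 - d * e\<^sup>2] (mod p ^ k)"
      by (intro cong_diff cong_mult cong_pow r cong_refl)
    then show ?thesis using assms(3) by (simp add: quartic_def cong_sym power_mult[symmetric])
  qed
  then show ?thesis
    by (intro padic_solubleI[where x=r and y="\<lambda>_. 1" and z="\<lambda>_. 0" and j=1])
      (use assms r power_dvd_1[of p] in auto)
qed

lemma padic_soluble_of_value:
  assumes "p > 1" "padic_square p (d * (x ^ 4 - e\<^sup>2))"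
  shows "padic_soluble p 0 d (- d * e\<^sup>2)"
proof -
  obtain r where r: "\<And>k. [r (Suc k) = r k] (mod p ^ k)"
    "\<And>k. [(r k)\<^sup>2 = d * (x ^ 4 - e\<^sup>2)] (mod p ^ k)"
    using assms unfolding padic_square_def by blast
  show ?thesis
    by (rule padic_solubleI[where x="\<lambda>_. x" and y="\<lambda>_. 1" and z=r and j=1])
      (use assms r power_dvd_1[of p] in \<open>auto simp: quartic_def algebra_simps\<close>)
qed

lemma Legendre_pm_3_mod_4:
  assumes "prime (p::nat)" "p mod 4 = 3" "\<not> int p dvd a"
  shows "Legendre a (int p) = 1 \<or> Legendre (- a) (int p) = 1"
proof -
  have "2 < p" using assms prime_gt_1_nat[of p] by (cases "p = 2") auto
  then have "Legendre (- a) (int p) = - Legendre a (int p)"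
    using Legendre_mult[of p "-1" a] Legendre_minus_1(2)[of p] assms by simp
  then show ?thesis using Legendre_cases[of a p] Legendre_eq_0_iff[of a p] assms by auto
qed

text \<open>At infinity \<open>d\<close> is positive and at 2 it is a square. At p = 3 mod 4 one of
  \<open>a\<close> and \<open>- a\<close> is a residue as soon as \<open>p\<close> does not divide
  \<open>a\<close>, and \<open>p\<close> cannot divide both \<open>d\<close> and \<open>e\<close>.
  At p = 1 mod 4 the hypotheses settle the divisors of \<open>d e\<close>; if \<open>p\<close>
  divides neither factor and both are nonresidues, \<open>exists_quartic_nonresidue\<close> gives a
  point.\<close>

lemma locally_soluble_criterion:
  fixes d e :: nat
  assumes sf: "squarefree (d * e)" and d8: "d mod 8 = 1"
    and de: "\<And>p. prime p \<Longrightarrow> p mod 4 = 1 \<Longrightarrow> p dvd d \<Longrightarrow> Legendre (int e) (int p) = 1"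
    and ed: "\<And>p. prime p \<Longrightarrow> p mod 4 = 1 \<Longrightarrow> p dvd e \<Longrightarrow> Legendre (int d) (int p) = 1"
  shows "locally_soluble 0 (int d) (- int d * (int e)\<^sup>2)"
  unfolding locally_soluble_def
proof (intro conjI allI impI)
  show "real_soluble 0 (int d) (- int d * (int e)\<^sup>2)"
    unfolding real_soluble_def
    by (rule exI[of _ 1], rule exI[of _ 0], rule exI[of _ "sqrt (real d)"]) (simp add: quartic_def)
next
  fix q :: int assume q: "prime q"
  define p where "p = nat q"
  have pq: "q = int p" and pp: "prime p" and p1: "q > 1"
    using q prime_gt_1_int[OF q] by (auto simp: p_def)
  have cop: "\<not> (p dvd d \<and> p dvd e)"
  proof
    assume "p dvd d \<and> p dvd e"
    then have "p ^ 2 dvd d * e" by (auto simp: power2_eq_square intro: mult_dvd_mono)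
    then have "p dvd 1" using sf unfolding squarefree_def by blast
    then show False using pp by (simp add: prime_nat_iff)
  qed
  show "padic_soluble q 0 (int d) (- int d * (int e)\<^sup>2)"
  proof (cases "p = 2")
    case True
    have "int d mod 8 = 1" using d8 by presburger
    then show ?thesis using True pq padic_square_2 padic_soluble_of_square_coeff p1 by simp
  next
    case False
    then have p2: "2 < p" using pp prime_ge_2_nat[of p] by simp
    have sq: "padic_square q u" if "Legendre u q = 1" for u
      using padic_square_odd[OF pp p2] that pq by simp
    have p4: "p mod 4 = 1 \<or> p mod 4 = 3"
    proof -
      have "odd p" using pp p2 prime_odd_nat by blast
      then show ?thesis by presburger
    qed
    have case_d: ?thesis if "Legendre (int d) q = 1 \<or> Legendre (- int d) q = 1"
      using that sq padic_soluble_of_square_coeff padic_soluble_of_neg_square_coeff p1 by blast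
    have case_e: ?thesis if "Legendre (int e) q = 1 \<or> Legendre (- int e) q = 1"
      using that sq padic_soluble_of_root[OF p1] by (metis power2_minus)
    show ?thesis
    proof (cases "p mod 4 = 1")
      case True
      consider "p dvd d" | "p dvd e" | "\<not> p dvd d" "\<not> p dvd e" by blast
      then show ?thesis
      proof cases
        case 1 then show ?thesis using de[OF pp True] case_e pq by simp
      next
        case 2 then show ?thesis using ed[OF pp True] case_d pq by simp
      next
        case 3
        show ?thesis
        proof (cases "Legendre (int d) q = 1 \<or> Legendre (int e) q = 1")
          case True then show ?thesis using case_d case_e by blast
        next
          case f: False
          have "Legendre (int d) q = -1" "Legendre (int e) q = -1"
            using f 3 Legendre_cases[of "int d" q] Legendre_cases[of "int e" q]
              Legendre_eq_0_iff[of "int d" q] Legendre_eq_0_iff[of "int e" q] pq by auto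
          then obtain x where "Legendre (x ^ 4 - (int e)\<^sup>2) q = -1"
            using exists_quartic_nonresidue[OF pp p2 True, of "int e"] pq by auto
          then have "Legendre (int d * (x ^ 4 - (int e)\<^sup>2)) q = 1"
            using \<open>Legendre (int d) q = -1\<close> Legendre_mult[OF pp p2] pq by simp
          then show ?thesis using sq padic_soluble_of_value[OF p1] by blast
        qed
      qed
    next
      case False
      then have p3: "p mod 4 = 3" using p4 by simp
      consider "\<not> p dvd d" | "\<not> p dvd e" using cop by blast
      then show ?thesis
      proof cases
        case 1 then show ?thesis using Legendre_pm_3_mod_4[OF pp p3, of "int d"] case_d pq by simp
      next
        case 2 then show ?thesis using Legendre_pm_3_mod_4[OF pp p3, of "int e"] case_e pq by simp
      qed
    qed
  qed
qed

section \<open>Counting locally soluble forms\<close>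

text \<open>Under symmetric difference the finite subsets form a vector space over the field of two
  elements, and a product of signs is a character of it.\<close>

lemma prod_sign_sym_diff:
  fixes f :: "'a \<Rightarrow> int"
  assumes "finite A" "finite B" and f: "\<And>x. x \<in> A \<union> B \<Longrightarrow> f x = 1 \<or> f x = -1"
  shows "prod f ((A - B) \<union> (B - A)) = prod f A * prod f B"
proof -
  have "prod f (A \<inter> B) * prod f (A \<inter> B) = (\<Prod>x\<in>A \<inter> B. f x * f x)" by (simp add: prod.distrib)
  also have "\<dots> = (\<Prod>x\<in>A \<inter> B. 1)" by (intro prod.cong refl) (use f in fastforce)
  finally have sq: "prod f (A \<inter> B) * prod f (A \<inter> B) = 1" by simp
  have A: "prod f A = prod f (A \<inter> B) * prod f (A - B)" by (rule prod.Int_Diff) fact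
  have B: "prod f B = prod f (A \<inter> B) * prod f (B - A)"
    using prod.Int_Diff[OF assms(2), of f A] by (simp only: Int_commute)
  have "prod f ((A - B) \<union> (B - A)) = prod f (A - B) * prod f (B - A)"
    using assms by (intro prod.union_disjoint) auto
  also have "\<dots> = (prod f (A \<inter> B) * prod f (A \<inter> B)) * (prod f (A - B) * prod f (B - A))"
    by (simp only: sq mult_1)
  also have "\<dots> = prod f A * prod f B" unfolding A B by (simp only: mult_ac)
  finally show ?thesis .
qed

text \<open>Each sign condition at most halves the number of admissible subsets, since symmetric
  difference with a fixed violating set exchanges the two halves.\<close>

lemma card_sign_conditions:
  fixes f :: "'b \<Rightarrow> 'a \<Rightarrow> int"
  assumes "finite S" and P: "finite P"
    and "\<And>s x. s \<in> S \<Longrightarrow> x \<in> P \<Longrightarrow> f s x = 1 \<or> f s x = -1"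
  shows "2 ^ card P \<le> 2 ^ card S * card {A. A \<subseteq> P \<and> (\<forall>s\<in>S. prod (f s) A = 1)}"
  using assms(1,3)
proof (induction S)
  case empty
  have "{A. A \<subseteq> P} = Pow P" by auto
  then show ?case using P by (simp add: card_Pow)
next
  case (insert s S)
  define K where "K = {A. A \<subseteq> P \<and> (\<forall>s\<in>S. prod (f s) A = 1)}"
  define K1 where "K1 = {A \<in> K. prod (f s) A = 1}"
  have fK: "finite K" unfolding K_def using P by simp
  have IH: "2 ^ card P \<le> 2 ^ card S * card K" using insert unfolding K_def by auto
  have fin: "finite A" if "A \<in> K" for A using that P finite_subset unfolding K_def by auto
  have sd: "prod (f t) ((A - B) \<union> (B - A)) = prod (f t) A * prod (f t) B"
    if "A \<in> K" "B \<in> K" "t \<in> insert s S" for A B t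
  proof -
    have fs: "f t x = 1 \<or> f t x = -1" if "x \<in> P" for x using insert.prems that \<open>t \<in> insert s S\<close> by blast
    show ?thesis by (intro prod_sign_sym_diff fin fs) (use that in \<open>auto simp: K_def\<close>)
  qed
  have pm: "prod (f s) A = 1 \<or> prod (f s) A = -1" if "A \<in> K" for A
  proof -
    have "\<bar>prod (f s) A\<bar> = (\<Prod>x\<in>A. \<bar>f s x\<bar>)" by (rule abs_prod)
    also have "\<dots> = 1" by (intro prod.neutral) (use that insert.prems in \<open>fastforce simp: K_def\<close>)
    finally show ?thesis by linarith
  qed
  have "card (K - K1) \<le> card K1"
  proof (cases "K - K1 = {}")
    case False
    then obtain A0 where A0: "A0 \<in> K" "A0 \<notin> K1" by blast
    then have A0': "prod (f s) A0 = -1" using pm unfolding K1_def by auto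
    show ?thesis
    proof (rule card_inj_on_le[where f="\<lambda>A. (A - A0) \<union> (A0 - A)"])
      show "inj_on (\<lambda>A. (A - A0) \<union> (A0 - A)) (K - K1)" by (rule inj_onI) blast
      show "finite K1" using fK unfolding K1_def by simp
      show "(\<lambda>A. (A - A0) \<union> (A0 - A)) ` (K - K1) \<subseteq> K1"
      proof (rule image_subsetI)
        fix A assume A: "A \<in> K - K1"
        then have "prod (f s) A = -1" using pm unfolding K1_def by auto
        then have "prod (f s) ((A - A0) \<union> (A0 - A)) = 1" using sd[of A A0 s] A A0 A0' by auto
        moreover have "(A - A0) \<union> (A0 - A) \<in> K"
          using sd[of A A0] A A0 unfolding K_def by auto
        ultimately show "(A - A0) \<union> (A0 - A) \<in> K1" unfolding K1_def by simp
      qed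
    qed
  next
    case True
    then show ?thesis by (simp only: card.empty)
  qed
  then have "card K \<le> 2 * card K1"
    using card_Diff_subset[of K1 K] fK card_mono[of K K1] unfolding K1_def by auto
  then have "2 ^ card P \<le> 2 ^ card S * (2 * card K1)" using IH by (meson mult_le_mono2 order_trans)
  moreover have "K1 = {A. A \<subseteq> P \<and> (\<forall>t\<in>insert s S. prod (f t) A = 1)}"
    unfolding K1_def K_def by auto
  ultimately show ?case using insert by (simp add: mult.assoc mult.left_commute)
qed

lemma finite_FB: "M \<noteq> 0 \<Longrightarrow> finite (FB B M)"
proof -
  assume M: "M \<noteq> 0"
  have "FB B M \<subseteq> (\<lambda>a. (a, M div a)) ` {a. a dvd M}"
    using M by (auto simp: FB_def image_iff)
  then show ?thesis using finite_divisors_int[OF M] finite_subset by blast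
qed

text \<open>The sign is the symbol of -1, the one of the next lemma that of 2. If both are 1 on
  \<open>d\<close>, then \<open>d\<close> is 1 modulo 4 and 1 or 7 modulo 8, hence 1 modulo
  8.\<close>

lemma prod_mod_4_sign:
  assumes "finite A" "\<And>q. q \<in> A \<Longrightarrow> odd (q::nat)"
  shows "(\<Prod>q\<in>A. if q mod 4 = 1 then 1 else - 1 :: int) = (if (\<Prod>A) mod 4 = 1 then 1 else -1) \<and> odd (\<Prod>A)"
  using assms
proof (induction A)
  case (insert x F)
  have "(x * \<Prod>F) mod 4 = ((x mod 4) * ((\<Prod>F) mod 4)) mod 4" by (simp add: mod_mult_eq)
  moreover have x: "odd x" using insert.prems by blast
  then have "x mod 4 = 1 \<or> x mod 4 = 3" by presburger
  moreover have o: "odd (\<Prod>F)" using insert by simp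
  then have "(\<Prod>F) mod 4 = 1 \<or> (\<Prod>F) mod 4 = 3" by presburger
  ultimately have "(x * \<Prod>F) mod 4 = 1 \<longleftrightarrow> (x mod 4 = 1 \<longleftrightarrow> (\<Prod>F) mod 4 = 1)"
    by (elim disjE) simp_all
  moreover have "(\<Prod>q\<in>F. if q mod 4 = 1 then 1 else - 1 :: int) = (if (\<Prod>F) mod 4 = 1 then 1 else -1)"
    using insert.IH insert.prems by blast
  ultimately show ?case using insert.hyps o x by simp
qed auto

lemma prod_mod_8_sign:
  assumes "finite A" "\<And>q. q \<in> A \<Longrightarrow> odd (q::nat)"
  shows "(\<Prod>q\<in>A. if q mod 8 \<in> {1, 7} then 1 else - 1 :: int) = (if (\<Prod>A) mod 8 \<in> {1, 7} then 1 else -1) \<and> odd (\<Prod>A)"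
  using assms
proof (induction A)
  case (insert x F)
  have "(x * \<Prod>F) mod 8 = ((x mod 8) * ((\<Prod>F) mod 8)) mod 8" by (simp add: mod_mult_eq)
  moreover have "x mod 8 = 1 \<or> x mod 8 = 3 \<or> x mod 8 = 5 \<or> x mod 8 = 7"
    using insert.prems[of x] by (simp, presburger)
  moreover have o: "odd (\<Prod>F)" using insert by simp
  then have "(\<Prod>F) mod 8 = 1 \<or> (\<Prod>F) mod 8 = 3 \<or> (\<Prod>F) mod 8 = 5 \<or> (\<Prod>F) mod 8 = 7"
    by presburger
  ultimately have "(x * \<Prod>F) mod 8 \<in> {1, 7} \<longleftrightarrow> (x mod 8 \<in> {1, 7} \<longleftrightarrow> (\<Prod>F) mod 8 \<in> {1, 7})"
    by (elim disjE) simp_all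
  moreover have "odd x" using insert.prems by blast
  moreover have "(\<Prod>q\<in>F. if q mod 8 \<in> {1, 7} then 1 else - 1 :: int) = (if (\<Prod>F) mod 8 \<in> {1, 7} then 1 else -1)"
    using insert.IH insert.prems by blast
  ultimately show ?case using insert.hyps o by (simp del: insert_iff)
qed auto

lemma prime_dvd_prod_primes_iff:
  assumes "finite A" "\<And>q. q \<in> A \<Longrightarrow> prime (q::nat)" "prime p"
  shows "p dvd \<Prod>A \<longleftrightarrow> p \<in> A"
  using assms prime_dvd_prod_iff[of A p "\<lambda>x. x"] primes_dvd_imp_eq[of p] by auto

lemma prod_primes_dvd:
  assumes "finite A" "\<And>q. q \<in> A \<Longrightarrow> prime (q::nat) \<and> q dvd n"
  shows "\<Prod>A dvd n"
  using assms
proof (induction A)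
  case (insert x F)
  have "coprime x (\<Prod>F)"
    using insert prime_dvd_prod_primes_iff[of F x] by (intro prime_imp_coprime) auto
  then show ?case using insert by (simp add: divides_mult)
qed auto

lemma Legendre_prod:
  assumes "prime (p::nat)" "2 < p"
  shows "Legendre (\<Prod>x\<in>A. g x) (int p) = (\<Prod>x\<in>A. Legendre (g x) (int p))"
  using assms by (induction A rule: infinite_finite_induct) (auto simp: Legendre_mult Legendre_1)

lemma squarefree_int_iff: "squarefree (int d) \<longleftrightarrow> squarefree d"
proof
  assume a: "squarefree (int d)"
  show "squarefree d" unfolding squarefree_def
  proof (intro allI impI)
    fix x assume "x\<^sup>2 dvd d"
    then have "(int x)\<^sup>2 dvd int d" by (metis of_nat_dvd_iff of_nat_power)
    then show "x dvd 1" using a unfolding squarefree_def by (metis of_nat_1 of_nat_dvd_iff)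
  qed
next
  assume a: "squarefree d"
  show "squarefree (int d)" unfolding squarefree_def
  proof (intro allI impI)
    fix x assume "x\<^sup>2 dvd int d"
    then have "(nat \<bar>x\<bar>)\<^sup>2 dvd d"
      by (metis nat_abs_dvd_iff nat_power_eq abs_ge_zero power2_abs nat_int nat_dvd_iff zero_le_power2 abs_of_nonneg)
    then have "nat \<bar>x\<bar> dvd 1" using a unfolding squarefree_def by blast
    then show "x dvd 1" by auto
  qed
qed

lemma mem_FB_iff: "M \<noteq> 0 \<Longrightarrow> (a, c) \<in> FB B M \<longleftrightarrow> a * c = M \<and> squarefree a"
  by (auto simp: FB_def squarefree_factorial_semiring'')

text \<open>A form comes from a set of odd primes dividing \<open>n\<close>, whose product is taken
  as the positive divisor \<open>d\<close>; a factor 2 of \<open>n\<close> always goes to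
  \<open>e\<close>. The \<open>card P\<close> primes are subject to at most
  \<open>2 + card P1\<close> sign conditions, which leaves 2 to the number of primes 3 mod 4, up to
  the factor 4.\<close>

proposition card_FB_ls_ge:
  assumes n: "squarefree n" "n > 0"
  shows "2 ^ card {p. prime p \<and> p dvd n \<and> p mod 4 = 3} \<le> 4 * card (FB_ls 0 (- (int n)\<^sup>2))"
proof -
  define P where "P = {p. prime p \<and> p dvd n \<and> p \<noteq> 2}"
  define P1 where "P1 = {p\<in>P. p mod 4 = 1}"
  define P3 where "P3 = {p. prime p \<and> p dvd n \<and> p mod 4 = 3}"
  define S where "S = {0,1} \<union> P1"
  \<comment> \<open>The indices 0 and 1 carry the two conditions modulo 8 and collide with no prime.
    For a prime \<open>s\<close> outside the set the product over the set is the symbol of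
    \<open>d\<close> modulo \<open>s\<close>. For \<open>s\<close> inside, the entry at
    \<open>q = s\<close> is the symbol of \<open>n div s\<close>; in the product the remaining part
    of \<open>d\<close> appears squared and only the symbol of \<open>e\<close> survives.\<close>
  define f :: "nat \<Rightarrow> nat \<Rightarrow> int" where "f s q =
     (if s = 0 then (if q mod 4 = 1 then 1 else - 1)
      else if s = 1 then (if q mod 8 \<in> {1, 7} then 1 else - 1)
      else if q = s then Legendre (int (n div s)) (int s) else Legendre (int q) (int s))" for s q
  have finP: "finite P" unfolding P_def using n by (auto intro: finite_subset[OF _ finite_divisors_nat[of n]])
  have pP: "prime q" "q dvd n" "odd q" "q > 2" if "q \<in> P" for q
    using that prime_odd_nat[of q] prime_ge_2_nat[of q] unfolding P_def by auto
  have fin1: "finite P1" using finP unfolding P1_def by auto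
  have P1_01: "p \<noteq> 0" "p \<noteq> 1" if "p \<in> P1" for p using that pP(4)[of p] unfolding P1_def by auto
  have "P = P1 \<union> P3" "P1 \<inter> P3 = {}" "finite P3"
  proof -
    have "p mod 4 = 1 \<or> p mod 4 = 3" if "p \<in> P" for p using pP(3)[OF that] by presburger
    then show u: "P = P1 \<union> P3" unfolding P1_def P3_def P_def by auto
    show "P1 \<inter> P3 = {}" unfolding P1_def P3_def by auto
    show "finite P3" using finP u by auto
  qed
  then have cP: "card P = card P1 + card P3" using fin1 by (simp add: card_Un_disjoint)
  have "card S \<le> 2 + card P1" unfolding S_def
    using card_Un_le[of "{0,1::nat}" P1] by auto
  define K where "K = {A. A \<subseteq> P \<and> (\<forall>s\<in>S. prod (f s) A = 1)}"
  have nsq: "\<not> p dvd n div p" if "p \<in> P" for p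
  proof
    assume "p dvd n div p"
    then have "p * p dvd p * (n div p)" by (intro mult_dvd_mono) auto
    then have "p ^ 2 dvd n" using pP(2)[OF that] by (simp add: power2_eq_square)
    then have "p dvd 1" using n unfolding squarefree_def by blast
    then show False using pP(1)[OF that] by auto
  qed
  have fpm: "f s x = 1 \<or> f s x = -1" if "s \<in> S" "x \<in> P" for s x
  proof (cases "s = 0 \<or> s = 1")
    case True then show ?thesis by (auto simp: f_def)
  next
    case False
    then have s: "s \<in> P" using that unfolding S_def P1_def by auto
    have "\<not> s dvd x" if "x \<noteq> s" using that pP(1)[OF s] pP(1)[OF \<open>x \<in> P\<close>] primes_dvd_imp_eq by blast
    then have "f s x \<noteq> 0" using False nsq[OF s] by (auto simp: f_def Legendre_eq_0_iff)
    then show ?thesis using False Legendre_cases[of "int (n div s)" "int s"] Legendre_cases[of "int x" "int s"]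
      by (auto simp: f_def)
  qed
  have K: "2 ^ card P \<le> 2 ^ card S * card K"
    unfolding K_def by (rule card_sign_conditions) (use finP fin1 fpm in \<open>auto simp: S_def\<close>)
  define h where "h A = (int (\<Prod>A), - int (\<Prod>A) * (int (n div \<Prod>A))\<^sup>2)" for A :: "nat set"
  have M0: "- (int n)\<^sup>2 \<noteq> 0" using n by simp
  have "card K \<le> card (FB_ls 0 (- (int n)\<^sup>2))"
  proof (rule card_inj_on_le[where f=h])
    show "inj_on h K"
    proof (rule inj_onI)
      fix A B assume A: "A \<in> K" and B: "B \<in> K" and "h A = h B"
      then have "\<Prod>A = \<Prod>B" unfolding h_def by (simp del: of_nat_prod)
      moreover have "C = {p. prime p \<and> p dvd \<Prod>C}" if "C \<in> K" for C
      proof -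
        have "C \<subseteq> P" using that unfolding K_def by simp
        then have "finite C" "\<And>q. q \<in> C \<Longrightarrow> prime q" using finP finite_subset pP(1) by blast+
        then show ?thesis using prime_dvd_prod_primes_iff[of C] by auto
      qed
      ultimately show "A = B" using A B by metis
    qed
    show "finite (FB_ls 0 (- (int n)\<^sup>2))"
      using finite_FB[OF M0] by (rule rev_finite_subset) (auto simp: FB_ls_def)
    show "h ` K \<subseteq> FB_ls 0 (- (int n)\<^sup>2)"
    proof (rule image_subsetI)
      fix A assume A: "A \<in> K"
      then have AP: "A \<subseteq> P" and k: "\<And>s. s \<in> S \<Longrightarrow> prod (f s) A = 1" unfolding K_def by auto
      have fA: "finite A" using AP finP finite_subset by blast
      define d where "d = \<Prod>A"
      define e where "e = n div d"
      have "d dvd n" unfolding d_def using fA AP pP by (intro prod_primes_dvd) auto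
      then have de: "n = d * e" unfolding e_def by simp
      have odd: "\<And>q. q \<in> A \<Longrightarrow> odd q" using AP pP by blast
      have "(\<Prod>q\<in>A. if q mod 4 = 1 then 1 else - 1 :: int) = 1"
        using k[of 0] by (simp add: S_def f_def)
      then have d4: "d mod 4 = 1" using prod_mod_4_sign[OF fA odd] unfolding d_def by (auto split: if_splits)
      have "(\<Prod>q\<in>A. if q mod 8 \<in> {1, 7} then 1 else - 1 :: int) = 1"
        using k[of 1] by (simp add: S_def f_def)
      then have "d mod 8 \<in> {1, 7}" using prod_mod_8_sign[OF fA odd] unfolding d_def by (auto split: if_splits)
      then have d8: "d mod 8 = 1" using d4 by (simp, presburger)
      have L: "Legendre (int e) (int p) = 1" if p: "prime p" "p mod 4 = 1" "p dvd d" for p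
      proof -
        have pA: "p \<in> A" using p fA AP pP unfolding d_def
          by (subst (asm) prime_dvd_prod_primes_iff) auto
        then have pS: "p \<in> P1" using p AP unfolding P1_def by auto
        have p2: "2 < p" using pP(4) pA AP by blast
        define d' where "d' = \<Prod>(A - {p})"
        have dd: "d = p * d'" unfolding d_def d'_def using pA fA by (simp add: prod.remove)
        have np: "n div p = d' * e" using de dd p by (simp add: mult.assoc)
        have "1 = f p p * prod (f p) (A - {p})" using k[of p] pA fA pS by (simp add: S_def prod.remove)
        also have "prod (f p) (A - {p}) = (\<Prod>q\<in>A - {p}. Legendre (int q) (int p))"
          using P1_01[OF pS] by (intro prod.cong refl) (auto simp: f_def)
        also have "\<dots> = Legendre (int d') (int p)"
          using Legendre_prod[OF p(1) p2, of int "A - {p}"] unfolding d'_def by simp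
        also have "f p p = Legendre (int d') (int p) * Legendre (int e) (int p)"
          using P1_01[OF pS] np Legendre_mult[OF p(1) p2] by (simp add: f_def)
        finally have "Legendre (int d') p * Legendre (int d') p * Legendre (int e) p = 1" by (simp add: mult.assoc mult.left_commute mult.commute)
        then show ?thesis
          using Legendre_cases[of "int d'" p] by auto
      qed
      have R: "Legendre (int d) (int p) = 1" if p: "prime p" "p mod 4 = 1" "p dvd e" for p
      proof -
        have "\<not> p dvd d"
        proof
          assume "p dvd d"
          then have "p ^ 2 dvd n" using p de by (auto simp: power2_eq_square intro: mult_dvd_mono)
          then have "p dvd 1" using n unfolding squarefree_def by blast
          then show False using p by auto
        qed
        then have pA: "p \<notin> A" unfolding d_def using fA by (auto intro: dvd_prodI)
        have pS: "p \<in> P1" using p de unfolding P1_def P_def by auto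
        then have p2: "2 < p" using pP(4) unfolding P1_def by auto
        have "1 = prod (f p) A" using k[of p] pS by (simp add: S_def)
        also have "\<dots> = (\<Prod>q\<in>A. Legendre (int q) (int p))"
          using P1_01[OF pS] pA by (intro prod.cong refl) (auto simp: f_def)
        also have "\<dots> = Legendre (int d) (int p)"
          using Legendre_prod[OF p(1) p2, of int A] unfolding d_def by simp
        finally show ?thesis by simp
      qed
      have "locally_soluble 0 (int d) (- int d * (int e)\<^sup>2)"
        by (rule locally_soluble_criterion) (use n de d8 L R in auto)
      moreover have "int d * (- int d * (int e)\<^sup>2) = - (int n)\<^sup>2"
        by (simp add: de power2_eq_square)
      moreover have "squarefree (int d)" using n de squarefree_multD by (auto simp: squarefree_int_iff)
      ultimately show "h A \<in> FB_ls 0 (- (int n)\<^sup>2)"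
        unfolding FB_ls_def h_def d_def[symmetric] e_def[symmetric] by (simp add: mem_FB_iff[OF M0])
    qed
  qed
  then have "2 ^ card P \<le> 2 ^ card S * card (FB_ls 0 (- (int n)\<^sup>2))"
    using K by (meson mult_le_mono2 order_trans)
  also have "\<dots> \<le> 2 ^ (2 + card P1) * card (FB_ls 0 (- (int n)\<^sup>2))"
    using \<open>card S \<le> 2 + card P1\<close> by (intro mult_right_mono power_increasing) auto
  finally have "2 ^ card P1 * 2 ^ card P3 \<le> 2 ^ card P1 * (4 * card (FB_ls 0 (- (int n)\<^sup>2)))"
    by (simp add: cP power_add)
  then show ?thesis unfolding P3_def by simp
qed

section \<open>Primes congruent to 3 modulo 4\<close>

text \<open>The integers built from the primes of \<open>insert p P\<close> are those built from
  \<open>P\<close> together with \<open>p\<close> times all of them, so a new prime multiplies the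
  sum by the inverse of \<open>1 - f p\<close>. Absolute convergence allows summation over any
  subset.\<close>

lemma finite_euler_product:
  fixes f :: "nat \<Rightarrow> real"
  assumes f1: "f 1 = 1" and fm: "\<And>a b. f (a * b) = f a * f b"
    and sm: "(\<lambda>n. norm (f n)) summable_on {1..}"
    and P: "finite P" "\<And>p. p \<in> P \<Longrightarrow> prime p"
  shows "infsum f {n. n > 0 \<and> prime_factors n \<subseteq> P} * (\<Prod>p\<in>P. 1 - f p) = 1"
  using P
proof (induction P)
  case empty
  have "{n::nat. n > 0 \<and> prime_factors n \<subseteq> {}} = {1}"
    by (auto simp: prime_factorization_empty_iff)
  then show ?case using f1 by simp
next
  case (insert p P)
  define S where "S = {n. n > 0 \<and> prime_factors n \<subseteq> P}"
  define S' where "S' = {n. n > 0 \<and> prime_factors n \<subseteq> insert p P}"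
  have pp: "prime p" using insert by simp
  have p0: "p > 0" using pp prime_gt_0_nat by blast
  have pf: "prime_factors (p * n) = insert p (prime_factors n)" if "n > 0" for n
    using that p0 pp by (simp add: prime_factors_product prime_prime_factors)
  have sub: "S \<subseteq> {1..}" "S' \<subseteq> {1..}" unfolding S_def S'_def by auto
  have smS: "f summable_on A" if "A \<subseteq> {1..}" for A
    using sm that abs_summable_summable summable_on_subset_banach by blast
  have S': "S' = S \<union> (\<lambda>n. p * n) ` S'"
  proof (intro equalityI subsetI)
    fix n assume n: "n \<in> S'"
    show "n \<in> S \<union> (\<lambda>n. p * n) ` S'"
    proof (cases "p dvd n")
      case True
      then obtain m where m: "n = p * m" by blast
      then have "m \<in> S'" using n pf[of m] unfolding S'_def by auto
      then show ?thesis using m by blast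
    next
      case False
      then have "n \<in> S" using n unfolding S_def S'_def by (auto simp: in_prime_factors_iff)
      then show ?thesis by blast
    qed
  next
    fix n assume "n \<in> S \<union> (\<lambda>n. p * n) ` S'"
    then show "n \<in> S'" using pf p0 unfolding S_def S'_def by auto
  qed
  have disj: "S \<inter> (\<lambda>n. p * n) ` S' = {}"
  proof -
    have "p \<notin> prime_factors n" if "n \<in> S" for n using that insert unfolding S_def by blast
    moreover have "p \<in> prime_factors (p * n)" if "n \<in> S'" for n using that pf[of n] unfolding S'_def by auto
    ultimately show ?thesis by blast
  qed
  have sub2: "(\<lambda>n. p * n) ` S' \<subseteq> {1..}" using sub S' by blast
  have "infsum f S' = infsum f S + infsum f ((\<lambda>n. p * n) ` S')"
    using infsum_Un_disjoint[OF smS[OF sub(1)] smS[OF sub2] disj] S' by simp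
  also have "infsum f ((\<lambda>n. p * n) ` S') = infsum (f \<circ> (\<lambda>n. p * n)) S'"
    using p0 by (intro infsum_reindex) (auto simp: inj_on_def)
  also have "\<dots> = f p * infsum f S'" by (simp add: o_def fm infsum_cmult_right')
  finally have e: "infsum f S' = infsum f S + f p * infsum f S'" .
  have "infsum f S' * (1 - f p) = infsum f S' - f p * infsum f S'" by (simp add: right_diff_distrib mult.commute)
  also have "\<dots> = infsum f S" using e by linarith
  finally have "infsum f S' * (1 - f p) = infsum f S" .
  then have "infsum f S' * (\<Prod>q\<in>insert p P. 1 - f q) = infsum f S * (\<Prod>q\<in>P. 1 - f q)"
    using insert by simp
  also have "\<dots> = 1" using insert.IH insert.prems unfolding S_def by simp
  finally show ?case unfolding S'_def .
qed

text \<open>Takes the place of comparing with an integral over the interval from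
  \<open>n - 1\<close> to \<open>n\<close>; the input is the Bernoulli type inequality
  \<open>1 + e x \<le> (1 - x) powr (- e)\<close> at \<open>x = 1 / n\<close>.\<close>

lemma powr_telescope_bound:
  fixes e :: real
  assumes "e > 0" "n \<ge> 2"
  shows "real n powr (- 1 - e) \<le> (real (n - 1) powr (- e) - real n powr (- e)) / e"
proof -
  define x where "x = 1 / real n"
  have x: "0 < x" "x < 1" using assms unfolding x_def by auto
  have r: "real (n - 1) = real n * (1 - x)" using assms unfolding x_def by (simp add: field_simps of_nat_diff)
  have "1 + e * x \<le> exp (e * x)" by (rule exp_ge_add_one_self)
  also have "exp (e * x) \<le> (1 - x) powr (- e)"
  proof -
    have "x \<le> - ln (1 - x)" using ln_le_minus_one[of "1 - x"] x by simp
    then have "e * x \<le> e * (- ln (1 - x))" using assms by (intro mult_left_mono) auto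
    then show ?thesis using x by (simp add: powr_def)
  qed
  finally have "1 + e * x \<le> (1 - x) powr (- e)" .
  then have "real n powr (- e) * (1 + e * x) \<le> real n powr (- e) * (1 - x) powr (- e)"
    by (intro mult_left_mono) auto
  also have "\<dots> = real (n - 1) powr (- e)" using r x by (simp add: powr_mult)
  finally have "e * (real n powr (- e) * x) \<le> real (n - 1) powr (- e) - real n powr (- e)"
    by (simp add: algebra_simps)
  moreover have "real n powr (- e) * x = real n powr (- 1 - e)"
  proof -
    have "- 1 - e = - e + - 1" by simp
    then have "real n powr (- 1 - e) = real n powr (- e) * real n powr (- 1)" by (simp only: powr_add)
    also have "real n powr (- 1) = x" unfolding x_def using assms by (intro powr_neg_one) auto
    finally show ?thesis by simp
  qed
  ultimately show ?thesis using assms by (simp add: field_simps)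
qed

text \<open>Stated for arbitrary finite sets beyond \<open>y\<close>, so that it yields the
  summability of the tail as well as its size.\<close>

lemma sum_powr_tail:
  fixes e :: real
  assumes "e > 0" "y \<ge> 1" "finite F" "F \<subseteq> {y<..}"
  shows "(\<Sum>n\<in>F. real n powr (- 1 - e)) \<le> real y powr (- e) / e"
proof -
  define N where "N = Max (insert y F)"
  have N: "y \<le> N" "F \<subseteq> {Suc y..N}" using assms unfolding N_def by auto
  have "(\<Sum>n\<in>F. real n powr (- 1 - e)) \<le> (\<Sum>n\<in>{Suc y..N}. real n powr (- 1 - e))"
    using N by (intro sum_mono2) auto
  also have "\<dots> \<le> (\<Sum>n\<in>{Suc y..N}. (real (n - 1) powr (- e) - real n powr (- e)) / e)"
    using assms by (intro sum_mono powr_telescope_bound) auto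
  also have "\<dots> = (\<Sum>n\<in>{Suc y..N}. - (real n powr (- e) / e) - (- (real (n - 1) powr (- e) / e)))"
    by (intro sum.cong refl) (simp add: diff_divide_distrib)
  also have "\<dots> = - (real N powr (- e) / e) - (- (real y powr (- e) / e))"
    by (rule sum_telescope''[OF N(1)])
  also have "\<dots> \<le> real y powr (- e) / e" using assms by simp
  finally show ?thesis .
qed

definition chi4 :: "nat \<Rightarrow> real" where
  "chi4 n = (if even n then 0 else if n mod 4 = 1 then 1 else -1)"

lemma chi4_mult: "chi4 (a * b) = chi4 a * chi4 b"
proof -
  have "(a * b) mod 4 = (a mod 4) * (b mod 4) mod 4" by (simp add: mod_mult_eq)
  moreover have "even a \<or> a mod 4 = 1 \<or> a mod 4 = 3" "even b \<or> b mod 4 = 1 \<or> b mod 4 = 3"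
    by presburger+
  ultimately show ?thesis unfolding chi4_def by auto
qed

lemma chi4_eq:
  "n mod 4 = 1 \<Longrightarrow> chi4 n = 1" "n mod 4 = 3 \<Longrightarrow> chi4 n = -1"
  "n mod 4 = 0 \<Longrightarrow> chi4 n = 0" "n mod 4 = 2 \<Longrightarrow> chi4 n = 0"
proof -
  show "n mod 4 = 1 \<Longrightarrow> chi4 n = 1" by (subgoal_tac "odd n") (simp add: chi4_def, presburger)
  show "n mod 4 = 3 \<Longrightarrow> chi4 n = -1" by (subgoal_tac "odd n") (simp add: chi4_def, presburger)
  show "n mod 4 = 0 \<Longrightarrow> chi4 n = 0" by (subgoal_tac "even n") (simp add: chi4_def, presburger)
  show "n mod 4 = 2 \<Longrightarrow> chi4 n = 0" by (subgoal_tac "even n") (simp add: chi4_def, presburger)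
qed

lemma abs_chi4_le: "\<bar>chi4 n\<bar> \<le> 1" unfolding chi4_def by auto

text \<open>The second conjunct is the invariant that carries the induction: after 3 or 0 modulo 4
  the next nonzero term is positive, and the room left below 1 must already cover it.\<close>

lemma sum_chi4_le_1:
  fixes g :: "nat \<Rightarrow> real"
  assumes g1: "g 1 \<le> 1" and dec: "\<And>n. n \<ge> 1 \<Longrightarrow> g (Suc n) \<le> g n" and pos: "\<And>n. g n \<ge> 0"
  shows "(\<Sum>n\<in>{1..N}. chi4 n * g n) \<le> 1 \<and>
    (N mod 4 \<in> {0, 3} \<longrightarrow> (\<Sum>n\<in>{1..N}. chi4 n * g n) + g (Suc N) \<le> 1)"
proof (induction N)
  case 0 then show ?case using g1 by simp
next
  case (Suc N)
  define s where "s = (\<Sum>n\<in>{1..N}. chi4 n * g n)"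
  have S: "(\<Sum>n\<in>{1..Suc N}. chi4 n * g n) = s + chi4 (Suc N) * g (Suc N)" by (simp add: s_def)
  have d: "g (Suc (Suc N)) \<le> g (Suc N)" using dec by simp
  consider "N mod 4 = 0" | "N mod 4 = 1" | "N mod 4 = 2" | "N mod 4 = 3" by linarith
  then show ?case
  proof cases
    case 1
    then have m: "Suc N mod 4 = 1" by presburger
    then have "chi4 (Suc N) = 1" by (rule chi4_eq)
    with m show ?thesis using Suc 1 unfolding S by (simp add: s_def)
  next
    case 2
    then have m: "Suc N mod 4 = 2" by presburger
    then have "chi4 (Suc N) = 0" by (rule chi4_eq)
    with m show ?thesis using Suc 2 unfolding S by (simp add: s_def)
  next
    case 3
    then have m: "Suc N mod 4 = 3" by presburger
    then have "chi4 (Suc N) = -1" by (rule chi4_eq)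
    with m show ?thesis using Suc 3 d pos[of "Suc N"] unfolding S by (simp add: s_def)
  next
    case 4
    then have m: "Suc N mod 4 = 0" by presburger
    then have "chi4 (Suc N) = 0" by (rule chi4_eq)
    with m show ?thesis using Suc 4 d unfolding S by (simp add: s_def)
  qed
qed

text \<open>Comparison of the Euler products of the zeta function and of the L-function of \<open>chi4\<close> at \<open>1 + e\<close>:
  their quotient is essentially a product of \<open>(1 + t) / (1 - t) \<le> exp (3 * t)\<close> over the primes
  3 mod 4, while the L-series is bounded because its partial sums alternate.\<close>

lemma sum_powr_le_exp_sum_primes_3_mod_4:
  fixes e :: real
  assumes e: "e > 0" and y: "y \<ge> 1" and tail: "real y powr (- e) / e \<le> 1"
  shows "(\<Sum>n\<in>{1..y}. real n powr (- 1 - e))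
      \<le> 4 * exp (3 * (\<Sum>p | prime p \<and> p mod 4 = 3 \<and> p \<le> y. 1 / real p))"
proof -
  define g where "g n = real n powr (- 1 - e)" for n :: nat
  define P where "P = {p::nat. prime p \<and> p \<le> y}"
  define S where "S = {n::nat. n > 0 \<and> prime_factors n \<subseteq> P}"
  define Q where "Q = {p::nat. prime p \<and> p mod 4 = 3 \<and> p \<le> y}"
  have finP: "finite P" unfolding P_def by simp
  have pP: "\<And>p. p \<in> P \<Longrightarrow> prime p" unfolding P_def by simp
  have g0: "g n \<ge> 0" for n unfolding g_def by simp
  have g1: "g 1 = 1" unfolding g_def by simp
  have gm: "g (a * b) = g a * g b" for a b unfolding g_def by (simp add: powr_mult)
  have gle: "g n \<le> 1 / real n" if "n \<ge> 1" for n
  proof -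
    have "real n powr (- 1 - e) \<le> real n powr (- 1)" using that e by (intro powr_mono) auto
    then show ?thesis using that by (simp add: g_def powr_minus field_simps)
  qed
  have gdec: "g (Suc n) \<le> g n" if "n \<ge> 1" for n
    unfolding g_def using that e by (intro powr_mono2') auto
  have bnd: "sum g F \<le> 1" if "finite F" "F \<subseteq> {y<..}" for F
    using sum_powr_tail[OF e y that] tail unfolding g_def by linarith
  have smt: "g summable_on {y<..}"
    by (rule nonneg_bdd_above_summable_on) (use g0 bnd in \<open>auto intro!: bdd_aboveI2[where M=1]\<close>)
  have "{1::nat..} = {1..y} \<union> {y<..}" using y by auto
  then have smg: "g summable_on {1..}"
    using summable_on_Un_disjoint[of g "{1..y}" "{y<..}"] smt by (simp add: summable_on_finite disjoint_iff)
  define h where "h n = chi4 n * g n" for n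
  have hle: "\<bar>h n\<bar> \<le> g n" for n
    using abs_chi4_le[of n] g0[of n] mult_right_mono[of "\<bar>chi4 n\<bar>" 1 "g n"] unfolding h_def by (simp add: abs_mult)
  have absg: "(\<lambda>n. norm (g n)) summable_on {1..}" using smg g0 by simp
  have absh: "(\<lambda>n. norm (h n)) summable_on {1..}"
    by (rule Infinite_Sum.abs_summable_on_comparison_test[OF absg]) (use hle g0 in auto)
  have SG: "infsum g S * (\<Prod>p\<in>P. 1 - g p) = 1"
    unfolding S_def by (rule finite_euler_product) (use g1 gm absg finP pP in auto)
  have SH: "infsum h S * (\<Prod>p\<in>P. 1 - h p) = 1"
    unfolding S_def
    by (rule finite_euler_product)
      (use g1 gm absh finP pP in \<open>auto simp: h_def chi4_mult\<close>, auto simp: chi4_def)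
  have subS: "{1..y} \<subseteq> S" "S \<subseteq> {1..}"
  proof
    fix n assume n: "n \<in> {1..y}"
    have "p \<le> y" if "p \<in> prime_factors n" for p
      using that n dvd_imp_le[of p n] by (auto simp: in_prime_factors_iff)
    then show "n \<in> S" using n unfolding S_def P_def by (auto intro: in_prime_factors_imp_prime)
  qed (auto simp: S_def)
  have smS: "g summable_on A" "h summable_on A" if "A \<subseteq> {1..}" for A
    using that smg summable_on_subset_banach absh abs_summable_summable by blast+
  have G: "(\<Sum>n\<in>{1..y}. g n) \<le> infsum g S"
    by (rule finite_sum_le_infsum) (use smS subS g0 in auto)
  \<comment> \<open>The terms up to \<open>y\<close> contribute at most 1 because they alternate,
    those of \<open>S\<close> beyond \<open>y\<close> at most 1 by the tail bound.\<close>
  have H: "infsum h S \<le> 2"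
  proof -
    have eq: "S = {1..y} \<union> (S \<inter> {y<..})" using subS by auto
    have s2: "S \<inter> {y<..} \<subseteq> {1..}" by auto
    have "infsum h S = infsum h {1..y} + infsum h (S \<inter> {y<..})"
      by (subst eq, rule infsum_Un_disjoint) (use smS s2 in auto)
    also have "infsum h {1..y} \<le> 1"
      using sum_chi4_le_1[of g y] g1 gdec g0 by (simp add: h_def)
    also have "infsum h (S \<inter> {y<..}) \<le> infsum g {y<..}"
    proof (rule infsum_mono_neutral)
      show "h summable_on S \<inter> {y<..}" using smS s2 by blast
      show "g summable_on {y<..}" by (rule smt)
    qed (use hle g0 in \<open>auto simp: abs_le_iff\<close>)
    also have "infsum g {y<..} \<le> 1"
      by (rule infsum_le_finite_sums[OF smt]) (use bnd in auto)
    finally show ?thesis by simp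
  qed
  have pge: "p \<ge> 2" if "p \<in> P" for p using pP[OF that] prime_ge_2_nat by blast
  have glt: "g p \<le> 1/2" if "p \<in> P" for p
    using gle[of p] pge[OF that] frac_le[of 1 1 2 "real p"] by linarith
  have hpos: "1 - h p > 0" "1 - g p > 0" if "p \<in> P" for p
    using hle[of p] glt[OF that] by (auto simp: abs_le_iff)
  \<comment> \<open>Local comparison of the Euler factors: at 2 \<open>h\<close> vanishes and
    \<open>g 2 \<le> 1/2\<close>; at primes 1 mod 4 \<open>h\<close> and \<open>g\<close> agree; at
    primes 3 mod 4 they are opposite, and \<open>1 + t \<le> (1 - t) (1 + 3 t)\<close> for
    \<open>0 \<le> t \<le> 1/3\<close>.\<close>
  define w where "w p = (if p = 2 then 2 else if p mod 4 = 3 then exp (3 * g p) else 1)" for p :: nat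
  have step: "1 - h p \<le> (1 - g p) * w p" if p: "p \<in> P" for p
  proof -
    consider "p = 2" | "p \<noteq> 2" "p mod 4 = 3" | "p \<noteq> 2" "p mod 4 = 1"
    proof -
      have "odd p" if "p \<noteq> 2" using that pP[OF p] pge[OF p] prime_odd_nat[of p] by auto
      then have "p mod 4 = 3 \<or> p mod 4 = 1" if "p \<noteq> 2" using that by presburger
      then show ?thesis using that by blast
    qed
    then show ?thesis
    proof cases
      case 1
      then show ?thesis using glt[OF p] by (simp add: w_def h_def chi4_def)
    next
      case 2
      then have p3: "p \<ge> 3" using pge[OF p] by linarith
      define t where "t = g p"
      have t: "0 \<le> t" "t \<le> 1/3"
      proof -
        have "1 / real p \<le> 1 / 3" using p3 by (simp add: field_simps)
        then show "0 \<le> t" "t \<le> 1/3" using g0[of p] gle[of p] p3 unfolding t_def by linarith+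
      qed
      have "odd p" using 2 by presburger
      then have "1 - h p = 1 + t" using 2 unfolding h_def chi4_def t_def by simp
      also have "\<dots> \<le> (1 - t) * (1 + 3 * t)"
      proof -
        have "0 \<le> t * (1 - 3 * t)" using t by (intro mult_nonneg_nonneg) auto
        then show ?thesis by (simp add: algebra_simps)
      qed
      also have "\<dots> \<le> (1 - t) * exp (3 * t)"
        using t exp_ge_add_one_self[of "3*t"] by (intro mult_left_mono) auto
      finally show ?thesis using 2 by (simp add: w_def t_def)
    next
      case 3
      then have "odd p" by presburger
      then show ?thesis using 3 by (simp add: w_def h_def chi4_def)
    qed
  qed
  have "(\<Prod>p\<in>P. 1 - h p) \<le> (\<Prod>p\<in>P. (1 - g p) * w p)"
    by (intro prod_mono) (use step hpos in \<open>auto intro: less_imp_le\<close>)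
  also have "\<dots> = (\<Prod>p\<in>P. 1 - g p) * (\<Prod>p\<in>P. w p)" by (rule prod.distrib)
  also have "(\<Prod>p\<in>P. w p) \<le> 2 * exp (3 * (\<Sum>p\<in>Q. g p))"
  proof -
    have "(\<Prod>p\<in>P. w p) = (\<Prod>p\<in>P. (if p = 2 then 2 else 1) * (if p \<in> Q then exp (3 * g p) else 1))"
      by (intro prod.cong refl) (auto simp: w_def Q_def P_def)
    also have "\<dots> = (\<Prod>p\<in>P. if p = 2 then 2 else 1) * (\<Prod>p\<in>P. if p \<in> Q then exp (3 * g p) else 1)"
      by (rule prod.distrib)
    also have "(\<Prod>p\<in>P. if p \<in> Q then exp (3 * g p) else 1) = (\<Prod>p\<in>P \<inter> Q. exp (3 * g p))"
      by (simp add: prod.inter_restrict finP)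
    also have "P \<inter> Q = Q" unfolding P_def Q_def by auto
    also have "(\<Prod>p\<in>Q. exp (3 * g p)) = exp (3 * (\<Sum>p\<in>Q. g p))"
      by (simp add: Q_def exp_sum sum_distrib_left)
    also have "(\<Prod>p\<in>P. if p = 2 then 2 else 1::real) \<le> 2"
      using finP by (simp add: prod.delta)
    finally show ?thesis by simp
  qed
  finally have *: "(\<Prod>p\<in>P. 1 - h p) \<le> (\<Prod>p\<in>P. 1 - g p) * (2 * exp (3 * (\<Sum>p\<in>Q. g p)))"
    using hpos by (simp add: prod_nonneg less_imp_le mult_left_mono)
  have "1 = infsum h S * (\<Prod>p\<in>P. 1 - h p)" using SH by simp
  also have "\<dots> \<le> 2 * (\<Prod>p\<in>P. 1 - h p)"
    using H hpos by (intro mult_right_mono prod_nonneg) (auto intro: less_imp_le)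
  also have "\<dots> \<le> (\<Prod>p\<in>P. 1 - g p) * (4 * exp (3 * (\<Sum>p\<in>Q. g p)))" using * by simp
  finally have "infsum g S * 1 \<le> infsum g S * ((\<Prod>p\<in>P. 1 - g p) * (4 * exp (3 * (\<Sum>p\<in>Q. g p))))"
    using g0 by (intro mult_left_mono infsum_nonneg) auto
  also have "\<dots> = 4 * exp (3 * (\<Sum>p\<in>Q. g p))" using SG by (simp flip: mult.assoc)
  also have "\<dots> \<le> 4 * exp (3 * (\<Sum>p\<in>Q. 1 / real p))"
    using gle by (auto intro!: sum_mono simp: Q_def prime_gt_0_nat Suc_leI)
  finally show ?thesis using G unfolding g_def Q_def by simp
qed

text \<open>Up to \<open>exp (1 / e)\<close> the factor \<open>n powr (- e)\<close> is at least
  \<open>exp (- 1)\<close>, and the harmonic sum over this range is at least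
  \<open>1 / e\<close>.\<close>

lemma sum_powr_ge:
  fixes e :: real
  assumes e: "e > 0" and y: "exp (1 / e) \<le> real y"
  shows "(\<Sum>n\<in>{1..y}. real n powr (- 1 - e)) \<ge> 1 / (exp 1 * e)"
proof -
  define z where "z = nat \<lfloor>exp (1 / e)\<rfloor>"
  have z: "real z \<le> exp (1 / e)" "exp (1 / e) < real z + 1"
    unfolding z_def by (auto simp: of_nat_nat)
  have zy: "z \<le> y" using z y by linarith
  have "1 / e = ln (exp (1 / e))" by simp
  also have "\<dots> \<le> ln (real z + 1)" using z by (subst ln_le_cancel_iff) (auto intro: less_imp_le)
  also have "\<dots> \<le> harm z" using ln_le_harm[of z] by simp
  finally have "1 / (exp 1 * e) \<le> exp (- 1) * harm z"
    by (simp add: exp_minus field_simps)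
  also have "\<dots> = (\<Sum>n\<in>{1..z}. exp (- 1) * (1 / real n))"
    by (simp add: harm_def sum_distrib_left inverse_eq_divide)
  also have "\<dots> \<le> (\<Sum>n\<in>{1..z}. real n powr (- 1 - e))"
  proof (intro sum_mono)
    fix n assume n: "n \<in> {1..z}"
    then have "ln (real n) \<le> 1 / e" using z
      by (metis (full_types) atLeastAtMost_iff exp_gt_zero ln_exp ln_mono not_one_le_zero of_nat_0_less_iff of_nat_mono order_trans zero_less_iff_neq_zero)
    then have "e * ln (real n) \<le> 1" using e by (simp add: field_simps)
    then have "exp (- 1) \<le> real n powr (- e)" using n by (simp add: powr_def)
    moreover have "real n powr (- 1 - e) = real n powr (- e) * (1 / real n)"
    proof -
      have "- 1 - e = - e + - 1" by simp
    then have "real n powr (- 1 - e) = real n powr (- e) * real n powr (- 1)" by (simp only: powr_add)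
      also have "real n powr (- 1) = 1 / real n" using n by (intro powr_neg_one) auto
      finally show ?thesis .
    qed
    ultimately show "exp (- 1) * (1 / real n) \<le> real n powr (- 1 - e)"
      by (simp add: mult_right_mono del: times_divide_eq_right)
  qed
  also have "\<dots> \<le> (\<Sum>n\<in>{1..y}. real n powr (- 1 - e))" using zy by (intro sum_mono2) auto
  finally show ?thesis .
qed

text \<open>The argument yields any constant below 1/3 in front of the double logarithm. The prime 3
  is dropped because the count of squarefree multiples below subtracts \<open>1 / p\<close> from
  1/4.\<close>

proposition sum_inverse_primes_3_mod_4_ge:
  "eventually (\<lambda>y::nat. (\<Sum>p | prime p \<and> p mod 4 = 3 \<and> 7 \<le> p \<and> p \<le> y. 1 / real p) \<ge> ln (ln (real y)) / 8) sequentially"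
proof -
  \<comment> \<open>With this choice \<open>y powr (- e y)\<close> is
    \<open>ln y powr (- 2)\<close>, small enough for the tail condition, while
    \<open>1 / e y\<close> is still \<open>ln y\<close> up to a factor of double logarithmic
    size.\<close>
  define e where "e y = 2 * ln (ln (real y)) / ln (real y)" for y :: nat
  have "eventually (\<lambda>y::nat. e y > 0) sequentially"
    "eventually (\<lambda>y::nat. real y powr (- e y) / e y \<le> 1) sequentially"
    "eventually (\<lambda>y::nat. exp (1 / e y) \<le> real y) sequentially"
    "eventually (\<lambda>y::nat. (ln (1 / (4 * exp 1 * e y)) - 1) / 3 \<ge> ln (ln (real y)) / 8) sequentially"
    unfolding e_def by real_asymp+
  then show ?thesis using eventually_ge_at_top[of 1]
  proof eventually_elim
    case (elim y)
    define Q where "Q = {p::nat. prime p \<and> p mod 4 = 3 \<and> p \<le> y}"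
    define Q7 where "Q7 = {p::nat. prime p \<and> p mod 4 = 3 \<and> 7 \<le> p \<and> p \<le> y}"
    have "1 / (exp 1 * e y) \<le> 4 * exp (3 * (\<Sum>p\<in>Q. 1 / real p))"
      using sum_powr_ge[OF elim(1,3)] sum_powr_le_exp_sum_primes_3_mod_4[OF elim(1,5,2)]
      unfolding Q_def by linarith
    then have "1 / (4 * exp 1 * e y) \<le> exp (3 * (\<Sum>p\<in>Q. 1 / real p))" using elim(1)
      by (simp add: field_simps)
    then have "ln (1 / (4 * exp 1 * e y)) \<le> 3 * (\<Sum>p\<in>Q. 1 / real p)"
      using elim(1) by (metis exp_gt_zero ln_exp ln_mono divide_pos_pos mult_pos_pos zero_less_numeral zero_less_one)
    moreover have "(\<Sum>p\<in>Q. 1 / real p) \<le> 1/3 + (\<Sum>p\<in>Q7. 1 / real p)"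
    proof -
      have fin: "finite Q7" unfolding Q7_def by simp
      have "p = 3 \<or> 7 \<le> p" if "p mod 4 = 3" for p :: nat using that by presburger
      then have "Q \<subseteq> insert 3 Q7" unfolding Q_def Q7_def by auto
      then have "(\<Sum>p\<in>Q. 1 / real p) \<le> (\<Sum>p\<in>insert 3 Q7. 1 / real p)"
        using fin by (intro sum_mono2) auto
      also have "\<dots> = 1/3 + (\<Sum>p\<in>Q7. 1 / real p)" using fin by (subst sum.insert) (auto simp: Q7_def)
      finally show ?thesis .
    qed
    ultimately have "(ln (1 / (4 * exp 1 * e y)) - 1) / 3 \<le> (\<Sum>p\<in>Q7. 1 / real p)" by (simp add: field_simps)
    with elim(4) show ?case unfolding Q7_def by (rule order_trans)
  qed
qed

section \<open>Squarefree numbers and their prime divisors congruent to 3 modulo 4\<close>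

lemma sum_inverse_squares_le: "(\<Sum>j\<in>{2..K}. 1 / (real j)\<^sup>2) \<le> 3/4"
proof -
  \<comment> \<open>The telescoping starts from the exact term 1/4 = 3/4 - 1/2 at 2; this keeps the
    bound below 1, so a positive proportion survives the sieve.\<close>
  have "(\<Sum>j\<in>{2..K}. 1 / (real j)\<^sup>2) \<le> 3/4 - 1 / real K" if "K \<ge> 2" for K
    using that
  proof (induction K rule: dec_induct)
    case base
    then show ?case by simp
  next
    case (step n)
    have "1 / (real (Suc n))\<^sup>2 \<le> 1 / real n - 1 / real (Suc n)"
    proof -
      have "1 / real n - 1 / real (Suc n) = 1 / (real n * real (Suc n))" using step by (simp add: field_simps)
      moreover have "real n * real (Suc n) \<le> (real (Suc n))\<^sup>2" by (simp add: power2_eq_square)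
      ultimately show ?thesis using step by (simp add: frac_le del: of_nat_Suc)
    qed
    then show ?case using step by (simp add: atLeastAtMostSuc_conv del: of_nat_Suc)
  qed
  then have "(\<Sum>j\<in>{2..K}. 1 / (real j)\<^sup>2) \<le> 3/4 - 1 / real K" if "K \<ge> 2" using that by blast
  moreover have "0 \<le> 1 / real K" by simp
  ultimately show ?thesis by (cases "K \<ge> 2") (linarith, simp)
qed

lemma card_multiples: "d > 0 \<Longrightarrow> card {m\<in>{1..M}. d dvd m} = M div (d::nat)"
proof -
  assume d: "d > 0"
  have "{m\<in>{1..M}. d dvd m} = (\<lambda>k. d * k) ` {1..M div d}"
  proof (intro equalityI subsetI)
    fix m assume m: "m \<in> {m\<in>{1..M}. d dvd m}"
    then obtain k where "m = d * k" by blast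
    then have k: "m = d * k" "1 \<le> m" "m \<le> M" using m by auto
    then have "1 \<le> k" by (auto simp: Suc_le_eq intro!: Nat.gr0I)
    moreover have "k \<le> M div d" using k d by (simp add: less_eq_div_iff_mult_less_eq mult.commute)
    ultimately show "m \<in> (\<lambda>k. d * k) ` {1..M div d}" using k by auto
  next
    fix m assume "m \<in> (\<lambda>k. d * k) ` {1..M div d}"
    then obtain k where "m = d * k" "k \<in> {1..M div d}" by (rule imageE)
    then have k: "m = d * k" "1 \<le> k" "k \<le> M div d" by simp_all
    then have "d * k \<le> M" using d by (simp add: less_eq_div_iff_mult_less_eq mult.commute)
    then show "m \<in> {m\<in>{1..M}. d dvd m}" using k d by (auto simp: Suc_le_eq)
  qed
  moreover have "card ((\<lambda>k. d * k) ` {1..M div d}) = M div d"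
    using d by (subst card_image) (auto simp: inj_on_def)
  ultimately show ?thesis by simp
qed

lemma card_multiples_le: "d > 0 \<Longrightarrow> real (card {m\<in>{1..M}. d dvd m}) \<le> real M / real (d::nat)"
proof -
  assume d: "d > 0"
  have "real (d * (M div d)) \<le> real M" by (intro of_nat_mono) simp
  then have "real (M div d) \<le> real M / real d" using d by (simp add: field_simps)
  then show ?thesis by (simp only: card_multiples[OF d])
qed

definition sqfree :: "nat \<Rightarrow> nat set" where "sqfree N = {n\<in>{1..N}. squarefree n}"

lemma finite_sqfree [simp]: "finite (sqfree N)" by (simp add: sqfree_def)

lemma card_sqfree_le: "card (sqfree N) \<le> N"
proof -
  have "sqfree N \<subseteq> {1..N}" by (auto simp: sqfree_def)
  then show ?thesis using card_mono[of "{1..N}" "sqfree N"] by simp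
qed

text \<open>A union bound over the multiples of all squares from 4 on removes at most the proportion
  3/4.\<close>

lemma card_sqfree_ge: "real (card (sqfree M)) \<ge> real M / 4"
proof -
  define D where "D j = {m\<in>{1..M}. j\<^sup>2 dvd m}" for j
  have "{1..M} \<subseteq> sqfree M \<union> (\<Union>j\<in>{2..M}. D j)"
  proof
    fix m assume m: "m \<in> {1..M}"
    show "m \<in> sqfree M \<union> (\<Union>j\<in>{2..M}. D j)"
    proof (cases "squarefree m")
      case False
      then obtain j where j: "j\<^sup>2 dvd m" "\<not> j dvd 1" unfolding squarefree_def by blast
      then have "j \<noteq> 0" "j \<noteq> 1" using m by (auto intro!: Nat.gr0I)
      moreover have "j \<le> j\<^sup>2" by (simp add: power2_eq_square)
      moreover have "j\<^sup>2 \<le> m" using j m by (intro dvd_imp_le) auto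
      ultimately show ?thesis using j m by (auto simp: D_def)
    qed (use m in \<open>auto simp: sqfree_def\<close>)
  qed
  then have "card {1..M} \<le> card (sqfree M \<union> (\<Union>j\<in>{2..M}. D j))"
    by (intro card_mono) (auto simp: D_def)
  also have "\<dots> \<le> card (sqfree M) + (\<Sum>j\<in>{2..M}. card (D j))"
    by (rule order_trans[OF card_Un_le add_left_mono]) (rule card_UN_le, simp)
  finally have "real M \<le> real (card (sqfree M)) + (\<Sum>j\<in>{2..M}. real (card (D j)))"
    by (simp flip: of_nat_sum of_nat_add)
  also have "(\<Sum>j\<in>{2..M}. real (card (D j))) \<le> (\<Sum>j\<in>{2..M}. real M * (1 / (real j)\<^sup>2))"
    unfolding D_def by (intro sum_mono order_trans[OF card_multiples_le]) auto
  also have "\<dots> \<le> real M * (3/4)"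
    unfolding sum_distrib_left[symmetric] by (intro mult_left_mono sum_inverse_squares_le) auto
  finally show ?thesis by simp
qed

text \<open>Counts the products \<open>p m\<close> with \<open>m\<close> squarefree and prime to
  \<open>p\<close>. Among the \<open>m\<close> up to \<open>M = N div p\<close> there are at least
  M/4 - M/7 = 3M/28, and \<open>2 p \<le> N\<close> gives \<open>N / p \<le> 2 M\<close>.\<close>

lemma card_sqfree_multiples_ge:
  assumes p: "prime p" "7 \<le> p" "2 * p \<le> N"
  shows "real (card {n\<in>sqfree N. p dvd n}) \<ge> 3/56 * (real N / real p)"
proof -
  define M where "M = N div p"
  have "card (sqfree M) - card {m\<in>{1..M}. p dvd m} \<le> card (sqfree M - {m\<in>{1..M}. p dvd m})"
    by (rule diff_card_le_card_Diff) simp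
  also have "\<dots> \<le> card {n\<in>sqfree N. p dvd n}"
  proof (rule card_inj_on_le[where f="\<lambda>m. p * m"])
    show "inj_on (\<lambda>m. p * m) (sqfree M - {m\<in>{1..M}. p dvd m})" using p by (auto simp: inj_on_def)
    show "(\<lambda>m. p * m) ` (sqfree M - {m\<in>{1..M}. p dvd m}) \<subseteq> {n\<in>sqfree N. p dvd n}"
    proof (rule image_subsetI)
      fix m assume "m \<in> sqfree M - {m\<in>{1..M}. p dvd m}"
      then have m: "1 \<le> m" "m \<le> M" "squarefree m" "\<not> p dvd m" by (auto simp: sqfree_def)
      have "coprime p m" using m p prime_imp_coprime by blast
      then have "squarefree (p * m)" using squarefree_mult_coprime[OF _ squarefree_prime[OF p(1)] m(3)] by blast
      moreover have "p * m \<le> N" using m(2) p unfolding M_def by (simp add: less_eq_div_iff_mult_less_eq mult.commute)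
      moreover have "1 \<le> p * m" using m p by (simp add: Suc_le_eq)
      ultimately show "p * m \<in> {n\<in>sqfree N. p dvd n}" by (simp add: sqfree_def)
    qed
  qed simp
  finally have "real (card (sqfree M)) - real (card {m\<in>{1..M}. p dvd m}) \<le> real (card {n\<in>sqfree N. p dvd n})"
    by linarith
  moreover have "real (card {m\<in>{1..M}. p dvd m}) \<le> real M / real p" using p by (intro card_multiples_le) auto
  moreover have "real M / real p \<le> real M / 7" using p by (intro divide_left_mono) auto
  ultimately have A: "real M / 4 - real M / 7 \<le> real (card {n\<in>sqfree N. p dvd n})"
    using card_sqfree_ge[of M] by linarith
  have "N < M * p + p" using p unfolding M_def
    by (metis add.commute dividend_less_times_div mult.commute le_trans less_le_trans not_less_eq_eq zero_less_numeral not_le mult_Suc)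
  then have "real N < real M * real p + real p" by (metis of_nat_add of_nat_less_iff of_nat_mult)
  moreover have "2 * real p \<le> real N" using p(3) by (metis of_nat_le_iff of_nat_mult of_nat_numeral)
  ultimately have "real N \<le> 2 * real M * real p" by linarith
  then have "real N / real p \<le> 2 * real M" using p by (simp add: field_simps)
  then show ?thesis using A by linarith
qed

definition omega3 :: "nat \<Rightarrow> nat" where "omega3 n = card {p. prime p \<and> p dvd n \<and> p mod 4 = 3}"

lemma sum_omega3_ge:
  assumes "2 * y \<le> N"
  shows "(\<Sum>n\<in>sqfree N. real (omega3 n)) \<ge>
    3/56 * real N * (\<Sum>p | prime p \<and> p mod 4 = 3 \<and> 7 \<le> p \<and> p \<le> y. 1 / real p)"
proof -
  define R where "R = {p. prime p \<and> p mod 4 = 3 \<and> 7 \<le> p \<and> p \<le> y}"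
  have fR: "finite R" by (simp add: R_def)
  have "3/56 * real N * (\<Sum>p\<in>R. 1 / real p) = (\<Sum>p\<in>R. 3/56 * (real N / real p))"
    by (simp add: sum_distrib_left)
  also have "\<dots> \<le> (\<Sum>p\<in>R. real (card {n\<in>sqfree N. p dvd n}))"
    by (intro sum_mono card_sqfree_multiples_ge) (use assms in \<open>auto simp: R_def\<close>)
  also have "\<dots> = (\<Sum>p\<in>R. \<Sum>n\<in>sqfree N. if p dvd n then 1 else 0)"
    by (simp add: sum.If_cases Int_def)
  also have "\<dots> = (\<Sum>n\<in>sqfree N. \<Sum>p\<in>R. if p dvd n then 1 else 0)" by (rule sum.swap)
  also have "\<dots> = (\<Sum>n\<in>sqfree N. real (card {p\<in>R. p dvd n}))"
    using fR by (simp add: sum.If_cases Int_def)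
  also have "\<dots> \<le> (\<Sum>n\<in>sqfree N. real (omega3 n))"
  proof (intro sum_mono of_nat_mono)
    fix n assume "n \<in> sqfree N"
    then have "n > 0" by (auto simp: sqfree_def)
    then show "card {p\<in>R. p dvd n} \<le> omega3 n" unfolding omega3_def
      by (intro card_mono) (auto simp: R_def intro: finite_subset[OF _ finite_divisors_nat[of n]])
  qed
  finally show ?thesis unfolding R_def .
qed

text \<open>Jensen's inequality for \<open>x \<mapsto> 2 ^ x\<close>, with the tangent line taken at \<open>t\<close>.\<close>

lemma sum_2_power_ge:
  fixes w :: "'a \<Rightarrow> nat"
  assumes "finite S" "(\<Sum>n\<in>S. real (w n)) \<ge> t * real (card S)"
  shows "(\<Sum>n\<in>S. 2 ^ w n) \<ge> real (card S) * 2 powr t"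
proof -
  have "2 powr t * (1 + (real (w n) - t) * ln 2) \<le> 2 ^ w n" for n
  proof -
    have "1 + (real (w n) - t) * ln 2 \<le> exp ((real (w n) - t) * ln 2)" by (rule exp_ge_add_one_self)
    also have "\<dots> = 2 powr (real (w n) - t)" by (simp add: powr_def)
    finally have "2 powr t * (1 + (real (w n) - t) * ln 2) \<le> 2 powr t * 2 powr (real (w n) - t)"
      by (intro mult_left_mono) auto
    also have "\<dots> = 2 ^ w n" by (simp flip: powr_add add: powr_realpow)
    finally show ?thesis .
  qed
  then have f1: "(\<Sum>n\<in>S. 2 powr t * (1 + (real (w n) - t) * ln 2)) \<le> (\<Sum>n\<in>S. 2 ^ w n)" by (intro sum_mono)
  have f2: "(\<Sum>n\<in>S. 2 powr t * (1 + (real (w n) - t) * ln 2))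
      = 2 powr t * (real (card S) + ((\<Sum>n\<in>S. real (w n)) - t * real (card S)) * ln 2)"
    by (simp add: sum_distrib_left[symmetric] sum.distrib sum_subtractf mult.commute flip: sum_distrib_right)
  have f3: "2 powr t * real (card S) \<le> 2 powr t * (real (card S) + ((\<Sum>n\<in>S. real (w n)) - t * real (card S)) * ln 2)"
    using assms by (intro mult_left_mono) auto
  have "2 powr t * real (card S) \<le> (\<Sum>n\<in>S. 2 ^ w n)" by (rule order_trans[OF f3 f1[unfolded f2]])
  then show ?thesis by (simp only: mult.commute)
qed

text \<open>On average \<open>omega3\<close> is at least 3/448 times the double logarithm, where
  3/448 is 3/56 times 1/8. By convexity the mean of 2 to the power \<open>omega3\<close> is at least
  2 to this quantity, which is the power \<open>\<delta>\<close> of the logarithm up to a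
  constant.\<close>

proposition sum_card_FB_ls_ge:
  "\<exists>c>0. \<exists>\<delta>>0. eventually (\<lambda>N. c * real N * ln (real N) powr \<delta>
     \<le> real (\<Sum>n\<in>sqfree N. card (FB_ls 0 (- (int n)\<^sup>2)))) sequentially"
proof -
  \<comment> \<open>Cutting the primes at the square root secures \<open>2 y \<le> N\<close> and
    shifts the double logarithm only by a constant, which reappears as the factor
    \<open>(1/3) powr \<delta>\<close>.\<close>
  define y where "y N = nat \<lfloor>sqrt (real N)\<rfloor>" for N :: nat
  define \<delta> where "\<delta> = ln 2 * (3/448 :: real)"
  have lim: "filterlim y sequentially sequentially"
    unfolding y_def
    by (intro filterlim_compose[OF filterlim_nat_sequentially] filterlim_compose[OF filterlim_floor_sequentially]
        filterlim_compose[OF sqrt_at_top] filterlim_real_sequentially)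
  have e1: "eventually (\<lambda>N. (\<Sum>p | prime p \<and> p mod 4 = 3 \<and> 7 \<le> p \<and> p \<le> y N. 1 / real p) \<ge> ln (ln (real (y N))) / 8) sequentially"
    using sum_inverse_primes_3_mod_4_ge lim by (rule eventually_compose_filterlim)
  have e2: "eventually (\<lambda>N::nat. sqrt (real N) - 1 \<ge> real N powr (1/3)) sequentially"
    "eventually (\<lambda>N::nat. 2 * sqrt (real N) \<le> real N) sequentially"
    "eventually (\<lambda>N::nat. ln (real N) > 3) sequentially"
    by real_asymp+
  have "eventually (\<lambda>N. (1/16 * (1/3) powr \<delta>) * real N * ln (real N) powr \<delta>
     \<le> real (\<Sum>n\<in>sqfree N. card (FB_ls 0 (- (int n)\<^sup>2)))) sequentially"
    using e1 e2 eventually_gt_at_top[of 0]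
  proof eventually_elim
    case (elim N)
    have y: "real (y N) \<le> sqrt (real N)" "sqrt (real N) < real (y N) + 1"
      unfolding y_def by (simp_all add: of_nat_nat)
    have y2: "2 * y N \<le> N" using y elim by linarith
    have y3: "real N powr (1/3) \<le> real (y N)" using y elim by linarith
    have "0 < real N powr (1/3)" using elim by simp
    then have "ln (real N powr (1/3)) \<le> ln (real (y N))"
      using y3 by (subst ln_le_cancel_iff) linarith+
    then have l3: "ln (real N) / 3 \<le> ln (real (y N))" using elim by (simp add: ln_powr)
    have l0: "0 < ln (real N) / 3" using elim by linarith
    have "ln (ln (real N) / 3) \<le> ln (ln (real (y N)))"
      by (subst ln_le_cancel_iff) (use l0 l3 in linarith)+
    define t where "t = 3/448 * ln (ln (real N) / 3)"
    have t0: "t \<ge> 0" using elim by (simp add: t_def)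
    have "t * real (card (sqfree N)) \<le> t * real N"
      using t0 card_sqfree_le[of N] by (intro mult_left_mono) auto
    also have "\<dots> = 3/56 * real N * (ln (ln (real N) / 3) / 8)" by (simp add: t_def)
    also have "\<dots> \<le> 3/56 * real N * (\<Sum>p | prime p \<and> p mod 4 = 3 \<and> 7 \<le> p \<and> p \<le> y N. 1 / real p)"
      using elim \<open>ln (ln (real N) / 3) \<le> ln (ln (real (y N)))\<close> by (intro mult_left_mono) linarith+
    also have "\<dots> \<le> (\<Sum>n\<in>sqfree N. real (omega3 n))" by (rule sum_omega3_ge[OF y2])
    finally have "real (card (sqfree N)) * 2 powr t \<le> (\<Sum>n\<in>sqfree N. 2 ^ omega3 n)"
      by (intro sum_2_power_ge) auto
    moreover have "real N / 4 * 2 powr t \<le> real (card (sqfree N)) * 2 powr t"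
      by (intro mult_right_mono card_sqfree_ge) auto
    moreover have "(\<Sum>n\<in>sqfree N. 2 ^ omega3 n) \<le> 4 * real (\<Sum>n\<in>sqfree N. card (FB_ls 0 (- (int n)\<^sup>2)))"
    proof -
      have "(\<Sum>n\<in>sqfree N. 2 ^ omega3 n) \<le> (\<Sum>n\<in>sqfree N. 4 * card (FB_ls 0 (- (int n)\<^sup>2)))"
        unfolding omega3_def by (intro sum_mono card_FB_ls_ge) (auto simp: sqfree_def)
      then have "real (\<Sum>n\<in>sqfree N. 2 ^ omega3 n) \<le> real (4 * (\<Sum>n\<in>sqfree N. card (FB_ls 0 (- (int n)\<^sup>2))))"
        by (simp only: of_nat_le_iff sum_distrib_left)
      then show ?thesis by simp
    qed
    ultimately have "real N / 4 * 2 powr t \<le> 4 * real (\<Sum>n\<in>sqfree N. card (FB_ls 0 (- (int n)\<^sup>2)))" by linarith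
    moreover have "2 powr t = (1/3) powr \<delta> * ln (real N) powr \<delta>"
    proof -
      have "N \<noteq> Suc 0" using elim by auto
      then have "2 powr t = (1/3 * ln (real N)) powr \<delta>"
        using elim by (simp add: t_def \<delta>_def powr_def mult_ac)
      then show ?thesis using elim by (simp only: powr_mult)
    qed
    ultimately show ?case by (simp add: mult_ac)
  qed
  moreover have "\<delta> > 0" "1/16 * (1/3) powr \<delta> > 0" by (auto simp: \<delta>_def)
  ultimately show ?thesis by blast
qed

section \<open>Bilinear sums of Jacobi symbols\<close>

text \<open>The Jacobi symbol when \<open>n\<close> is odd and squarefree; multiplicities of primes
  are ignored. Real values are convenient for the averages to come.\<close>

definition jac :: "int \<Rightarrow> nat \<Rightarrow> real" where
  "jac a n = (\<Prod>p\<in>prime_factors n. real_of_int (Legendre a (int p)))"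

lemma odd_prime_factor: "odd n \<Longrightarrow> p \<in> prime_factors n \<Longrightarrow> prime p \<and> 2 < (p::nat)"
  using prime_ge_2_nat[of p] by (cases "p = 2") (auto simp: in_prime_factors_iff)

lemma jac_mult: "odd n \<Longrightarrow> jac (a * b) n = jac a n * jac b n"
  unfolding jac_def prod.distrib[symmetric]
  by (intro prod.cong refl) (use odd_prime_factor in \<open>auto simp: Legendre_mult\<close>)

lemma jac_cong:
  assumes "[a = b] (mod int n)" shows "jac a n = jac b n"
  unfolding jac_def
proof (intro prod.cong refl)
  fix p assume "p \<in> prime_factors n"
  then have "int p dvd int n" by (auto simp: in_prime_factors_iff)
  then have "[a = b] (mod int p)" using assms cong_dvd_modulus by blast
  then show "real_of_int (Legendre a (int p)) = real_of_int (Legendre b (int p))"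
    using Legendre_cong by simp
qed

lemma abs_jac_le: "\<bar>jac a n\<bar> \<le> 1"
proof -
  have "\<bar>jac a n\<bar> = (\<Prod>p\<in>prime_factors n. \<bar>real_of_int (Legendre a (int p))\<bar>)"
    unfolding jac_def by (rule abs_prod)
  also have "\<dots> \<le> 1"
  proof (rule prod_le_1)
    fix p assume "p \<in> prime_factors n"
    show "0 \<le> \<bar>real_of_int (Legendre a (int p))\<bar> \<and> \<bar>real_of_int (Legendre a (int p))\<bar> \<le> 1"
      using Legendre_cases[of a p] by auto
  qed
  finally show ?thesis .
qed

lemma jac_eq_0_iff:
  assumes n: "n > 0"
  shows "jac a n = 0 \<longleftrightarrow> \<not> coprime a (int n)"
proof
  assume "jac a n = 0"
  then obtain p where p: "prime p" "int p dvd int n" "int p dvd a"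
    by (auto simp: jac_def Legendre_eq_0_iff in_prime_factors_iff)
  then have "\<not> is_unit (int p)" using prime_gt_1_nat[OF p(1)] by simp
  then show "\<not> coprime a (int n)" using p coprime_common_divisor by blast
next
  assume "\<not> coprime a (int n)"
  then have "\<not> is_unit (gcd a (int n))" by (simp only: is_unit_gcd not_False_eq_True)
  moreover have "gcd a (int n) \<noteq> 0" using n by simp
  ultimately obtain q where q: "q dvd gcd a (int n)" "prime q" using prime_divisor_exists by blast
  define p where "p = nat q"
  have p: "q = int p" "prime p" using q(2) prime_ge_0_int[OF q(2)] by (auto simp: p_def)
  have "p dvd n" "int p dvd a" using q(1) p by simp_all
  then have "p \<in> prime_factors n" "Legendre a (int p) = 0"
    using p(2) n by (auto simp: in_prime_factors_iff Legendre_eq_0_iff)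
  then show "jac a n = 0" unfolding jac_def by (intro prod_zero) auto
qed

text \<open>Otherwise squaring would map the nonzero residues onto themselves, hence injectively,
  although 1 and \<open>p - 1\<close> have the same square.\<close>

lemma exists_nonresidue:
  assumes p: "prime (p::nat)" "2 < p"
  shows "\<exists>a. Legendre a (int p) = -1"
proof (rule ccontr)
  assume no: "\<not> ?thesis"
  let ?h = "\<lambda>x::int. x\<^sup>2 mod int p"
  have pp: "prime (int p)" using p by simp
  have "{1..<int p} \<subseteq> ?h ` {1..<int p}"
  proof
    fix a assume a: "a \<in> {1..<int p}"
    then have nd: "\<not> int p dvd a" using zdvd_not_zless by auto
    then have "Legendre a (int p) = 1"
      using no Legendre_cases[of a p] Legendre_eq_0_iff[of a p] by blast
    then obtain y where y: "[y\<^sup>2 = a] (mod int p)" using Legendre_eq_1D[of a p] by (auto simp: QuadRes_def)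
    define x where "x = y mod int p"
    have xa: "?h x = a" using y a by (simp add: x_def power_mod cong_iff_mod_eq)
    have "x \<noteq> 0" using xa a by auto
    moreover have "0 \<le> x" "x < int p" using p by (auto simp: x_def)
    ultimately show "a \<in> ?h ` {1..<int p}" using xa by force
  qed
  then have "card {1..<int p} \<le> card (?h ` {1..<int p})" by (intro card_mono) auto
  then have "inj_on ?h {1..<int p}"
    by (metis card_image_le eq_card_imp_inj_on finite_atLeastLessThan_int le_antisym)
  moreover have "?h 1 = ?h (int p - 1)"
  proof -
    have "(int p - 1)\<^sup>2 = 1 + int p * (int p - 2)" by (simp add: power2_eq_square algebra_simps)
    then show ?thesis by simp
  qed
  moreover have "(1::int) \<in> {1..<int p}" "int p - 1 \<in> {1..<int p}" using p by auto
  ultimately have "1 = int p - 1" by (rule inj_onD)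
  then show False using p by simp
qed

text \<open>The Chinese remainder theorem gives a multiplier \<open>a\<close> that is a nonresidue
  at \<open>p\<close> and 1 modulo the rest of \<open>n1 n2\<close>. Multiplication by
  \<open>a\<close> permutes the period and changes the sign of the product of symbols.\<close>

lemma sum_jac_jac_period_aux:
  assumes n: "odd n1" "squarefree n1" "odd n2" and p: "p \<in> prime_factors n1" "\<not> p dvd n2"
  shows "(\<Sum>s\<in>{0..<int (n1 * n2)}. jac s n1 * jac s n2) = 0"
proof -
  have pp: "prime p" "2 < p" using odd_prime_factor[OF n(1) p(1)] by auto
  obtain k where k: "n1 = p * k" using p(1) by (auto simp: in_prime_factors_iff)
  have npk: "\<not> p dvd k"
  proof
    assume "p dvd k"
    then have "p ^ 2 dvd n1" using k by (auto simp: power2_eq_square)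
    then have "p dvd 1" using n unfolding squarefree_def by blast
    then show False using pp by auto
  qed
  have cop: "coprime (int p) (int (k * n2))"
    using npk p(2) pp by (metis coprime_int_iff prime_dvd_mult_iff prime_imp_coprime)
  obtain r where r: "Legendre r (int p) = -1" using exists_nonresidue[OF pp] by blast
  obtain a where a: "[a = r] (mod int p)" "[a = 1] (mod int (k * n2))"
    using binary_chinese_remainder_int[OF cop] by blast
  have ap: "Legendre a (int p) = -1" using Legendre_cong[OF a(1)] r by simp
  have aq: "Legendre a (int q) = 1" if "prime q" "q dvd k * n2" for q
  proof -
    have "[a = 1] (mod int q)" using a(2) that by (meson cong_dvd_modulus of_nat_dvd_iff)
    then show ?thesis using Legendre_cong Legendre_1[of "int q"] prime_gt_1_nat[OF that(1)] by simp
  qed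
  have n0: "n1 > 0" "n2 > 0" using n by (auto intro!: Nat.gr0I)
  have "jac a n2 = 1" unfolding jac_def
    by (intro prod.neutral ballI) (use aq in \<open>auto simp: in_prime_factors_iff\<close>)
  moreover have "jac a n1 = -1"
  proof -
    have "jac a n1 = real_of_int (Legendre a (int p)) * (\<Prod>q\<in>prime_factors n1 - {p}. real_of_int (Legendre a (int q)))"
      unfolding jac_def using p(1) by (simp add: prod.remove)
    also have "(\<Prod>q\<in>prime_factors n1 - {p}. real_of_int (Legendre a (int q))) = 1"
    proof (intro prod.neutral ballI)
      fix q assume q: "q \<in> prime_factors n1 - {p}"
      then have "prime q" "q dvd p * k" "q \<noteq> p" using k by (auto simp: in_prime_factors_iff)
      then have "q dvd k" using pp by (metis prime_dvd_mult_iff primes_dvd_imp_eq)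
      then show "real_of_int (Legendre a (int q)) = 1" using aq \<open>prime q\<close> by simp
    qed
    finally show ?thesis using ap by simp
  qed
  moreover have "coprime a (int (n1 * n2))"
  proof -
    have "coprime a (int n1)" "coprime a (int n2)"
      using jac_eq_0_iff[OF n0(1), of a] jac_eq_0_iff[OF n0(2), of a] \<open>jac a n2 = 1\<close> \<open>jac a n1 = -1\<close> by auto
    then show ?thesis by simp
  qed
  moreover have "(\<Sum>s\<in>{0..<int (n1 * n2)}. jac (a * s + 0) n1 * jac (a * s + 0) n2)
     = (\<Sum>s\<in>{0..<int (n1 * n2)}. jac s n1 * jac s n2)"
  proof (rule sum_affine_mod[where f="\<lambda>s. jac s n1 * jac s n2"])
    fix x y :: int assume "[x = y] (mod int (n1 * n2))"
    then have "[x = y] (mod int n1)" "[x = y] (mod int n2)"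
      by (auto elim: cong_dvd_modulus)
    then show "jac x n1 * jac x n2 = jac y n1 * jac y n2" using jac_cong by metis
  qed (use n0 \<open>coprime a (int (n1 * n2))\<close> in auto)
  ultimately show ?thesis using n by (simp add: jac_mult sum_negf)
qed

lemma squarefree_prod_prime_factors:
  assumes "squarefree (n::nat)" shows "\<Prod>(prime_factors n) = n"
proof -
  have n0: "n \<noteq> 0" using assms by (metis not_squarefree_0)
  have "(\<Prod>p\<in>prime_factors n. p ^ multiplicity p n) = n"
    using prod_prime_factors[OF n0] by simp
  moreover have "multiplicity p n = 1" if "p \<in> prime_factors n" for p
    using that assms n0 squarefree_factorial_semiring''[OF n0]
    by (metis One_nat_def in_prime_factors_imp_prime le_antisym not_less_eq_eq not_numeral_le_zero prime_factors_multiplicity less_one linorder_not_le mem_Collect_eq)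
  ultimately show ?thesis by simp
qed

lemma sum_jac_jac_period:
  assumes n: "odd n1" "squarefree n1" "odd n2" "squarefree n2" "n1 \<noteq> n2"
  shows "(\<Sum>s\<in>{0..<int (n1 * n2)}. jac s n1 * jac s n2) = 0"
proof -
  have n0: "n1 \<noteq> 0" "n2 \<noteq> 0" using n(1,3) by (metis even_zero)+
  have "prime_factors n1 \<noteq> prime_factors n2"
    using n squarefree_prod_prime_factors by metis
  then consider p where "p \<in> prime_factors n1" "p \<notin> prime_factors n2"
    | p where "p \<in> prime_factors n2" "p \<notin> prime_factors n1" by blast
  then show ?thesis
  proof cases
    case 1
    then have "\<not> p dvd n2" using n0 by (auto simp: in_prime_factors_iff)
    then show ?thesis using sum_jac_jac_period_aux 1 n by blast
  next
    case 2
    then have "\<not> p dvd n1" using n0 by (auto simp: in_prime_factors_iff)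
    then show ?thesis using sum_jac_jac_period_aux[of n2 n1 p] 2 n by (simp add: mult.commute)
  qed
qed

text \<open>Complete periods are split off from the top of the range; fewer than \<open>q\<close>
  terms remain.\<close>

lemma abs_sum_periodic_le:
  fixes f :: "int \<Rightarrow> real"
  assumes q: "q > 0" and per: "\<And>x y. [x = y] (mod int q) \<Longrightarrow> f x = f y"
    and zero: "(\<Sum>x\<in>{0..<int q}. f x) = 0" and bd: "\<And>x. \<bar>f x\<bar> \<le> 1"
  shows "\<bar>\<Sum>s<Z. f (int s)\<bar> \<le> real q"
proof (induction Z rule: less_induct)
  case (less Z)
  show ?case
  proof (cases "Z < q")
    case True
    have "\<bar>\<Sum>s<Z. f (int s)\<bar> \<le> (\<Sum>s<Z. 1)" by (rule order_trans[OF sum_abs sum_mono]) (rule bd)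
    then show ?thesis using True by simp
  next
    case False
    have "(\<Sum>s\<in>{Z-q..<Z}. f (int s)) = (\<Sum>x\<in>{0..<int q}. f (1 * x + int (Z - q)))"
      by (rule sum.reindex_bij_witness[where i="\<lambda>x. nat x + (Z - q)" and j="\<lambda>s. int s - int (Z - q)"])
        (use False in auto)
    also have "\<dots> = 0" using sum_affine_mod[of "int q" 1 f "int (Z - q)"] q per zero by simp
    finally have z: "(\<Sum>s\<in>{Z-q..<Z}. f (int s)) = 0" .
    have "{..<Z} = {..<Z-q} \<union> {Z-q..<Z}" using False by auto
    then have "(\<Sum>s<Z. f (int s)) = (\<Sum>s<Z-q. f (int s)) + (\<Sum>s\<in>{Z-q..<Z}. f (int s))"
      by (simp add: sum.union_disjoint disjoint_iff)
    then show ?thesis using z less[of "Z - q"] False q by simp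
  qed
qed

definition odd_sqfree :: "nat \<Rightarrow> nat set" where
  "odd_sqfree N = {n\<in>{1..N}. odd n \<and> squarefree n}"

lemma finite_odd_sqfree [simp]: "finite (odd_sqfree N)" by (simp add: odd_sqfree_def)

lemma card_odd_sqfree_le: "card (odd_sqfree N) \<le> N"
proof -
  have "odd_sqfree N \<subseteq> {1..N}" by (auto simp: odd_sqfree_def)
  then show ?thesis using card_mono[of "{1..N}" "odd_sqfree N"] by simp
qed

text \<open>The square is opened and the sum over \<open>s\<close> is taken first. A pair
  \<open>a \<noteq> b\<close> contributes at most its period \<open>a b \<le> N ^ 2\<close>, and
  there are at most \<open>N ^ 2\<close> pairs; each of at most \<open>N\<close> diagonal pairs adds
  \<open>Z\<close>.\<close>

lemma sum_jac_second_moment: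
  assumes e: "\<And>n. \<bar>e n\<bar> \<le> 1"
  shows "(\<Sum>s<Z. (\<Sum>n\<in>odd_sqfree N. e n * jac (int s) n)\<^sup>2) \<le> real N ^ 4 + real N * real Z"
proof -
  let ?B = "odd_sqfree N"
  have inner: "\<bar>\<Sum>s<Z. jac (int s) a * jac (int s) b\<bar> \<le> real N ^ 2 + (if a = b then real Z else 0)"
    if ab: "a \<in> ?B" "b \<in> ?B" for a b
  proof (cases "a = b")
    case True
    have "\<bar>\<Sum>s<Z. jac (int s) a * jac (int s) b\<bar> \<le> (\<Sum>s<Z. 1)"
      by (rule order_trans[OF sum_abs sum_mono])
        (simp add: abs_mult mult_le_one abs_jac_le)
    then show ?thesis using True by (simp add: add_increasing)
  next
    case False
    have "\<bar>\<Sum>s<Z. jac (int s) a * jac (int s) b\<bar> \<le> real (a * b)"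
    proof (rule abs_sum_periodic_le[where f="\<lambda>s. jac s a * jac s b"])
      fix x y :: int assume "[x = y] (mod int (a * b))"
      then have "[x = y] (mod int a)" "[x = y] (mod int b)"
        by (auto elim: cong_dvd_modulus)
      then show "jac x a * jac x b = jac y a * jac y b" using jac_cong by metis
    qed (use False ab in \<open>auto simp: odd_sqfree_def sum_jac_jac_period abs_mult mult_le_one abs_jac_le simp del: of_nat_mult\<close>)
    also have "\<dots> \<le> real (N * N)"
      using ab by (intro of_nat_mono mult_le_mono) (auto simp: odd_sqfree_def)
    finally show ?thesis using False by (simp add: power2_eq_square)
  qed
  have "(\<Sum>s<Z. (\<Sum>n\<in>?B. e n * jac (int s) n)\<^sup>2)
      = (\<Sum>s<Z. \<Sum>a\<in>?B. \<Sum>b\<in>?B. (e a * e b) * (jac (int s) a * jac (int s) b))"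
    by (simp add: power2_eq_square sum_product mult_ac)
  also have "\<dots> = (\<Sum>a\<in>?B. \<Sum>b\<in>?B. \<Sum>s<Z. (e a * e b) * (jac (int s) a * jac (int s) b))"
  proof -
    have "(\<Sum>s<Z. \<Sum>a\<in>?B. \<Sum>b\<in>?B. (e a * e b) * (jac (int s) a * jac (int s) b))
      = (\<Sum>a\<in>?B. \<Sum>s<Z. \<Sum>b\<in>?B. (e a * e b) * (jac (int s) a * jac (int s) b))"
      by (rule sum.swap)
    also have "\<dots> = (\<Sum>a\<in>?B. \<Sum>b\<in>?B. \<Sum>s<Z. (e a * e b) * (jac (int s) a * jac (int s) b))"
      by (rule sum.cong[OF refl], rule sum.swap)
    finally show ?thesis .
  qed
  also have "\<dots> = (\<Sum>a\<in>?B. \<Sum>b\<in>?B. (e a * e b) * (\<Sum>s<Z. jac (int s) a * jac (int s) b))"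
    by (simp add: sum_distrib_left)
  also have "\<dots> \<le> (\<Sum>a\<in>?B. \<Sum>b\<in>?B. real N ^ 2 + (if a = b then real Z else 0))"
  proof (intro sum_mono)
    fix a b assume ab: "a \<in> ?B" "b \<in> ?B"
    have "(e a * e b) * (\<Sum>s<Z. jac (int s) a * jac (int s) b)
        \<le> \<bar>e a * e b\<bar> * \<bar>\<Sum>s<Z. jac (int s) a * jac (int s) b\<bar>" 
      unfolding abs_mult[symmetric] by (rule abs_ge_self)
    also have "\<dots> \<le> 1 * \<bar>\<Sum>s<Z. jac (int s) a * jac (int s) b\<bar>"
      using e by (intro mult_right_mono) (auto simp: abs_mult intro: mult_le_one)
    finally show "(e a * e b) * (\<Sum>s<Z. jac (int s) a * jac (int s) b)
        \<le> real N ^ 2 + (if a = b then real Z else 0)" using inner[OF ab] by linarith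
  qed
  also have "\<dots> = real (card ?B) * (real (card ?B) * real N ^ 2 + real Z)"
    by (simp add: sum.distrib sum.delta' algebra_simps)
  also have "\<dots> \<le> real N * (real N * real N ^ 2 + real Z)"
    using card_odd_sqfree_le[of N] by (intro mult_mono add_mono) auto
  also have "\<dots> = real N ^ 4 + real N * real Z" by (simp add: algebra_simps power2_eq_square power4_eq_xxxx)
  finally show ?thesis .
qed

section \<open>Moments of the divisor function and squares of character sums\<close>

definition tau :: "nat \<Rightarrow> nat" where "tau n = card {d. d dvd n}"

text \<open>A divisor \<open>d\<close> of \<open>a b\<close> is recovered from
  \<open>gcd d a\<close> and the quotient, which divides \<open>b\<close>; coprimality of
  \<open>a\<close> and \<open>b\<close> plays no part in this.\<close>

lemma tau_mult_le:
  assumes "a > 0" "b > 0"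
  shows "tau (a * b) \<le> tau a * tau b"
proof -
  have "card {d. d dvd a * b} \<le> card ({d. d dvd a} \<times> {d. d dvd b})"
  proof (rule card_inj_on_le[where f="\<lambda>d. (gcd d a, d div gcd d a)"])
    show "inj_on (\<lambda>d. (gcd d a, d div gcd d a)) {d. d dvd a * b}"
    proof (rule inj_onI)
      fix x y assume "(gcd x a, x div gcd x a) = (gcd y a, y div gcd y a)"
      then show "x = y" by (metis Pair_inject dvd_mult_div_cancel gcd_dvd1)
    qed
    show "finite ({d. d dvd a} \<times> {d. d dvd b})" using assms by simp
    show "(\<lambda>d. (gcd d a, d div gcd d a)) ` {d. d dvd a * b} \<subseteq> {d. d dvd a} \<times> {d. d dvd b}"
    proof (rule image_subsetI)
      fix d assume "d \<in> {d. d dvd a * b}"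
      then have d: "d dvd a * b" by simp
      define g where "g = gcd d a"
      have g: "g > 0" using assms by (simp add: g_def)
      obtain d' a' where da: "d = g * d'" "a = g * a'" "coprime d' a'"
        using gcd_coprime_exists[of d a] g by (metis g_def mult.commute not_gr_zero)
      have "d' dvd a' * b" using d da g by (simp add: mult.assoc)
      then have "d' dvd b" using da(3) by (simp add: coprime_dvd_mult_right_iff)
      moreover have "d div g = d'" using da g by simp
      ultimately show "(gcd d a, d div gcd d a) \<in> {d. d dvd a} \<times> {d. d dvd b}"
        by (simp add: g_def)
    qed
  qed
  then show ?thesis by (simp add: tau_def card_cartesian_product)
qed

text \<open>One factor \<open>tau s\<close> is opened as a sum over the factorizations of
  \<open>s\<close> into two parts; by submultiplicativity the double sum is at most the square of
  the previous sum, which doubles the exponent of \<open>harm Z\<close>.\<close>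

lemma sum_tau_power_div_le:
  "(\<Sum>s\<in>{1..Z}. real (tau s) ^ k / real s) \<le> (harm Z) ^ (2 ^ k)"
proof (induction k)
  case 0
  then show ?case by (simp add: harm_def inverse_eq_divide)
next
  case (Suc k)
  define A where "A = (SIGMA s:{1..Z}. {d. d dvd s})"
  define h where "h = (\<lambda>x::nat \<times> nat. (snd x, fst x div snd x))"
  have "(\<Sum>s\<in>{1..Z}. real (tau s) ^ Suc k / real s) = (\<Sum>s\<in>{1..Z}. \<Sum>d | d dvd s. real (tau s) ^ k / real s)"
    by (simp add: tau_def)
  also have "\<dots> = (\<Sum>x\<in>A. real (tau (fst x)) ^ k / real (fst x))"
    unfolding A_def by (subst sum.Sigma) (auto simp: case_prod_unfold)
  also have "\<dots> = (\<Sum>x\<in>A. real (tau (fst (h x) * snd (h x))) ^ k / real (fst (h x) * snd (h x)))"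
    by (intro sum.cong refl) (auto simp: A_def h_def)
  also have "\<dots> = (\<Sum>y\<in>h ` A. real (tau (fst y * snd y)) ^ k / real (fst y * snd y))"
  proof (subst sum.reindex)
    show "inj_on h A"
    proof (rule inj_onI)
      fix x y assume "x \<in> A" "y \<in> A" "h x = h y"
      then have "snd x = snd y" "fst x div snd x = fst y div snd y" "snd x dvd fst x" "snd y dvd fst y"
        by (auto simp: A_def h_def)
      then show "x = y" by (metis dvd_mult_div_cancel prod.expand)
    qed
  qed (simp add: o_def)
  also have "\<dots> \<le> (\<Sum>y\<in>{1..Z} \<times> {1..Z}. real (tau (fst y * snd y)) ^ k / real (fst y * snd y))"
  proof (rule sum_mono2)
    show "h ` A \<subseteq> {1..Z} \<times> {1..Z}"
    proof (rule image_subsetI)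
      fix x assume x: "x \<in> A"
      obtain s d where sd: "x = (s, d)" by (cases x)
      then have s: "1 \<le> s" "s \<le> Z" "d dvd s" using x by (auto simp: A_def)
      then obtain c where c: "s = d * c" by blast
      have dc: "1 \<le> d" "1 \<le> c" "d \<le> d * c" "c \<le> d * c" using s c by (auto simp: Suc_le_eq intro!: Nat.gr0I)
      then have "d \<le> Z" "c \<le> Z" using s(2) c by linarith+
      with dc show "h x \<in> {1..Z} \<times> {1..Z}" using s c sd by (auto simp: h_def)
    qed
  qed auto
  also have "\<dots> \<le> (\<Sum>y\<in>{1..Z} \<times> {1..Z}. (real (tau (fst y)) ^ k / real (fst y)) * (real (tau (snd y)) ^ k / real (snd y)))"
  proof (intro sum_mono)
    fix y assume y: "y \<in> {1..Z} \<times> {1..Z}"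
    then have "tau (fst y * snd y) \<le> tau (fst y) * tau (snd y)" by (intro tau_mult_le) auto
    then have "real (tau (fst y * snd y)) ^ k \<le> (real (tau (fst y)) * real (tau (snd y))) ^ k"
      by (intro power_mono) (auto simp flip: of_nat_mult)
    then show "real (tau (fst y * snd y)) ^ k / real (fst y * snd y)
        \<le> (real (tau (fst y)) ^ k / real (fst y)) * (real (tau (snd y)) ^ k / real (snd y))"
      by (simp add: power_mult_distrib divide_right_mono)
  qed
  also have "\<dots> = (\<Sum>s\<in>{1..Z}. real (tau s) ^ k / real s)\<^sup>2"
    by (simp add: power2_eq_square sum_product sum.cartesian_product case_prod_unfold)
  also have "\<dots> \<le> ((harm Z) ^ (2 ^ k))\<^sup>2"
    by (intro power_mono Suc sum_nonneg) auto
  also have "\<dots> = harm Z ^ (2 ^ Suc k)" by (simp add: power_mult[symmetric] mult.commute)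
  finally show ?case .
qed

lemma sum_tau_power_le:
  "(\<Sum>s\<in>{1..Z}. real (tau s) ^ k) \<le> real Z * (harm Z) ^ (2 ^ k)"
proof -
  have "(\<Sum>s\<in>{1..Z}. real (tau s) ^ k) \<le> (\<Sum>s\<in>{1..Z}. real Z * (real (tau s) ^ k / real s))"
    by (intro sum_mono) (auto simp: field_simps intro!: mult_right_mono)
  also have "\<dots> = real Z * (\<Sum>s\<in>{1..Z}. real (tau s) ^ k / real s)" by (simp add: sum_distrib_left)
  also have "\<dots> \<le> real Z * (harm Z) ^ (2 ^ k)" by (intro mult_left_mono sum_tau_power_div_le) auto
  finally show ?thesis .
qed

text \<open>The Dirichlet convolution with itself of \<open>a\<close> cut off at \<open>K\<close>,
  that is, the coefficients in the square of a sum over \<open>m \<le> K\<close>.\<close>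

definition conv :: "nat \<Rightarrow> (nat \<Rightarrow> real) \<Rightarrow> nat \<Rightarrow> real" where
  "conv K a t = (\<Sum>d | d dvd t \<and> d \<le> K \<and> t div d \<le> K. a d * a (t div d))"

lemma sum_jac_square:
  assumes n: "odd n"
  shows "(\<Sum>m\<in>{1..K}. a m * jac (int m) n)\<^sup>2 = (\<Sum>t\<in>{1..K * K}. conv K a t * jac (int t) n)"
proof -
  have "(\<Sum>m\<in>{1..K}. a m * jac (int m) n)\<^sup>2
      = (\<Sum>x\<in>{1..K} \<times> {1..K}. a (fst x) * a (snd x) * jac (int (fst x * snd x)) n)"
    by (simp add: power2_eq_square sum_product sum.cartesian_product case_prod_unfold jac_mult[OF n] mult_ac)
  also have "\<dots> = (\<Sum>y\<in>(SIGMA t:{1..K * K}. {d. d dvd t \<and> d \<le> K \<and> t div d \<le> K}).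
      a (snd y) * a (fst y div snd y) * jac (int (fst y)) n)"
  proof (rule sum.reindex_bij_witness[where i="\<lambda>y. (snd y, fst y div snd y)" and j="\<lambda>x. (fst x * snd x, fst x)"])
    fix x assume "x \<in> {1..K} \<times> {1..K}"
    then show "(fst x * snd x, fst x) \<in> (SIGMA t:{1..K * K}. {d. d dvd t \<and> d \<le> K \<and> t div d \<le> K})"
      by (auto intro: mult_le_mono)
  next
    fix y assume "y \<in> (SIGMA t:{1..K * K}. {d. d dvd t \<and> d \<le> K \<and> t div d \<le> K})"
    then show "(snd y, fst y div snd y) \<in> {1..K} \<times> {1..K}"
      by (auto simp: Suc_le_eq intro!: Nat.gr0I)
  qed auto
  also have "\<dots> = (\<Sum>t\<in>{1..K * K}. \<Sum>d | d dvd t \<and> d \<le> K \<and> t div d \<le> K. a d * a (t div d) * jac (int t) n)"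
    by (subst sum.Sigma) (auto simp: case_prod_unfold)
  finally show ?thesis by (simp add: conv_def sum_distrib_right)
qed

text \<open>There are at most \<open>tau t\<close> terms of size at most
  \<open>tau t ^ (2 * j)\<close>. Starting from bounded coefficients, the exponents run 0, 1,
  3.\<close>

lemma abs_conv_le:
  assumes a: "\<And>m. m \<ge> 1 \<Longrightarrow> \<bar>a m\<bar> \<le> real (tau m) ^ j" and t: "t \<ge> 1"
  shows "\<bar>conv K a t\<bar> \<le> real (tau t) ^ (2 * j + 1)"
proof -
  have mono: "tau d \<le> tau t" if "d dvd t" for d
    unfolding tau_def using that t by (intro card_mono) (auto intro: dvd_trans)
  have "\<bar>conv K a t\<bar> \<le> (\<Sum>d | d dvd t \<and> d \<le> K \<and> t div d \<le> K. \<bar>a d * a (t div d)\<bar>)"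
    unfolding conv_def by (rule sum_abs)
  also have "\<dots> \<le> (\<Sum>d | d dvd t \<and> d \<le> K \<and> t div d \<le> K. real (tau t) ^ j * real (tau t) ^ j)"
  proof (intro sum_mono)
    fix d assume "d \<in> {d. d dvd t \<and> d \<le> K \<and> t div d \<le> K}"
    then have d: "d dvd t" by simp
    have d1: "d \<ge> 1" "t div d \<ge> 1" "t div d dvd t" using d t by (auto simp: Suc_le_eq intro!: Nat.gr0I)
    have "\<bar>a d\<bar> \<le> real (tau t) ^ j" "\<bar>a (t div d)\<bar> \<le> real (tau t) ^ j"
      using a[OF d1(1)] a[OF d1(2)] power_mono[of "real (tau d)" "real (tau t)" j]
        power_mono[of "real (tau (t div d))" "real (tau t)" j] mono[OF d] mono[OF d1(3)] by auto
    then show "\<bar>a d * a (t div d)\<bar> \<le> real (tau t) ^ j * real (tau t) ^ j"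
      unfolding abs_mult by (intro mult_mono) auto
  qed
  also have "\<dots> \<le> (\<Sum>d | d dvd t. real (tau t) ^ j * real (tau t) ^ j)"
    using t by (intro sum_mono2) auto
  also have "\<dots> = real (tau t) ^ (2 * j + 1)"
    by (simp add: tau_def power_add mult_2)
  finally show ?thesis .
qed

text \<open>Raising to the fourth power replaces \<open>m\<close> by a variable of length \<open>M ^ 4 \<ge> N ^ 4\<close>; after
  Cauchy-Schwarz and completion of the sum over that variable, the off-diagonal moduli are at most
  \<open>N\<^sup>2\<close>, so cancellation over full periods suffices.\<close>

lemma bilinear_long:
  assumes a: "\<And>m. \<bar>a m\<bar> \<le> 1" and N: "1 \<le> N" "N \<le> M"
  shows "(\<Sum>n\<in>odd_sqfree N. \<bar>\<Sum>m\<in>{1..M}. a m * jac (int m) n\<bar>) ^ 8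
      \<le> 3 * (real M * real N) ^ 8 * harm (M ^ 4) ^ 64 / real N"
proof -
  let ?B = "odd_sqfree N"
  define A where "A n = (\<Sum>m\<in>{1..M}. a m * jac (int m) n)" for n
  define b where "b = conv M a"
  define c where "c = conv (M * M) b"
  define Z where "Z = M ^ 4"
  have ZM: "M * M * (M * M) = Z" by (simp add: Z_def power4_eq_xxxx)
  have bb: "\<bar>b t\<bar> \<le> real (tau t) ^ 1" if "t \<ge> 1" for t
    unfolding b_def using abs_conv_le[of a 0 t M] a that by simp
  have cb: "\<bar>c t\<bar> \<le> real (tau t) ^ 3" if "t \<ge> 1" for t
    unfolding c_def using abs_conv_le[of b 1 t "M * M"] bb that by simp
  have A4: "A n ^ 4 = (\<Sum>t\<in>{1..Z}. c t * jac (int t) n)" if "n \<in> ?B" for n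
  proof -
    have o: "odd n" using that by (simp add: odd_sqfree_def)
    have "A n ^ 4 = ((A n)\<^sup>2)\<^sup>2" by (simp flip: power_mult)
    also have "(A n)\<^sup>2 = (\<Sum>t\<in>{1..M * M}. b t * jac (int t) n)"
      unfolding A_def b_def by (rule sum_jac_square[OF o])
    also have "\<dots>\<^sup>2 = (\<Sum>t\<in>{1..Z}. c t * jac (int t) n)"
      unfolding c_def by (subst sum_jac_square[OF o]) (simp only: ZM)
    finally show ?thesis .
  qed
  have cs: "(\<Sum>n\<in>?B. f n) ^ 2 \<le> real N * (\<Sum>n\<in>?B. (f n)\<^sup>2)" for f :: "nat \<Rightarrow> real"
  proof -
    have "(\<Sum>n\<in>?B. 1 * f n) ^ 2 \<le> (\<Sum>n\<in>?B. 1\<^sup>2) * (\<Sum>n\<in>?B. (f n)\<^sup>2)"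
      by (rule Cauchy_Schwarz_ineq_sum)
    also have "\<dots> \<le> real N * (\<Sum>n\<in>?B. (f n)\<^sup>2)"
      using card_odd_sqfree_le[of N] by (intro mult_right_mono sum_nonneg) auto
    finally show ?thesis by simp
  qed
  have s2: "(\<Sum>n\<in>?B. \<bar>A n\<bar>)\<^sup>2 \<le> real N * (\<Sum>n\<in>?B. (A n)\<^sup>2)" using cs[of "\<lambda>n. \<bar>A n\<bar>"] by simp
  have "((\<Sum>n\<in>?B. \<bar>A n\<bar>)\<^sup>2)\<^sup>2 \<le> (real N * (\<Sum>n\<in>?B. (A n)\<^sup>2))\<^sup>2"
    by (intro power_mono s2) auto
  also have "\<dots> = real N ^ 2 * (\<Sum>n\<in>?B. (A n)\<^sup>2)\<^sup>2" by (simp add: power_mult_distrib)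
  also have "\<dots> \<le> real N ^ 2 * (real N * (\<Sum>n\<in>?B. ((A n)\<^sup>2)\<^sup>2))" by (intro mult_left_mono cs) auto
  also have "\<dots> = real N ^ 3 * (\<Sum>n\<in>?B. A n ^ 4)"
    by (simp add: power3_eq_cube power2_eq_square power4_eq_xxxx mult_ac)
  finally have s4: "((\<Sum>n\<in>?B. \<bar>A n\<bar>)\<^sup>2)\<^sup>2 \<le> real N ^ 3 * (\<Sum>n\<in>?B. A n ^ 4)" .
  have "(\<Sum>n\<in>?B. A n ^ 4) = (\<Sum>n\<in>?B. \<Sum>t\<in>{1..Z}. c t * jac (int t) n)" by (intro sum.cong refl A4)
  also have "\<dots> = (\<Sum>t\<in>{1..Z}. c t * (\<Sum>n\<in>?B. jac (int t) n))"
    by (subst sum.swap) (simp add: sum_distrib_left)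
  finally have "(\<Sum>n\<in>?B. A n ^ 4)\<^sup>2 \<le> (\<Sum>t\<in>{1..Z}. (c t)\<^sup>2) * (\<Sum>t\<in>{1..Z}. (\<Sum>n\<in>?B. jac (int t) n)\<^sup>2)"
    using Cauchy_Schwarz_ineq_sum[of c "\<lambda>t. \<Sum>n\<in>?B. jac (int t) n" "{1..Z}"] by simp
  \<comment> \<open>The coefficients \<open>c\<close> are bounded by the cube of \<open>tau\<close>,
    their squares by its sixth power, and 64 is 2 ^ 6.\<close>
  also have "\<dots> \<le> (real Z * harm Z ^ 64) * (3 * real N * real Z)"
  proof (intro mult_mono)
    have "(\<Sum>t\<in>{1..Z}. (c t)\<^sup>2) \<le> (\<Sum>t\<in>{1..Z}. real (tau t) ^ 6)"
    proof (intro sum_mono)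
      fix t assume "t \<in> {1..Z}"
      then have "\<bar>c t\<bar>\<^sup>2 \<le> (real (tau t) ^ 3)\<^sup>2" using cb by (intro power_mono) auto
      then show "(c t)\<^sup>2 \<le> real (tau t) ^ 6" by (simp flip: power_mult)
    qed
    also have "\<dots> \<le> real Z * harm Z ^ 64" using sum_tau_power_le[of 6 Z] by simp
    finally show "(\<Sum>t\<in>{1..Z}. (c t)\<^sup>2) \<le> real Z * harm Z ^ 64" .
    have "(\<Sum>t\<in>{1..Z}. (\<Sum>n\<in>?B. jac (int t) n)\<^sup>2) \<le> (\<Sum>t<Suc Z. (\<Sum>n\<in>?B. 1 * jac (int t) n)\<^sup>2)"
      unfolding mult_1 by (intro sum_mono2) auto
    also have "\<dots> \<le> real N ^ 4 + real N * real (Suc Z)" by (rule sum_jac_second_moment) simp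
    also have "\<dots> \<le> 3 * real N * real Z"
    proof -
      have Z1: "1 \<le> Z" using N by (simp add: Z_def)
      have "N ^ 4 \<le> Z" unfolding Z_def using N by (intro power_mono) auto
      also have "Z \<le> N * Z" using N by simp
      finally have "real N ^ 4 \<le> real N * real Z" by (metis of_nat_le_iff of_nat_mult of_nat_power)
      moreover have "real N * real (Suc Z) \<le> real N * (2 * real Z)" using Z1 by (intro mult_left_mono) auto
      ultimately show ?thesis by (simp add: algebra_simps)
    qed
    finally show "(\<Sum>t\<in>{1..Z}. (\<Sum>n\<in>?B. jac (int t) n)\<^sup>2) \<le> 3 * real N * real Z" .
  qed (simp_all add: sum_nonneg harm_nonneg)
  finally have q: "(\<Sum>n\<in>?B. A n ^ 4)\<^sup>2 \<le> 3 * real N * real Z ^ 2 * harm Z ^ 64"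
    by (simp add: power2_eq_square mult_ac)
  have "(\<Sum>n\<in>?B. \<bar>A n\<bar>) ^ 8 = (((\<Sum>n\<in>?B. \<bar>A n\<bar>)\<^sup>2)\<^sup>2)\<^sup>2" by (simp flip: power_mult)
  also have "\<dots> \<le> (real N ^ 3 * (\<Sum>n\<in>?B. A n ^ 4))\<^sup>2" by (intro power_mono s4) auto
  also have "\<dots> = real N ^ 6 * (\<Sum>n\<in>?B. A n ^ 4)\<^sup>2" by (simp add: power_mult_distrib flip: power_mult)
  also have "\<dots> \<le> real N ^ 6 * (3 * real N * real Z ^ 2 * harm Z ^ 64)" by (intro mult_left_mono q) auto
  also have "\<dots> = 3 * (real M * real N) ^ 8 * harm (M ^ 4) ^ 64 / real N"
  proof -
    have "real Z ^ 2 = real M ^ 8" by (simp add: Z_def flip: power_mult)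
    moreover have "real N ^ 6 * real N = real N ^ 8 / real N" using N by (simp add: power_numeral_reduce field_simps)
    ultimately show ?thesis using N by (simp add: power_mult_distrib Z_def field_simps)
  qed
  finally show ?thesis unfolding A_def .
qed

section \<open>Quadratic reciprocity and the symmetric bilinear estimate\<close>

definition recip_sign :: "nat \<Rightarrow> nat \<Rightarrow> real" where
  "recip_sign m n = (if m mod 4 = 3 \<and> n mod 4 = 3 then -1 else 1)"

text \<open>The sign of reciprocity couples the two variables; in this form it is a combination of
  four products of a function of \<open>m\<close> and a function of \<open>n\<close>, which can be
  absorbed into bilinear coefficients.\<close>

lemma recip_sign_eq:
  assumes "odd m" "odd n"
  shows "recip_sign m n = (1 + chi4 m + chi4 n - chi4 m * chi4 n) / 2"
proof -
  have "m mod 4 = 1 \<or> m mod 4 = 3" "n mod 4 = 1 \<or> n mod 4 = 3" using assms by presburger+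
  then show ?thesis using assms by (auto simp: recip_sign_def chi4_def)
qed

lemma prod_recip_sign:
  assumes "finite Q" "\<And>q. q \<in> Q \<Longrightarrow> odd (q::nat)"
  shows "(\<Prod>q\<in>Q. recip_sign m q) = recip_sign m (\<Prod>Q)"
  using assms
proof (induction Q)
  case (insert x F)
  have "(x * \<Prod>F) mod 4 = ((x mod 4) * ((\<Prod>F) mod 4)) mod 4" by (simp add: mod_mult_eq)
  moreover have "x mod 4 = 1 \<or> x mod 4 = 3" using insert.prems[of x] by (simp, presburger)
  moreover have "odd (\<Prod>F)" using insert by (simp add: even_prod_iff)
  then have "(\<Prod>F) mod 4 = 1 \<or> (\<Prod>F) mod 4 = 3" by presburger
  ultimately have "recip_sign m (x * \<Prod>F) = recip_sign m x * recip_sign m (\<Prod>F)"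
    unfolding recip_sign_def by (elim disjE) simp_all
  moreover have "(\<Prod>q\<in>F. recip_sign m q) = recip_sign m (\<Prod>F)" using insert by blast
  ultimately show ?case using insert.hyps by simp
qed (simp add: recip_sign_def)

lemma recip_sign_commute: "recip_sign m n = recip_sign n m" by (auto simp: recip_sign_def)

lemma Legendre_reciprocity:
  assumes "prime p" "2 < p" "prime q" "2 < q" "p \<noteq> q"
  shows "real_of_int (Legendre (int p) (int q)) = recip_sign p q * real_of_int (Legendre (int q) (int p))"
proof -
  have R: "Legendre (int p) (int q) * Legendre (int q) (int p) = (- 1) ^ ((p - 1) div 2 * ((q - 1) div 2))"
    using Quadratic_Reciprocity[of p q] assms by simp
  have "\<not> q dvd p" "\<not> p dvd q" using assms primes_dvd_imp_eq by blast+
  then have c: "Legendre (int p) (int q) = 1 \<or> Legendre (int p) (int q) = -1"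
    "Legendre (int q) (int p) = 1 \<or> Legendre (int q) (int p) = -1"
    using Legendre_cases[of p q] Legendre_cases[of q p] Legendre_eq_0_iff[of p q] Legendre_eq_0_iff[of q p] by auto
  have "odd p" "odd q" using assms prime_odd_nat by blast+
  then have "odd ((p - 1) div 2) \<longleftrightarrow> p mod 4 = 3" "odd ((q - 1) div 2) \<longleftrightarrow> q mod 4 = 3" by presburger+
  then have "(- 1 :: int) ^ ((p - 1) div 2 * ((q - 1) div 2)) = (if p mod 4 = 3 \<and> q mod 4 = 3 then -1 else 1)"
    by (auto simp: minus_one_power_iff)
  then show ?thesis using R c by (auto simp: recip_sign_def)
qed

lemma jac_prod: "odd n \<Longrightarrow> jac (\<Prod>x\<in>A. g x) n = (\<Prod>x\<in>A. jac (g x) n)"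
proof -
  assume n: "odd n"
  have "jac (\<Prod>x\<in>A. g x) n = (\<Prod>p\<in>prime_factors n. \<Prod>x\<in>A. real_of_int (Legendre (g x) (int p)))"
    unfolding jac_def by (intro prod.cong refl) (use odd_prime_factor[OF n] in \<open>simp add: Legendre_prod\<close>)
  also have "\<dots> = (\<Prod>x\<in>A. jac (g x) n)" unfolding jac_def by (rule prod.swap)
  finally show ?thesis .
qed

text \<open>Both symbols factor over pairs of primes, one from each number. A common prime makes
  both vanish.\<close>

lemma jac_reciprocity:
  assumes m: "odd m" "squarefree m" and n: "odd n" "squarefree n"
  shows "jac (int m) n = recip_sign m n * jac (int n) m"
proof (cases "coprime m n")
  case False
  have "m > 0" "n > 0" using m n by (auto intro!: Nat.gr0I)
  then have "jac (int m) n = 0" "jac (int n) m = 0"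
    using False by (simp_all add: jac_eq_0_iff coprime_commute)
  then show ?thesis by simp
next
  case True
  let ?P = "prime_factors m" and ?Q = "prime_factors n"
  have disj: "p \<noteq> q" if "p \<in> ?P" "q \<in> ?Q" for p q
    using that True by (auto simp: in_prime_factors_iff) (metis coprime_common_divisor not_prime_unit)
  have om: "odd p" if "p \<in> ?P" for p using that m by (auto simp: in_prime_factors_iff)
  have on: "odd p" if "p \<in> ?Q" for p using that n by (auto simp: in_prime_factors_iff)
  have "jac (int m) n = jac (\<Prod>p\<in>?P. int p) n"
    using squarefree_prod_prime_factors[OF m(2)] by (simp flip: of_nat_prod)
  also have "\<dots> = (\<Prod>p\<in>?P. jac (int p) n)" by (rule jac_prod[OF n(1)])
  also have "\<dots> = (\<Prod>p\<in>?P. \<Prod>q\<in>?Q. real_of_int (Legendre (int p) (int q)))"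
    by (simp only: jac_def)
  also have "\<dots> = (\<Prod>p\<in>?P. \<Prod>q\<in>?Q. recip_sign p q * real_of_int (Legendre (int q) (int p)))"
    using odd_prime_factor[OF m(1)] odd_prime_factor[OF n(1)] disj
    by (intro prod.cong refl Legendre_reciprocity) auto
  also have "\<dots> = (\<Prod>p\<in>?P. \<Prod>q\<in>?Q. recip_sign p q) * (\<Prod>p\<in>?P. \<Prod>q\<in>?Q. real_of_int (Legendre (int q) (int p)))"
    by (simp only: prod.distrib)
  also have "(\<Prod>p\<in>?P. \<Prod>q\<in>?Q. recip_sign p q) = (\<Prod>p\<in>?P. recip_sign n p)"
    using prod_recip_sign[of ?Q] on squarefree_prod_prime_factors[OF n(2)]
    by (intro prod.cong refl) (simp add: recip_sign_commute)
  also have "\<dots> = recip_sign m n"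
    using prod_recip_sign[of ?P n] om squarefree_prod_prime_factors[OF m(2)] by (simp add: recip_sign_commute)
  also have "(\<Prod>p\<in>?P. \<Prod>q\<in>?Q. real_of_int (Legendre (int q) (int p))) = (\<Prod>q\<in>?Q. jac (int q) m)"
    unfolding jac_def by (rule prod.swap)
  also have "\<dots> = jac (\<Prod>q\<in>?Q. int q) m" by (rule jac_prod[OF m(1), symmetric])
  also have "\<dots> = jac (int n) m"
    using squarefree_prod_prime_factors[OF n(2)] by (simp flip: of_nat_prod)
  finally show ?thesis .
qed

text \<open>The eighth root of \<open>bilinear_long\<close>, with the coefficients \<open>b\<close>
  removed by absolute values; the constant 2 comes from 3 \<le> 2 ^ 8.\<close>

lemma bilinear_short:
  assumes a: "\<And>m. \<bar>a m\<bar> \<le> 1" and b: "\<And>n. \<bar>b n\<bar> \<le> 1" and N: "1 \<le> N" "N \<le> M"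
  shows "\<bar>\<Sum>m\<in>{1..M}. \<Sum>n\<in>odd_sqfree N. a m * b n * jac (int m) n\<bar>
      \<le> 2 * (real M * real N * harm (M ^ 4) ^ 8 * real N powr (- 1/8))"
proof -
  let ?S = "\<Sum>n\<in>odd_sqfree N. \<bar>\<Sum>m\<in>{1..M}. a m * jac (int m) n\<bar>"
  have "\<bar>\<Sum>m\<in>{1..M}. \<Sum>n\<in>odd_sqfree N. a m * b n * jac (int m) n\<bar>
      = \<bar>\<Sum>n\<in>odd_sqfree N. b n * (\<Sum>m\<in>{1..M}. a m * jac (int m) n)\<bar>"
    by (subst sum.swap) (simp add: sum_distrib_left mult_ac)
  also have "\<dots> \<le> ?S"
  proof (rule order_trans[OF sum_abs sum_mono])
    fix n
    show "\<bar>b n * (\<Sum>m\<in>{1..M}. a m * jac (int m) n)\<bar> \<le> \<bar>\<Sum>m\<in>{1..M}. a m * jac (int m) n\<bar>"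
      unfolding abs_mult using b[of n] by (intro mult_left_le_one_le) auto
  qed
  also have "\<dots> \<le> 2 * (real M * real N * harm (M ^ 4) ^ 8 * real N powr (- 1/8))"
  proof (rule power_le_imp_le_base)
    have h: "harm (M ^ 4) \<ge> (0::real)" by (rule harm_nonneg)
    have "(real N powr (- 1/8)) ^ 8 = real N powr (- 1)"
      using N by (simp add: powr_realpow[symmetric] powr_powr)
    also have "\<dots> = 1 / real N" using N by (intro powr_neg_one) auto
    finally have e: "(real N powr - (1/8)) ^ 8 = 1 / real N" by simp
    have "?S ^ 8 \<le> 3 * (real M * real N) ^ 8 * harm (M ^ 4) ^ 64 / real N"
      by (rule bilinear_long[OF a N])
    also have "\<dots> \<le> 256 * (real M * real N) ^ 8 * harm (M ^ 4) ^ 64 / real N"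
      by (intro divide_right_mono mult_right_mono) (auto simp: h)
    also have "\<dots> = (2 * (real M * real N * harm (M ^ 4) ^ 8 * real N powr (- 1/8))) ^ 8"
      by (simp add: power_mult_distrib e flip: power_mult)
    finally show "?S ^ Suc 7 \<le> (2 * (real M * real N * harm (M ^ 4) ^ 8 * real N powr (- 1/8))) ^ Suc 7"
      by simp
    show "0 \<le> 2 * (real M * real N * harm (M ^ 4) ^ 8 * real N powr (- 1/8))" using h by simp
  qed
  finally show ?thesis .
qed

text \<open>For \<open>M < N\<close> reciprocity exchanges the arguments, so that the longer
  variable is again the upper one. The sign splits the sum into four separated sums with
  coefficients 1/2 or -1/2, which doubles the constant.\<close>

proposition bilinear_jacobi_bound:
  assumes a: "\<And>m. \<bar>a m\<bar> \<le> 1" and b: "\<And>n. \<bar>b n\<bar> \<le> 1" and N: "1 \<le> N" "1 \<le> M"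
  shows "\<bar>\<Sum>m\<in>odd_sqfree M. \<Sum>n\<in>odd_sqfree N. a m * b n * jac (int m) n\<bar>
      \<le> 4 * (real M * real N * harm ((max M N) ^ 4) ^ 8 * real (min M N) powr (- 1/8))"
proof (cases "N \<le> M")
  case True
  define a' where "a' m = (if m \<in> odd_sqfree M then a m else 0)" for m
  have a': "\<bar>a' m\<bar> \<le> 1" for m using a[of m] by (simp add: a'_def)
  have "(\<Sum>m\<in>odd_sqfree M. \<Sum>n\<in>odd_sqfree N. a m * b n * jac (int m) n)
      = (\<Sum>m\<in>{1..M}. \<Sum>n\<in>odd_sqfree N. a' m * b n * jac (int m) n)"
    by (rule sum.mono_neutral_cong_left) (auto simp: a'_def odd_sqfree_def)
  then have "\<bar>\<Sum>m\<in>odd_sqfree M. \<Sum>n\<in>odd_sqfree N. a m * b n * jac (int m) n\<bar>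
      \<le> 2 * (real M * real N * harm (M ^ 4) ^ 8 * real N powr (- 1/8))"
    using bilinear_short[of a' b N M, OF a' b N(1) True] by simp
  also have "\<dots> \<le> 4 * (real M * real N * harm (M ^ 4) ^ 8 * real N powr (- 1/8))"
    by (intro mult_right_mono) (auto simp: harm_nonneg)
  finally show ?thesis using True by (simp add: max_absorb1 min_absorb2)
next
  case False
  then have MN: "M \<le> N" by simp
  let ?U = "2 * (real N * real M * harm (N ^ 4) ^ 8 * real M powr (- 1/8))"
  have key: "\<bar>\<Sum>n\<in>odd_sqfree N. \<Sum>m\<in>odd_sqfree M. f n * g m * jac (int n) m\<bar> \<le> ?U"
    if f: "\<And>n. \<bar>f n\<bar> \<le> 1" and g: "\<And>m. \<bar>g m\<bar> \<le> 1" for f g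
  proof -
    define f' where "f' m = (if m \<in> odd_sqfree N then f m else 0)" for m
    have f': "\<bar>f' m\<bar> \<le> 1" for m using f[of m] by (simp add: f'_def)
    have "(\<Sum>n\<in>odd_sqfree N. \<Sum>m\<in>odd_sqfree M. f n * g m * jac (int n) m)
        = (\<Sum>n\<in>{1..N}. \<Sum>m\<in>odd_sqfree M. f' n * g m * jac (int n) m)"
      by (rule sum.mono_neutral_cong_left) (auto simp: f'_def odd_sqfree_def)
    then show ?thesis using bilinear_short[of f' g M N, OF f' g N(2) MN] by simp
  qed
  define T where "T f g = (\<Sum>n\<in>odd_sqfree N. \<Sum>m\<in>odd_sqfree M. f n * g m * jac (int n) m)"
    for f g :: "nat \<Rightarrow> real"
  define bc where "bc n = b n * chi4 n" for n
  define ac where "ac n = a n * chi4 n" for n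
  have bc: "\<bar>bc n\<bar> \<le> 1" for n using b[of n] abs_chi4_le[of n] by (simp add: bc_def abs_mult mult_le_one)
  have ac: "\<bar>ac n\<bar> \<le> 1" for n using a[of n] abs_chi4_le[of n] by (simp add: ac_def abs_mult mult_le_one)
  have "(\<Sum>m\<in>odd_sqfree M. \<Sum>n\<in>odd_sqfree N. a m * b n * jac (int m) n)
     = (\<Sum>n\<in>odd_sqfree N. \<Sum>m\<in>odd_sqfree M. a m * b n * (recip_sign m n * jac (int n) m))"
  proof (subst sum.swap, intro sum.cong refl)
    fix n m assume nm: "n \<in> odd_sqfree N" "m \<in> odd_sqfree M"
    have "jac (int m) n = recip_sign m n * jac (int n) m"
      by (rule jac_reciprocity) (use nm in \<open>auto simp: odd_sqfree_def\<close>)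
    then show "a m * b n * jac (int m) n = a m * b n * (recip_sign m n * jac (int n) m)" by simp
  qed
  also have "\<dots> = (\<Sum>n\<in>odd_sqfree N. \<Sum>m\<in>odd_sqfree M.
      (b n * a m * jac (int n) m + b n * ac m * jac (int n) m + bc n * a m * jac (int n) m
       - bc n * ac m * jac (int n) m) / 2)"
  proof (intro sum.cong refl)
    fix n m assume nm: "n \<in> odd_sqfree N" "m \<in> odd_sqfree M"
    have r: "recip_sign m n = (1 + chi4 m + chi4 n - chi4 m * chi4 n) / 2"
      by (rule recip_sign_eq) (use nm in \<open>auto simp: odd_sqfree_def\<close>)
    have "A * B * ((1 + X + Y - X * Y) / 2 * J) = (B * A * J + B * (A * X) * J + B * Y * A * J - B * Y * (A * X) * J) / 2"
      for A B X Y J :: real by (simp add: algebra_simps add_divide_distrib diff_divide_distrib)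
    then show "a m * b n * (recip_sign m n * jac (int n) m) =
      (b n * a m * jac (int n) m + b n * ac m * jac (int n) m + bc n * a m * jac (int n) m
       - bc n * ac m * jac (int n) m) / 2"
      unfolding ac_def bc_def r by blast
  qed
  also have "\<dots> = (T b a + T b ac + T bc a - T bc ac) / 2"
    by (simp add: T_def sum.distrib sum_subtractf flip: sum_divide_distrib)
  finally have "\<bar>\<Sum>m\<in>odd_sqfree M. \<Sum>n\<in>odd_sqfree N. a m * b n * jac (int m) n\<bar>
      = \<bar>T b a + T b ac + T bc a - T bc ac\<bar> / 2" by simp
  moreover have "\<bar>T b a\<bar> \<le> ?U" "\<bar>T b ac\<bar> \<le> ?U" "\<bar>T bc a\<bar> \<le> ?U" "\<bar>T bc ac\<bar> \<le> ?U"
    unfolding T_def by (intro key a b ac bc)+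
  moreover have "\<bar>s\<bar> \<le> 2 * u"
    if "\<bar>s\<bar> = \<bar>w + x + y - z\<bar> / 2" "\<bar>w\<bar> \<le> u" "\<bar>x\<bar> \<le> u" "\<bar>y\<bar> \<le> u" "\<bar>z\<bar> \<le> u"
    for s u w x y z :: real
  proof -
    have "w \<le> u" "- w \<le> u" "x \<le> u" "- x \<le> u" "y \<le> u" "- y \<le> u" "z \<le> u" "- z \<le> u"
      using that by (simp_all add: abs_le_iff)
    then have "\<bar>w + x + y - z\<bar> \<le> 4 * u" by (intro abs_leI; linarith)
    then show ?thesis unfolding that(1) by simp
  qed
  ultimately have "\<bar>\<Sum>m\<in>odd_sqfree M. \<Sum>n\<in>odd_sqfree N. a m * b n * jac (int m) n\<bar> \<le> 2 * ?U" by blast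
  then show ?thesis using MN by (simp add: max_absorb2 min_absorb1 mult_ac)
qed

section \<open>The second descent\<close>

text \<open>Pairs of bits rather than an enumeration, because the indices are later treated as
  elements of the field of four elements, whose addition is bitwise exclusive or.\<close>

type_synonym idx = "bool \<times> bool"

abbreviation i1 :: idx where "i1 \<equiv> (False, False)"
abbreviation i2 :: idx where "i2 \<equiv> (False, True)"
abbreviation i3 :: idx where "i3 \<equiv> (True, False)"
abbreviation i4 :: idx where "i4 \<equiv> (True, True)"

lemma UNIV_idx: "(UNIV :: idx set) = {i1, i2, i3, i4}" by auto

lemma prod_UNIV_idx: "(\<Prod>k\<in>UNIV. f k) = f i1 * f i2 * f i3 * (f i4 :: 'a::comm_monoid_mult)"
  unfolding UNIV_idx by (simp add: mult.assoc)

text \<open>In the descent, \<open>D i1, D i2, D i3, D i4\<close> are the odd parts of \<open>d\<^sub>1, d\<^sub>2, g, e'\<close> in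
  \<open>g x\<^sup>2 - e' y\<^sup>2 = d\<^sub>1 u\<^sup>2\<close> and \<open>g x\<^sup>2 + e' y\<^sup>2 = d\<^sub>2 v\<^sup>2\<close>. At the primes dividing \<open>D i\<close> there are four
  characters, indexed by \<open>l\<close>: the trivial one for \<open>l = i\<close>, and otherwise the one built from the
  two \<open>D k\<close> with \<open>k\<close> outside \<open>{i, l}\<close>.\<close>

definition dep :: "idx \<Rightarrow> idx \<Rightarrow> idx \<Rightarrow> bool" where
  "dep i l k \<longleftrightarrow> k \<noteq> i \<and> l \<noteq> i \<and> k \<noteq> l"

definition dprod :: "idx \<Rightarrow> idx \<Rightarrow> (idx \<Rightarrow> nat) \<Rightarrow> int" where
  "dprod i l D = (\<Prod>k\<in>UNIV. if dep i l k then int (D k) else 1)"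

text \<open>The constants come from reducing the two equations modulo a prime dividing \<open>D i\<close>, for instance
  \<open>2 g x\<^sup>2 = d\<^sub>2 v\<^sup>2\<close> modulo a divisor of \<open>d\<^sub>1\<close>.\<close>

definition descent_sign :: "idx \<Rightarrow> idx \<Rightarrow> int" where
  "descent_sign i l =
    (if i = i1 then (if l = i3 \<or> l = i4 then 2 else 1)
     else if i = i2 then (if l = i1 then -1 else if l = i4 then 2 else if l = i3 then -2 else 1)
     else if i = i3 then (if l = i2 \<or> l = i4 then -1 else 1)
     else 1)"

text \<open>\<open>s k\<close> is the power of 2, namely 1 or 2, in the squarefree coefficient with
  odd part \<open>D k\<close>. It is moved into the constant so that the symbols involve odd
  variables only.\<close>

definition descent_coeff :: "(idx \<Rightarrow> nat) \<Rightarrow> idx \<Rightarrow> idx \<Rightarrow> int" where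
  "descent_coeff s i l = descent_sign i l * dprod i l s"

definition descent_cond :: "(idx \<Rightarrow> idx \<Rightarrow> int) \<Rightarrow> (idx \<Rightarrow> nat) \<Rightarrow> bool" where
  "descent_cond \<kappa> D \<longleftrightarrow> (\<forall>i l p. prime p \<longrightarrow> p dvd D i \<longrightarrow> Legendre (\<kappa> i l * dprod i l D) (int p) = 1)"

lemma dprod_mult: "dprod i l (\<lambda>k. s k * D k) = dprod i l s * dprod i l D"
  unfolding dprod_def prod.distrib[symmetric] by (intro prod.cong) auto

section \<open>From a primitive solution to a descent tuple\<close>

lemma Legendre_of_cong_squares:
  assumes p: "prime (p::nat)" "2 < p" and c: "[A * x\<^sup>2 = B * y\<^sup>2] (mod int p)"
    and nd: "\<not> int p dvd A * x\<^sup>2"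
  shows "Legendre (A * B) (int p) = 1"
proof -
  have "\<not> int p dvd B * y\<^sup>2" using c nd cong_dvd_iff by blast
  then have n: "\<not> int p dvd A * x" "\<not> int p dvd y" using nd by (auto simp: power2_eq_square simp flip: mult.assoc)
  have "[A * (A * x\<^sup>2) = A * (B * y\<^sup>2)] (mod int p)" by (intro cong_mult cong_refl c)
  then have "Legendre ((A * x)\<^sup>2) p = Legendre (A * B * y\<^sup>2) p"
    by (intro Legendre_cong) (simp add: power2_eq_square mult_ac)
  moreover have "Legendre ((A * x)\<^sup>2) p = 1" "Legendre (y\<^sup>2) p = 1"
    using n p by (auto intro!: Legendre_square)
  ultimately show ?thesis by (simp add: Legendre_mult[OF p])
qed

lemma squarefree_odd_split:
  assumes "squarefree (m::nat)"
  obtains s D where "m = s * D" "s \<in> {1, 2}" "odd D"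
proof (cases "even m")
  case True
  then obtain D where D: "m = 2 * D" by blast
  have "odd D"
  proof
    assume "even D"
    then have "2 ^ 2 dvd m" using D by (auto simp: power2_eq_square)
    then have "(2::nat) dvd 1" using assms unfolding squarefree_def by blast
    then show False by simp
  qed
  then show ?thesis using D that[of 2 D] by simp
qed (use that[of 1 m] in simp)

lemma squarefree_dvd_of_dvd_square:
  assumes "squarefree (d::nat)" "d dvd z\<^sup>2"
  shows "d dvd z"
proof -
  have "\<Prod>(prime_factors d) dvd z"
  proof (rule prod_primes_dvd)
    fix q assume "q \<in> prime_factors d"
    then have "prime q" "q dvd z\<^sup>2" using assms(2) by (auto simp: in_prime_factors_iff intro: dvd_trans)
    then show "prime q \<and> q dvd z" using prime_dvd_power by blast
  qed simp
  moreover have "\<Prod>(prime_factors d) = d" using assms(1) by (rule squarefree_prod_prime_factors)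
  ultimately show ?thesis by simp
qed

lemma eq_of_same_odd_primes:
  assumes "squarefree (a::nat)" "squarefree b" "odd a" "odd b"
    and "\<And>q. prime q \<Longrightarrow> odd q \<Longrightarrow> q dvd a \<longleftrightarrow> q dvd b"
  shows "a = b"
proof -
  have aux: "x dvd y" if "squarefree x" "odd x" "\<And>q. prime q \<Longrightarrow> odd q \<Longrightarrow> q dvd x \<longrightarrow> q dvd y" for x y :: nat
  proof -
    have n0: "x \<noteq> 0" using that(1) by (metis not_squarefree_0)
    show ?thesis
    proof (cases "y = 0")
      case False
      show ?thesis
      proof (rule multiplicity_le_imp_dvd[OF n0])
        fix q :: nat assume q: "prime q"
        have "multiplicity q x \<le> 1" using squarefree_factorial_semiring''[OF n0] that(1) q by blast
        moreover have "q dvd y" if "multiplicity q x > 0"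
        proof -
          have "q dvd x" using that by (metis not_dvd_imp_multiplicity_0 less_irrefl)
          moreover then have "odd q" using \<open>odd x\<close> dvd_trans by blast
          ultimately show ?thesis using \<open>\<And>q. prime q \<Longrightarrow> odd q \<Longrightarrow> q dvd x \<longrightarrow> q dvd y\<close> q by blast
        qed
        then have "multiplicity q y > 0" if "multiplicity q x > 0"
          using that q False by (simp add: prime_multiplicity_gt_zero_iff prime_imp_prime_elem)
        ultimately show "multiplicity q x \<le> multiplicity q y" by linarith
      qed
    qed simp
  qed
  show ?thesis by (rule dvd_antisym; rule aux) (use assms in auto)
qed

text \<open>Since \<open>d\<close> divides \<open>z\<close> and \<open>g = gcd x e\<close> can be
  cancelled, the equation becomes \<open>d w\<^sup>2 = (a - b) (a + b)\<close> with
  \<open>a = g x1\<^sup>2\<close> and \<open>b = e' y\<^sup>2\<close> coprime. The two factors share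
  no odd prime, so their squarefree parts \<open>d1\<close> and \<open>d2\<close> distribute the odd
  part of \<open>d\<close>; reducing the two resulting equations modulo each odd prime gives the
  symbols.\<close>

lemma descent:
  fixes d e x y z :: nat
  assumes sf: "squarefree (d * e)" and e1: "e \<noteq> 1" and cop: "coprime x y"
    and eq: "z\<^sup>2 + d * e\<^sup>2 * y ^ 4 = d * x ^ 4"
  shows "\<exists>s D. (\<forall>k. s k \<in> {1, 2}) \<and> odd (\<Prod>k\<in>UNIV. D k) \<and> squarefree (\<Prod>k\<in>UNIV. D k) \<and>
    e = s i3 * D i3 * (s i4 * D i4) \<and> (d * e = (\<Prod>k\<in>UNIV. D k) \<or> d * e = 2 * (\<Prod>k\<in>UNIV. D k)) \<and>
    descent_cond (descent_coeff s) D"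
proof -
  have de0: "d \<noteq> 0" "e \<noteq> 0" using sf by (auto intro!: Nat.gr0I)
  have sfd: "squarefree d" and sfe: "squarefree e" using sf squarefree_multD by blast+
  have copde: "coprime d e"
  proof (rule ccontr)
    assume "\<not> coprime d e"
    then obtain q where q: "prime q" "q dvd d" "q dvd e"
      by (metis coprime_iff_gcd_eq_1 gcd_nat.boundedE prime_factor_nat)
    then have "q ^ 2 dvd d * e" by (auto simp: power2_eq_square intro: mult_dvd_mono)
    then show False using sf q(1) unfolding squarefree_def by (metis not_prime_unit)
  qed
  \<comment> \<open>Cancelling this gcd is what makes \<open>a\<close> and \<open>b\<close> below
    coprime; \<open>g\<close> and the cofactor \<open>e'\<close> become two of the four factors of
    the tuple.\<close>
  define g where "g = gcd x e"
  have g0: "g > 0" using de0 by (simp add: g_def)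
  obtain x1 e' where x1: "x = g * x1" and e': "e = g * e'" and cxe: "coprime x1 e'"
    using gcd_coprime_exists[of x e] g0 by (metis g_def mult.commute not_gr_zero)
  have sfg: "squarefree g" and sfe': "squarefree e'" using sfe e' squarefree_multD by blast+
  have cge: "coprime g e'"
  proof (rule ccontr)
    assume "\<not> coprime g e'"
    then obtain q where q: "prime q" "q dvd g" "q dvd e'"
      by (metis coprime_iff_gcd_eq_1 gcd_nat.boundedE prime_factor_nat)
    then have "q ^ 2 dvd e" using e' by (auto simp: power2_eq_square intro: mult_dvd_mono)
    then show False using sfe q(1) unfolding squarefree_def by (metis not_prime_unit)
  qed
  have cgy: "coprime g y" using cop x1 by simp
  have cx1y: "coprime x1 y" using cop x1 by simp
  have "d dvd z\<^sup>2"
  proof -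
    have "d dvd z\<^sup>2 + d * e\<^sup>2 * y ^ 4" using eq by simp
    then show ?thesis by (simp add: dvd_add_left_iff mult.assoc)
  qed
  then have "d dvd z" by (rule squarefree_dvd_of_dvd_square[OF sfd])
  then obtain z1 where z1: "z = d * z1" by blast
  have eq1: "d * z1\<^sup>2 + e\<^sup>2 * y ^ 4 = x ^ 4"
  proof -
    have "d * (d * z1\<^sup>2 + e\<^sup>2 * y ^ 4) = d * x ^ 4"
      using eq z1 by (simp add: algebra_simps power2_eq_square)
    then show ?thesis using de0 by simp
  qed
  have "g\<^sup>2 dvd d * z1\<^sup>2 + e\<^sup>2 * y ^ 4" unfolding eq1 x1 by (simp add: power_mult_distrib le_imp_power_dvd)
  moreover have "g\<^sup>2 dvd e\<^sup>2 * y ^ 4" unfolding e' by (simp add: power_mult_distrib mult.assoc)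
  ultimately have "g\<^sup>2 dvd d * z1\<^sup>2" by (simp add: dvd_add_left_iff)
  moreover have "coprime (g\<^sup>2) d" using copde e' by (simp add: coprime_commute)
  ultimately have "g\<^sup>2 dvd z1\<^sup>2" by (simp add: coprime_dvd_mult_right_iff)
  then have "g dvd z1" by simp
  then obtain w where w: "z1 = g * w" by blast
  define a where "a = g * x1\<^sup>2"
  define b where "b = e' * y\<^sup>2"
  have eq2: "d * w\<^sup>2 + b\<^sup>2 = a\<^sup>2"
  proof -
    have "g\<^sup>2 * (d * w\<^sup>2 + b\<^sup>2) = d * z1\<^sup>2 + e\<^sup>2 * y ^ 4" unfolding w e' b_def
      by (simp add: algebra_simps power2_eq_square power4_eq_xxxx)
    also have "\<dots> = g\<^sup>2 * a\<^sup>2" unfolding eq1 x1 a_def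
      by (simp add: algebra_simps power2_eq_square power4_eq_xxxx)
    finally show ?thesis using g0 by simp
  qed
  have cab: "coprime a b" unfolding a_def b_def using cge cgy cxe cx1y by simp
  \<comment> \<open>\<open>w = 0\<close> would force \<open>a = b = 1\<close> and hence
    \<open>e = 1\<close>, the case with the trivial point \<open>(1, 1)\<close> and value 0.\<close>
  have w0: "w \<noteq> 0"
  proof
    assume "w = 0"
    then have "a = b" using eq2 by simp
    then have "a = 1" "b = 1" using cab by auto
    then have "g = 1" "e' = 1" by (simp_all add: a_def b_def)
    then show False using e1 e' by simp
  qed
  then have "b\<^sup>2 < a\<^sup>2" using eq2 de0 by (metis add_gr_0 less_add_same_cancel2 mult_eq_0_iff neq0_conv power_eq_0_iff)
  then have ba: "b < a" by (rule power_less_imp_less_base) simp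
  define P where "P = a - b"
  define Q where "Q = a + b"
  have PQ: "P * Q = d * w\<^sup>2"
  proof -
    obtain c where c: "a = b + c" using ba less_imp_add_positive by blast
    have "P * Q + b\<^sup>2 = a\<^sup>2" unfolding P_def Q_def c by (simp add: algebra_simps power2_eq_square)
    then show ?thesis using eq2 by simp
  qed
  have P0: "P > 0" "Q > 0" using ba by (auto simp: P_def Q_def)
  define d1 where "d1 = squarefree_part P"
  define u where "u = square_part P"
  define d2 where "d2 = squarefree_part Q"
  define v where "v = square_part Q"
  have Pd: "P = d1 * u\<^sup>2" and Qd: "Q = d2 * v\<^sup>2"
    unfolding d1_def u_def d2_def v_def by (simp_all add: squarefree_decompose)
  have sf1: "squarefree d1" and sf2: "squarefree d2"
    unfolding d1_def d2_def by simp_all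
  have uv0: "d1 \<noteq> 0" "d2 \<noteq> 0" "u \<noteq> 0" "v \<noteq> 0" using P0 Pd Qd by auto
  have not_both: "\<not> (q dvd P \<and> q dvd Q)" if q: "prime q" "odd q" for q
  proof
    assume "q dvd P \<and> q dvd Q"
    then have "q dvd Q + P" "q dvd Q - P" by (auto intro: dvd_diff_nat)
    then have "q dvd 2 * a" "q dvd 2 * b" using ba by (simp_all add: P_def Q_def mult_2)
    moreover have "\<not> q dvd 2" using q primes_dvd_imp_eq[of q 2] by auto
    ultimately have "q dvd a" "q dvd b" using q(1) prime_dvd_mult_iff by blast+
    then show False using cab q(1) by (metis coprime_common_divisor not_prime_unit)
  qed
  obtain s1 D1 where 1: "d1 = s1 * D1" "s1 \<in> {1,2}" "odd D1" using squarefree_odd_split[OF sf1] by blast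
  obtain s2 D2 where 2: "d2 = s2 * D2" "s2 \<in> {1,2}" "odd D2" using squarefree_odd_split[OF sf2] by blast
  obtain s3 D3 where 3: "g = s3 * D3" "s3 \<in> {1,2}" "odd D3" using squarefree_odd_split[OF sfg] by blast
  obtain s4 D4 where 4: "e' = s4 * D4" "s4 \<in> {1,2}" "odd D4" using squarefree_odd_split[OF sfe'] by blast
  obtain s0 D0 where 0: "d = s0 * D0" "s0 \<in> {1,2}" "odd D0" using squarefree_odd_split[OF sfd] by blast
  have dvd_s: "q dvd t * D' \<longleftrightarrow> q dvd D'" if "prime q" "odd q" "t \<in> {1,2}" for q t D' :: nat
    using that primes_dvd_imp_eq[of q 2] by (auto simp: prime_dvd_mult_iff)
  \<comment> \<open>At an odd prime, \<open>P Q = d w\<^sup>2\<close> compares the parities of the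
    valuations, and at most one of \<open>d1\<close> and \<open>d2\<close> is divisible by
    it.\<close>
  have D0: "D0 = D1 * D2"
  proof (rule eq_of_same_odd_primes)
    show "squarefree D0" using sfd 0 squarefree_multD by blast
    have s: "squarefree D1" "squarefree D2" using sf1 sf2 1 2 squarefree_multD by blast+
    show "odd D0" "odd (D1 * D2)" using 0 1 2 by auto
    have "coprime D1 D2"
    proof (rule ccontr)
      assume "\<not> coprime D1 D2"
      then obtain q where q: "prime q" "q dvd D1" "q dvd D2"
        by (metis coprime_iff_gcd_eq_1 gcd_nat.boundedE prime_factor_nat)
      then have "odd q" using 1 dvd_trans by blast
      then show False using not_both[OF q(1)] q Pd Qd 1 2 by (meson dvd_mult dvd_mult2)
    qed
    then show "squarefree (D1 * D2)" using s by (rule squarefree_mult_coprime)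
    fix q :: nat assume q: "prime q" "odd q"
    have pe: "prime_elem q" using q by simp
    let ?m = "multiplicity q"
    have m1: "?m d1 \<le> 1" "?m d2 \<le> 1" "?m d \<le> 1"
      using squarefree_factorial_semiring'' sf1 sf2 sfd uv0 de0 q by blast+
    have gt: "?m t > 0 \<longleftrightarrow> q dvd t" if "t \<noteq> 0" for t
      using prime_multiplicity_gt_zero_iff[OF pe that] .
    have "?m (P * Q) = ?m d1 + 2 * ?m u + (?m d2 + 2 * ?m v)"
      unfolding Pd Qd using uv0 pe
      by (simp add: prime_elem_multiplicity_mult_distrib prime_elem_multiplicity_power_distrib)
    moreover have "?m (P * Q) = ?m d + 2 * ?m w"
      unfolding PQ using w0 de0 pe
      by (simp add: prime_elem_multiplicity_mult_distrib prime_elem_multiplicity_power_distrib)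
    ultimately have m2: "?m d1 + 2 * ?m u + (?m d2 + 2 * ?m v) = ?m d + 2 * ?m w" by simp
    have m3: "\<not> (?m d1 > 0 \<and> ?m d2 > 0)"
      using not_both[OF q] gt uv0 Pd Qd by (metis dvd_mult2)
    have "?m d > 0 \<longleftrightarrow> ?m d1 > 0 \<or> ?m d2 > 0" using m1 m2 m3 by presburger
    then have "q dvd d \<longleftrightarrow> q dvd d1 \<or> q dvd d2" using gt uv0 de0 by simp
    moreover have "q dvd d \<longleftrightarrow> q dvd D0" "q dvd d1 \<longleftrightarrow> q dvd D1" "q dvd d2 \<longleftrightarrow> q dvd D2"
      unfolding 0(1) 1(1) 2(1) by (rule dvd_s[OF q 0(2)], rule dvd_s[OF q 1(2)], rule dvd_s[OF q 2(2)])
    ultimately show "q dvd D0 \<longleftrightarrow> q dvd D1 * D2"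
      using q(1) by (simp only: prime_dvd_mult_iff)
  qed
  define s where "s k = (if k = i1 then s1 else if k = i2 then s2 else if k = i3 then s3 else s4)" for k
  define D where "D k = (if k = i1 then D1 else if k = i2 then D2 else if k = i3 then D3 else D4)" for k
  have prodD: "(\<Prod>k\<in>UNIV. D k) = D0 * (D3 * D4)"
    unfolding prod_UNIV_idx by (simp add: D_def D0 mult.assoc)
  have n: "d * e = (s0 * s3 * s4) * (\<Prod>k\<in>UNIV. D k)"
    unfolding prodD e' 0(1) 3(1) 4(1) by (simp add: mult_ac)
  have sfs: "squarefree (s0 * s3 * s4)" and sfD: "squarefree (\<Prod>k\<in>UNIV. D k)"
    using sf squarefree_multD unfolding n by blast+
  \<comment> \<open>The powers of 2 in \<open>d\<close>, \<open>g\<close> and \<open>e'\<close>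
    multiply to the one in the squarefree number \<open>d e\<close>, so at most one of them is 2.
    This is why the product of the tuple determines \<open>d e\<close> up to a factor 2.\<close>
  have ss: "s0 * s3 * s4 = 1 \<or> s0 * s3 * s4 = 2"
  proof -
    have "\<not> 4 dvd s0 * s3 * s4"
    proof
      assume "4 dvd s0 * s3 * s4"
      then have "(2::nat)\<^sup>2 dvd s0 * s3 * s4" by simp
      then have "(2::nat) dvd 1" using sfs unfolding squarefree_def by blast
      then show False by simp
    qed
    then show ?thesis using 0(2) 3(2) 4(2) by auto
  qed
  have F: "s i1 * D i1 = d1" "s i2 * D i2 = d2" "s i3 * D i3 = g" "s i4 * D i4 = e'"
    using 1 2 3 4 by (simp_all add: s_def D_def)
  have cond: "Legendre (descent_sign i l * dprod i l (\<lambda>k. s k * D k)) (int p) = 1"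
    if p: "prime p" "p dvd D i" for i l p
  proof -
    have oD: "odd (D i)" using 1 2 3 4 by (simp add: D_def)
    then have op: "odd p" using p dvd_trans by blast
    then have p2: "2 < p" using p prime_ge_2_nat[of p] by (cases "p = 2") auto
    have pp: "prime (int p)" using p by simp
    have n2: "\<not> int p dvd 2" using p2 zdvd_not_zless[of 2 "int p"] by simp
    note LL = Legendre_of_cong_squares[OF p(1) p2]
    have Pi: "int P = int a - int b" using ba by (simp add: P_def of_nat_diff)
    have Qi: "int Q = int a + int b" by (simp add: Q_def)
    have Pi': "int d1 * (int u)\<^sup>2 = int a - int b" using Pi Pd by simp
    have Qi': "int d2 * (int v)\<^sup>2 = int a + int b" using Qi Qd by simp
    have ai: "int a = int g * (int x1)\<^sup>2" and bi: "int b = int e' * (int y)\<^sup>2" by (simp_all add: a_def b_def)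
    have nab: "\<not> (int p dvd int a \<and> int p dvd int b)"
      using cab p(1) by (metis coprime_common_divisor not_prime_unit of_nat_dvd_iff)
    have Ld: "Legendre 1 (int p) = 1" using p2 by (simp add: Legendre_1)
    consider "i = i1" | "i = i2" | "i = i3" | "i = i4" by (metis (full_types) prod.exhaust)
    then show ?thesis
    proof cases
      case 1
      then have "p dvd d1" using p F(1) by (metis dvd_mult)
      then have "int p dvd int d1 * (int u)\<^sup>2" by simp
      then have dv: "int p dvd int a - int b" by (simp only: Pi')
      have na: "\<not> int p dvd int a" "\<not> int p dvd int b"
        using dv nab by (metis diff_add_cancel dvd_add_right_iff dvd_add)+
      have c1: "[int g * (int x1)\<^sup>2 = int e' * (int y)\<^sup>2] (mod int p)"
        using dv unfolding ai bi cong_iff_dvd_diff .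
      have c2: "[2 * int g * (int x1)\<^sup>2 = int d2 * (int v)\<^sup>2] (mod int p)"
        using dv unfolding cong_iff_dvd_diff Qi' by (simp add: ai[symmetric] mult.assoc)
      have c3: "[2 * int e' * (int y)\<^sup>2 = int d2 * (int v)\<^sup>2] (mod int p)"
        using dv unfolding cong_iff_dvd_diff Qi' by (simp add: bi[symmetric] mult.assoc dvd_diff_commute)
      have nd: "\<not> int p dvd 2 * int g * (int x1)\<^sup>2" "\<not> int p dvd 2 * int e' * (int y)\<^sup>2"
        using na n2 pp unfolding ai bi mult.assoc by (simp_all only: prime_dvd_mult_iff) auto
      have "Legendre (int g * int e') p = 1" "Legendre (2 * int g * int d2) p = 1" "Legendre (2 * int e' * int d2) p = 1"
        using LL[OF c1] LL[OF c2] LL[OF c3] na nd unfolding ai bi by blast+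
      then show ?thesis using Ld 1 F
        by (cases l rule: prod.exhaust)
          (auto simp: descent_sign_def dprod_def prod_UNIV_idx dep_def mult_ac simp flip: of_nat_mult split: if_splits)
    next
      case 2
      then have "p dvd d2" using p F(2) by (metis dvd_mult)
      then have "int p dvd int d2 * (int v)\<^sup>2" by simp
      then have dv: "int p dvd int a + int b" by (simp only: Qi')
      have na: "\<not> int p dvd int a" "\<not> int p dvd int b"
        using dv nab by (metis dvd_add_right_iff dvd_add_left_iff)+
      have c1: "[int g * (int x1)\<^sup>2 = (- int e') * (int y)\<^sup>2] (mod int p)"
        using dv unfolding ai bi cong_iff_dvd_diff by simp
      have c2: "[2 * int g * (int x1)\<^sup>2 = int d1 * (int u)\<^sup>2] (mod int p)"
        using dv unfolding cong_iff_dvd_diff Pi' by (simp add: ai[symmetric] mult.assoc)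
      have c3: "[- 2 * int e' * (int y)\<^sup>2 = int d1 * (int u)\<^sup>2] (mod int p)"
      proof -
        have "- 2 * int e' * (int y)\<^sup>2 - int d1 * (int u)\<^sup>2 = - (int a + int b)"
          unfolding Pi' by (simp add: bi)
        then show ?thesis using dv by (simp only: cong_iff_dvd_diff dvd_minus_iff)
      qed
      have nd: "\<not> int p dvd 2 * int g * (int x1)\<^sup>2" "\<not> int p dvd - 2 * int e' * (int y)\<^sup>2"
        using na n2 pp unfolding ai bi by (simp_all add: prime_dvd_mult_iff mult.assoc)
      have "Legendre (int g * - int e') p = 1" "Legendre (2 * int g * int d1) p = 1" "Legendre (- 2 * int e' * int d1) p = 1"
        using LL[OF c1] LL[OF c2] LL[OF c3] na nd unfolding ai bi by blast+
      then show ?thesis using Ld 2 F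
        by (cases l rule: prod.exhaust)
          (auto simp: descent_sign_def dprod_def prod_UNIV_idx dep_def mult_ac simp flip: of_nat_mult split: if_splits)
    next
      case 3
      then have "p dvd g" using p F(3) by (metis dvd_mult)
      then have da: "int p dvd int a" by (simp add: ai)
      then have nb: "\<not> int p dvd int b" using nab by blast
      have c1: "[(- int e') * (int y)\<^sup>2 = int d1 * (int u)\<^sup>2] (mod int p)"
        using da unfolding cong_iff_dvd_diff Pi' by (simp add: bi)
      have c2: "[int e' * (int y)\<^sup>2 = int d2 * (int v)\<^sup>2] (mod int p)"
        using da unfolding cong_iff_dvd_diff Qi' by (simp add: bi)
      \<comment> \<open>The third relation comes from multiplying the two equations:
        \<open>d1 d2 (u v)\<^sup>2 = a\<^sup>2 - b\<^sup>2\<close>, and here \<open>p\<close>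
        divides \<open>a\<close>.\<close>
      have c3: "[(- 1) * (int b)\<^sup>2 = (int d1 * int d2) * (int u * int v)\<^sup>2] (mod int p)"
      proof -
        have "(int d1 * int d2) * (int u * int v)\<^sup>2 = (int a - int b) * (int a + int b)"
          unfolding Pi'[symmetric] Qi'[symmetric] by (simp add: power_mult_distrib mult_ac)
        then have "(- 1) * (int b)\<^sup>2 - (int d1 * int d2) * (int u * int v)\<^sup>2 = - (int a * int a)"
          by (simp add: algebra_simps power2_eq_square)
        then show ?thesis using da unfolding cong_iff_dvd_diff by simp
      qed
      have nd: "\<not> int p dvd (- int e') * (int y)\<^sup>2" "\<not> int p dvd int e' * (int y)\<^sup>2" "\<not> int p dvd (- 1) * (int b)\<^sup>2"
        using nb pp by (simp_all add: bi[symmetric] prime_dvd_power_iff)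
      have "Legendre (- int e' * int d1) p = 1" "Legendre (int e' * int d2) p = 1" "Legendre (- 1 * (int d1 * int d2)) p = 1"
        using LL[OF c1 nd(1)] LL[OF c2 nd(2)] LL[OF c3 nd(3)] by blast+
      then show ?thesis using Ld 3 F
        by (cases l rule: prod.exhaust)
          (auto simp: descent_sign_def dprod_def prod_UNIV_idx dep_def mult_ac simp flip: of_nat_mult split: if_splits)
    next
      case 4
      then have "p dvd e'" using p F(4) by (metis dvd_mult)
      then have db: "int p dvd int b" by (simp add: bi)
      then have na: "\<not> int p dvd int a" using nab by blast
      have c1: "[int g * (int x1)\<^sup>2 = int d1 * (int u)\<^sup>2] (mod int p)"
        using db unfolding cong_iff_dvd_diff Pi' by (simp add: ai)
      have c2: "[int g * (int x1)\<^sup>2 = int d2 * (int v)\<^sup>2] (mod int p)"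
        using db unfolding cong_iff_dvd_diff Qi' by (simp add: ai)
      have c3: "[1 * (int a)\<^sup>2 = (int d1 * int d2) * (int u * int v)\<^sup>2] (mod int p)"
      proof -
        have "(int d1 * int d2) * (int u * int v)\<^sup>2 = (int a - int b) * (int a + int b)"
          unfolding Pi'[symmetric] Qi'[symmetric] by (simp add: power_mult_distrib mult_ac)
        then have "1 * (int a)\<^sup>2 - (int d1 * int d2) * (int u * int v)\<^sup>2 = int b * int b"
          by (simp add: algebra_simps power2_eq_square)
        then show ?thesis using db unfolding cong_iff_dvd_diff by simp
      qed
      have nd: "\<not> int p dvd int g * (int x1)\<^sup>2" "\<not> int p dvd 1 * (int a)\<^sup>2"
        using na pp by (simp_all add: ai[symmetric] prime_dvd_power_iff)
      have "Legendre (int g * int d1) p = 1" "Legendre (int g * int d2) p = 1" "Legendre (1 * (int d1 * int d2)) p = 1"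
        using LL[OF c1 nd(1)] LL[OF c2 nd(1)] LL[OF c3 nd(2)] by blast+
      then show ?thesis using Ld 4 F
        by (cases l rule: prod.exhaust)
          (auto simp: descent_sign_def dprod_def prod_UNIV_idx dep_def mult_ac simp flip: of_nat_mult split: if_splits)
    qed
  qed
  have "descent_cond (descent_coeff s) D"
    unfolding descent_cond_def descent_coeff_def using cond by (simp add: dprod_mult mult.assoc)
  moreover have "\<forall>k. s k \<in> {1, 2}" using 1(2) 2(2) 3(2) 4(2) by (simp add: s_def)
  moreover have "odd (\<Prod>k\<in>UNIV. D k)" unfolding prodD using 0 3 4 by simp
  moreover have "e = s i3 * D i3 * (s i4 * D i4)" by (simp only: F e')
  moreover have "d * e = (\<Prod>k\<in>UNIV. D k) \<or> d * e = 2 * (\<Prod>k\<in>UNIV. D k)" using n ss by auto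
  ultimately show ?thesis using sfD by blast
qed

section \<open>Expansion into characters\<close>

lemma prime_factors_prod_primes:
  assumes "finite A" "\<And>q. q \<in> A \<Longrightarrow> prime (q::nat)"
  shows "prime_factors (\<Prod>A) = A"
proof -
  have "\<Prod>A \<noteq> 0" using assms by (metis not_prime_0 prod_zero_iff)
  then show ?thesis using prime_dvd_prod_primes_iff[OF assms] assms(2)
    by (auto simp: in_prime_factors_iff)
qed

lemma squarefree_prodD:
  fixes e :: "'l::finite \<Rightarrow> nat"
  assumes "squarefree (\<Prod>l\<in>UNIV. e l)"
  shows "squarefree (e l)" "l \<noteq> l' \<Longrightarrow> coprime (e l) (e l')"
proof -
  have "(\<Prod>l\<in>UNIV. e l) = e l * (\<Prod>l\<in>UNIV - {l}. e l)" by (rule prod.remove) auto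
  then show "squarefree (e l)" using assms squarefree_multD by metis
  assume ne: "l \<noteq> l'"
  show "coprime (e l) (e l')"
  proof (rule ccontr)
    assume "\<not> coprime (e l) (e l')"
    then obtain q where q: "prime q" "q dvd e l" "q dvd e l'"
      by (metis coprime_iff_gcd_eq_1 gcd_nat.boundedE prime_factor_nat)
    have "e l * e l' = (\<Prod>k\<in>{l, l'}. e k)" using ne by simp
    also have "\<dots> dvd (\<Prod>l\<in>UNIV. e l)" by (rule prod_dvd_prod_subset) auto
    finally have "q ^ 2 dvd (\<Prod>l\<in>UNIV. e l)"
      using q by (metis mult_dvd_mono dvd_trans power2_eq_square)
    then show False using assms q(1) unfolding squarefree_def by (metis not_prime_unit)
  qed
qed

text \<open>Expanding the product assigns an index to every prime of \<open>m\<close>. Such an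
  assignment is the same as an ordered factorization of \<open>m\<close>, the factor at
  \<open>l\<close> collecting the primes sent to \<open>l\<close>.\<close>

lemma prod_sum_factorizations:
  fixes h :: "'l::finite \<Rightarrow> nat \<Rightarrow> real"
  assumes sf: "squarefree m"
  shows "(\<Prod>p\<in>prime_factors m. \<Sum>l\<in>UNIV. h l p)
    = (\<Sum>e | (\<Prod>l\<in>UNIV. e l) = m. \<Prod>l\<in>UNIV. \<Prod>p\<in>prime_factors (e l). h l p)"
proof -
  let ?P = "prime_factors m"
  have m0: "m \<noteq> 0" using sf by (metis not_squarefree_0)
  have prP: "prime p" if "p \<in> ?P" for p using that by auto
  define toE where "toE \<sigma> = (\<lambda>l. \<Prod>{p\<in>?P. \<sigma> p = l})" for \<sigma> :: "nat \<Rightarrow> 'l"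
  define toS where "toS e = (\<lambda>p\<in>?P. THE l. p dvd e l)" for e :: "'l \<Rightarrow> nat"
  have pfE: "prime_factors (toE \<sigma> l) = {p\<in>?P. \<sigma> p = l}" for \<sigma> l
    unfolding toE_def by (rule prime_factors_prod_primes) auto
  have prodE: "(\<Prod>l\<in>UNIV. toE \<sigma> l) = m" for \<sigma>
  proof -
    have "(\<Prod>l\<in>UNIV. toE \<sigma> l) = \<Prod>?P"
      unfolding toE_def by (rule prod.group) auto
    then show ?thesis using squarefree_prod_prime_factors[OF sf] by simp
  qed
  have val: "(\<Prod>l\<in>UNIV. \<Prod>p\<in>prime_factors (toE \<sigma> l). h l p) = (\<Prod>p\<in>?P. h (\<sigma> p) p)" for \<sigma>
  proof -
    have "(\<Prod>l\<in>UNIV. \<Prod>p\<in>prime_factors (toE \<sigma> l). h l p) = (\<Prod>l\<in>UNIV. \<Prod>p\<in>{p\<in>?P. \<sigma> p = l}. h (\<sigma> p) p)"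
      unfolding pfE by (intro prod.cong refl) auto
    also have "\<dots> = (\<Prod>p\<in>?P. h (\<sigma> p) p)" by (rule prod.group) auto
    finally show ?thesis .
  qed
  have uniq: "(THE l. p dvd e l) = l" if "(\<Prod>l\<in>UNIV. e l) = m" "prime p" "p dvd e l"
    for e :: "'l \<Rightarrow> nat" and p l
  proof (rule the_equality)
    fix l' assume l': "p dvd e l'"
    show "l' = l"
    proof (rule ccontr)
      assume "l' \<noteq> l"
      then have "coprime (e l') (e l)" using squarefree_prodD(2)[of e l' l] that sf by simp
      then show False using l' that by (metis coprime_common_divisor not_prime_unit)
    qed
  qed (rule that)
  have toE_toS: "toE (toS e) = e" if e: "(\<Prod>l\<in>UNIV. e l) = m" for e :: "'l \<Rightarrow> nat"
  proof
    fix l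
    have dv: "e l dvd m" unfolding e[symmetric] by (rule dvd_prodI) auto
    have "{p\<in>?P. toS e p = l} = prime_factors (e l)"
    proof (intro equalityI subsetI)
      fix p assume p: "p \<in> {p\<in>?P. toS e p = l}"
      then have pp: "prime p" "p dvd (\<Prod>l\<in>UNIV. e l)" using e by (auto simp: in_prime_factors_iff)
      then obtain l' where l': "p dvd e l'" using prime_dvd_prod_iff[of UNIV p e] by auto
      then have "(THE l. p dvd e l) = l'" using uniq[OF e pp(1)] by blast
      moreover have "p \<in> ?P" "toS e p = l" using p by auto
      ultimately have "l' = l" by (simp add: toS_def)
      then show "p \<in> prime_factors (e l)" using l' pp m0 dv by (auto simp: in_prime_factors_iff)
    next
      fix p assume "p \<in> prime_factors (e l)"
      then have "prime p" "p dvd e l" by (auto simp: in_prime_factors_iff)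
      then show "p \<in> {p\<in>?P. toS e p = l}"
        using uniq[OF e] dv m0 by (auto simp: toS_def in_prime_factors_iff intro: dvd_trans)
    qed
    then show "toE (toS e) l = e l"
      unfolding toE_def using squarefree_prodD(1)[of e l] e sf squarefree_prod_prime_factors by simp
  qed
  have toS_toE: "toS (toE \<sigma>) = \<sigma>" if \<sigma>: "\<sigma> \<in> PiE ?P (\<lambda>_. UNIV)" for \<sigma>
  proof
    fix p
    show "toS (toE \<sigma>) p = \<sigma> p"
    proof (cases "p \<in> ?P")
      case True
      then have "p \<in> prime_factors (toE \<sigma> (\<sigma> p))" by (simp add: pfE)
      then have "p dvd toE \<sigma> (\<sigma> p)" by auto
      then show ?thesis using uniq[OF prodE prP[OF True]] True by (simp add: toS_def)
    next
      case False
      then show ?thesis using \<sigma> by (auto simp: toS_def PiE_def extensional_def)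
    qed
  qed
  have "(\<Prod>p\<in>?P. \<Sum>l\<in>UNIV. h l p) = (\<Sum>\<sigma>\<in>PiE ?P (\<lambda>_. UNIV). \<Prod>p\<in>?P. h (\<sigma> p) p)"
    by (rule prod_sum_PiE) auto
  also have "\<dots> = (\<Sum>e | (\<Prod>l\<in>UNIV. e l) = m. \<Prod>l\<in>UNIV. \<Prod>p\<in>prime_factors (e l). h l p)"
    by (rule sum.reindex_bij_witness[where i=toS and j=toE])
      (use toE_toS toS_toE prodE val in \<open>auto simp: toS_def\<close>)
  finally show ?thesis .
qed

lemma card_factorizations:
  assumes "squarefree m"
  shows "card {e :: 'l::finite \<Rightarrow> nat. (\<Prod>l\<in>UNIV. e l) = m} = CARD('l) ^ card (prime_factors m)"
proof -
  have "real (CARD('l) ^ card (prime_factors m)) = real (card {e :: 'l \<Rightarrow> nat. (\<Prod>l\<in>UNIV. e l) = m})"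
    using prod_sum_factorizations[OF assms, of "\<lambda>(_::'l) _. 1"] by simp
  then show ?thesis by linarith
qed

text \<open>The label \<open>(i, l)\<close> names the part of \<open>D i\<close> formed by the
  primes at which the character \<open>l\<close> was selected. Its first component is its
  row.\<close>

type_synonym label = "idx \<times> idx"

definition rows :: "(label \<Rightarrow> nat) \<Rightarrow> idx \<Rightarrow> nat" where
  "rows E i = (\<Prod>l\<in>UNIV. E (i, l))"

text \<open>The Jacobi symbol of \<open>E v\<close> over \<open>E u\<close> occurs in the expansion.
  Only the row of \<open>v\<close> matters, because the characters at primes of \<open>E u\<close>
  contain either all of \<open>D (fst v)\<close> or nothing of it.\<close>

definition depends :: "label \<Rightarrow> label \<Rightarrow> bool" where
  "depends u v \<longleftrightarrow> dep (fst u) (snd u) (fst v)"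

definition valid_tuple :: "(idx \<Rightarrow> nat) \<Rightarrow> bool" where
  "valid_tuple D \<longleftrightarrow> odd (\<Prod>i\<in>UNIV. D i) \<and> squarefree (\<Prod>i\<in>UNIV. D i)"

text \<open>Averages the four signs at every prime. For valid tuples and good coefficients each
  average is 0 or 1, and the weight is the indicator of \<open>descent_cond\<close>.\<close>

definition descent_weight :: "(idx \<Rightarrow> idx \<Rightarrow> int) \<Rightarrow> (idx \<Rightarrow> nat) \<Rightarrow> real" where
  "descent_weight \<kappa> D = (\<Prod>i\<in>UNIV. \<Prod>p\<in>prime_factors (D i).
     \<Sum>l\<in>UNIV. real_of_int (Legendre (\<kappa> i l * dprod i l D) (int p)) / 4)"

definition char_term :: "(idx \<Rightarrow> idx \<Rightarrow> int) \<Rightarrow> (label \<Rightarrow> nat) \<Rightarrow> real" where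
  "char_term \<kappa> E = (\<Prod>u\<in>UNIV. ((1/4) ^ card (prime_factors (E u)) * jac (\<kappa> (fst u) (snd u)) (E u))
      * (\<Prod>v\<in>UNIV. if depends u v then jac (int (E v)) (E u) else 1))"

text \<open>The two requirements on the constants that make the four signs at a prime contain a 1
  and multiply to 1.\<close>

definition good_coeff :: "(idx \<Rightarrow> idx \<Rightarrow> int) \<Rightarrow> bool" where
  "good_coeff \<kappa> \<longleftrightarrow> (\<forall>i. \<kappa> i i = 1) \<and>
     (\<forall>i p. prime p \<longrightarrow> 2 < p \<longrightarrow> (\<Prod>l\<in>UNIV. Legendre (\<kappa> i l) (int p)) = 1)"

lemma sum_UNIV_idx: "(\<Sum>k\<in>UNIV. f k) = f i1 + f i2 + f i3 + (f i4 :: 'a::comm_monoid_add)"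
  unfolding UNIV_idx by (simp add: add.assoc)

lemma idx_cases: obtains "i = i1" | "i = i2" | "i = i3" | "i = i4"
  by (metis (full_types) prod.exhaust)

lemma valid_tupleD:
  assumes "valid_tuple D"
  shows "odd (D i)" "squarefree (D i)" "i \<noteq> k \<Longrightarrow> coprime (D i) (D k)"
proof -
  have v: "odd (\<Prod>i\<in>UNIV. D i)" "squarefree (\<Prod>i\<in>UNIV. D i)" using assms by (simp_all add: valid_tuple_def)
  show "odd (D i)" using v(1) even_prod_iff[of UNIV D, OF finite] by blast
  show "squarefree (D i)" "i \<noteq> k \<Longrightarrow> coprime (D i) (D k)" using squarefree_prodD[OF v(2)] by blast+
qed

text \<open>The number of signs -1 is even because the product is 1, and it is not four, hence it is
  zero or two.\<close>

lemma sum_signs_nonneg: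
  fixes a b c d :: int
  assumes "a = -1 \<or> a = 0 \<or> a = 1" "b = -1 \<or> b = 0 \<or> b = 1" "c = -1 \<or> c = 0 \<or> c = 1"
    "d = -1 \<or> d = 0 \<or> d = 1" "a * b * c * d = 1" "a = 1 \<or> b = 1 \<or> c = 1 \<or> d = 1"
  shows "0 \<le> a + b + c + d"
proof -
  have "a = 1 \<or> a = -1" "b = 1 \<or> b = -1" "c = 1 \<or> c = -1" "d = 1 \<or> d = -1"
    using assms(1-5) by auto
  then show ?thesis using assms(5,6) by (elim disjE) simp_all
qed

text \<open>The four signs at a prime have product 1 and one of them is 1, so their sum is
  4 or 0; it is 4 exactly when the descent conditions hold at that prime.\<close>

lemma descent_weight_factor_nonneg:
  assumes v: "valid_tuple D" and k: "good_coeff \<kappa>" and p: "p \<in> prime_factors (D i)"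
  shows "0 \<le> (\<Sum>l\<in>UNIV. real_of_int (Legendre (\<kappa> i l * dprod i l D) (int p)) / 4)"
proof -
  have pp: "prime p" "2 < p" using odd_prime_factor[OF valid_tupleD(1)[OF v] p] by auto
  let ?L = "\<lambda>a. Legendre a (int p)"
  note LM = Legendre_mult[OF pp]
  have sq: "?L (int (D k)) * ?L (int (D k)) = 1" if "k \<noteq> i" for k
  proof -
    have "coprime (D i) (D k)" using that valid_tupleD(3)[OF v] by metis
    then have "\<not> p dvd D k" using p pp
      by (metis coprime_common_divisor in_prime_factors_iff not_prime_unit)
    then show ?thesis using Legendre_cases[of "int (D k)" p] by (auto simp: Legendre_eq_0_iff)
  qed
  have L1: "?L 1 = 1" using pp by (simp add: Legendre_1)
  have "(\<Prod>l\<in>UNIV. ?L (\<kappa> i l * dprod i l D)) = (\<Prod>l\<in>UNIV. ?L (\<kappa> i l)) * (\<Prod>l\<in>UNIV. ?L (dprod i l D))"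
    by (simp add: LM prod.distrib)
  also have "(\<Prod>l\<in>UNIV. ?L (\<kappa> i l)) = 1" using k pp unfolding good_coeff_def by blast
  also have "(\<Prod>l\<in>UNIV. ?L (dprod i l D)) = (\<Prod>k\<in>UNIV. if k = i then 1 else ?L (int (D k)) * ?L (int (D k)))"
    by (cases i rule: idx_cases) (simp_all add: prod_UNIV_idx dprod_def dep_def LM L1 mult_ac)
  also have "\<dots> = 1" by (intro prod.neutral ballI) (simp add: sq)
  finally have prod: "(\<Prod>l\<in>UNIV. ?L (\<kappa> i l * dprod i l D)) = 1" by simp
  have "?L (\<kappa> i i * dprod i i D) = 1"
  proof -
    have "\<kappa> i i = 1" using k unfolding good_coeff_def by blast
    then show ?thesis using L1 by (simp add: dprod_def dep_def)
  qed
  then have one: "?L (\<kappa> i i1 * dprod i i1 D) = 1 \<or> ?L (\<kappa> i i2 * dprod i i2 D) = 1 \<or>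
      ?L (\<kappa> i i3 * dprod i i3 D) = 1 \<or> ?L (\<kappa> i i4 * dprod i i4 D) = 1"
    by (cases i rule: idx_cases) simp_all
  have "0 \<le> (\<Sum>l\<in>UNIV. ?L (\<kappa> i l * dprod i l D))"
    unfolding sum_UNIV_idx
    by (rule sum_signs_nonneg[OF Legendre_cases Legendre_cases Legendre_cases Legendre_cases _ one])
      (use prod in \<open>simp only: prod_UNIV_idx\<close>)
  then show ?thesis by (simp flip: sum_divide_distrib of_int_sum)
qed

lemma descent_weight_nonneg: "valid_tuple D \<Longrightarrow> good_coeff \<kappa> \<Longrightarrow> 0 \<le> descent_weight \<kappa> D"
  unfolding descent_weight_def by (intro prod_nonneg descent_weight_factor_nonneg ballI) auto

lemma descent_weight_eq_1:
  assumes "descent_cond \<kappa> D"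
  shows "descent_weight \<kappa> D = 1"
proof -
  have "(\<Sum>l\<in>UNIV. real_of_int (Legendre (\<kappa> i l * dprod i l D) (int p)) / 4) = 1"
    if "p \<in> prime_factors (D i)" for i p
  proof -
    have "Legendre (\<kappa> i l * dprod i l D) (int p) = 1" for l
    proof -
      have "prime p" "p dvd D i" using that by auto
      then show ?thesis using assms unfolding descent_cond_def by blast
    qed
    then show ?thesis by (simp add: sum_UNIV_idx)
  qed
  then show ?thesis unfolding descent_weight_def by (intro prod.neutral ballI) auto
qed

lemma jac_1: "odd n \<Longrightarrow> jac 1 n = 1"
  using jac_prod[of n "\<lambda>_. 1" "{}"] by simp

lemma prod_UNIV_pairs: "(\<Prod>u\<in>UNIV. f u) = (\<Prod>i\<in>UNIV. \<Prod>l\<in>UNIV. f (i, l))"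
  by (simp add: prod.cartesian_product)

text \<open>By multiplicativity in the upper argument every \<open>D k\<close> splits into its parts
  \<open>E (k, m)\<close>, which leaves symbols between two variables and the symbols of the
  constants.\<close>

lemma char_term_eq:
  assumes v: "valid_tuple D" and E: "\<And>i. rows E i = D i"
  shows "char_term \<kappa> E = (\<Prod>i\<in>UNIV. \<Prod>l\<in>UNIV. \<Prod>p\<in>prime_factors (E (i, l)).
      real_of_int (Legendre (\<kappa> i l * dprod i l D) (int p)) / 4)"
proof -
  have odd: "odd (E (i, l))" for i l
    using valid_tupleD(1)[OF v, of i] unfolding E[symmetric] rows_def
    using even_prod_iff[of UNIV "\<lambda>l. E (i, l)", OF finite] by blast
  have "(\<Prod>p\<in>prime_factors (E (i, l)). real_of_int (Legendre (\<kappa> i l * dprod i l D) (int p)) / 4)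
    = ((1/4) ^ card (prime_factors (E (i, l))) * jac (\<kappa> i l) (E (i, l)))
      * (\<Prod>v\<in>UNIV. if depends (i, l) v then jac (int (E v)) (E (i, l)) else 1)" for i l
  proof -
    let ?n = "E (i, l)"
    have "(\<Prod>p\<in>prime_factors ?n. real_of_int (Legendre (\<kappa> i l * dprod i l D) (int p)) / 4)
      = (1/4) ^ card (prime_factors ?n) * jac (\<kappa> i l * dprod i l D) ?n"
      unfolding jac_def by (simp add: prod_dividef power_one_over)
    also have "jac (\<kappa> i l * dprod i l D) ?n = jac (\<kappa> i l) ?n * jac (dprod i l D) ?n"
      by (rule jac_mult[OF odd])
    also have "jac (dprod i l D) ?n = (\<Prod>k\<in>UNIV. \<Prod>m\<in>UNIV. if dep i l k then jac (int (E (k, m))) ?n else 1)"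
      unfolding dprod_def jac_prod[OF odd]
    proof (intro prod.cong refl)
      fix k
      have "jac (int (D k)) ?n = (\<Prod>m\<in>UNIV. jac (int (E (k, m))) ?n)"
        unfolding E[symmetric] rows_def of_nat_prod by (rule jac_prod[OF odd])
      then show "jac (if dep i l k then int (D k) else 1) ?n = (\<Prod>m\<in>UNIV. if dep i l k then jac (int (E (k, m))) ?n else 1)"
        by (simp add: jac_1[OF odd])
    qed
    also have "\<dots> = (\<Prod>v\<in>UNIV. if depends (i, l) v then jac (int (E v)) ?n else 1)"
      unfolding prod_UNIV_pairs by (simp add: depends_def)
    finally show ?thesis by simp
  qed
  then show ?thesis unfolding char_term_def prod_UNIV_pairs[of "\<lambda>u. _ (E u) * _ u * _ u"] 
    by (subst prod_UNIV_pairs) simp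
qed

lemma descent_weight_expand:
  assumes v: "valid_tuple D"
  shows "descent_weight \<kappa> D = (\<Sum>E | \<forall>i. rows E i = D i. char_term \<kappa> E)"
proof -
  define f where "f i e = (\<Prod>l\<in>UNIV. \<Prod>p\<in>prime_factors (e l).
      real_of_int (Legendre (\<kappa> i l * dprod i l D) (int p)) / 4)" for i and e :: "idx \<Rightarrow> nat"
  define A where "A i = {e :: idx \<Rightarrow> nat. (\<Prod>l\<in>UNIV. e l) = D i}" for i
  have fin: "finite (A i)" for i
  proof -
    have "card (A i) = CARD(idx) ^ card (prime_factors (D i))"
      unfolding A_def by (rule card_factorizations[OF valid_tupleD(2)[OF v]])
    then have "card (A i) > 0" by simp
    then show ?thesis by (rule card_ge_0_finite)
  qed
  have "descent_weight \<kappa> D = (\<Prod>i\<in>UNIV. \<Sum>e\<in>A i. f i e)"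
    unfolding descent_weight_def f_def A_def
    by (intro prod.cong refl prod_sum_factorizations valid_tupleD(2)[OF v])
  also have "\<dots> = (\<Sum>e\<in>PiE UNIV A. \<Prod>i\<in>UNIV. f i (e i))"
    by (rule prod_sum_PiE) (use fin in auto)
  also have "\<dots> = (\<Sum>E | \<forall>i. rows E i = D i. char_term \<kappa> E)"
  proof (rule sum.reindex_bij_witness[where i="\<lambda>E i l. E (i, l)" and j="\<lambda>e u. e (fst u) (snd u)"])
    fix e assume e: "e \<in> PiE UNIV A"
    then have r: "rows (\<lambda>u. e (fst u) (snd u)) i = D i" for i 
      by (simp add: rows_def A_def PiE_UNIV_domain Pi_def del: split_paired_All)
    then show "(\<lambda>u. e (fst u) (snd u)) \<in> {E. \<forall>i. rows E i = D i}" by simp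
    show "char_term \<kappa> (\<lambda>u. e (fst u) (snd u)) = (\<Prod>i\<in>UNIV. f i (e i))"
      unfolding char_term_eq[OF v r] f_def by simp
  next
    fix E assume "E \<in> {E. \<forall>i. rows E i = D i}"
    then show "(\<lambda>i l. E (i, l)) \<in> PiE UNIV A" by (auto simp: A_def rows_def)
  qed auto
  finally show ?thesis .
qed

section \<open>Linked variables\<close>

declare split_paired_All [simp del] split_paired_Ex [simp del]

text \<open>Exactly one of the symbols of \<open>E u\<close> over \<open>E v\<close> and of
  \<open>E v\<close> over \<open>E u\<close> occurs. If both occurred, reciprocity would turn their
  product into a mere sign and no cancellation could be expected.\<close>

definition linked :: "label \<Rightarrow> label \<Rightarrow> bool" where
  "linked u v \<longleftrightarrow> fst u \<noteq> fst v \<and> depends u v \<noteq> depends v u"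

lemma prod_of_bool: "finite A \<Longrightarrow> (\<Prod>x\<in>A. of_bool (P x) :: real) = of_bool (\<forall>x\<in>A. P x)"
  by (induction A rule: finite_induct) auto

text \<open>With all other variables frozen at \<open>E\<close>, the factor is a product of
  functions of the two chosen variables, bounded by 1 as the bilinear estimate requires of its
  coefficients.\<close>

definition separable :: "label \<Rightarrow> label \<Rightarrow> (label \<Rightarrow> nat) \<Rightarrow> ((label \<Rightarrow> nat) \<Rightarrow> real) \<Rightarrow> bool" where
  "separable u v E f \<longleftrightarrow> (\<exists>\<alpha> \<beta>. (\<forall>x. \<bar>\<alpha> x\<bar> \<le> 1) \<and> (\<forall>y. \<bar>\<beta> y\<bar> \<le> 1) \<and>
     (\<forall>x y. f (E(u := x, v := y)) = \<alpha> x * \<beta> y))"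

lemma separable_mult:
  assumes "separable u v E f" "separable u v E g" shows "separable u v E (\<lambda>E. f E * g E)"
proof -
  obtain \<alpha> \<beta> where 1: "\<And>x. \<bar>\<alpha> x\<bar> \<le> 1" "\<And>y. \<bar>\<beta> y\<bar> \<le> 1" "\<And>x y. f (E(u := x, v := y)) = \<alpha> x * \<beta> y"
    using assms(1) unfolding separable_def by blast
  obtain \<gamma> \<delta> where 2: "\<And>x. \<bar>\<gamma> x\<bar> \<le> 1" "\<And>y. \<bar>\<delta> y\<bar> \<le> 1" "\<And>x y. g (E(u := x, v := y)) = \<gamma> x * \<delta> y"
    using assms(2) unfolding separable_def by blast
  show ?thesis unfolding separable_def
    by (rule exI[of _ "\<lambda>x. \<alpha> x * \<gamma> x"], rule exI[of _ "\<lambda>y. \<beta> y * \<delta> y"])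
      (use 1 2 in \<open>auto simp: abs_mult mult_ac intro: mult_le_one\<close>)
qed

lemma separable_1: "separable u v E (\<lambda>_. 1)"
  unfolding separable_def by (rule exI[of _ "\<lambda>_. 1"], rule exI[of _ "\<lambda>_. 1"]) simp

lemma separable_prod: "(\<And>j. j \<in> J \<Longrightarrow> separable u v E (f j)) \<Longrightarrow> separable u v E (\<lambda>E. \<Prod>j\<in>J. f j E)"
  by (induction J rule: infinite_finite_induct) (auto simp: separable_1 intro!: separable_mult)

lemma separable_indep_left:
  assumes "u \<noteq> v" "\<And>E x. f (E(u := x)) = f E" "\<And>E. \<bar>f E\<bar> \<le> 1"
  shows "separable u v E f"
proof -
  have "f (E(u := x, v := y)) = f (E(v := y))" for x y
    using assms(2)[of "E(v := y)" x] fun_upd_twist[OF assms(1), of E x y] by simp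
  then show ?thesis
    unfolding separable_def
    by (intro exI[of _ "\<lambda>_. 1"] exI[of _ "\<lambda>y. f (E(v := y))"]) (simp add: assms(3))
qed

lemma separable_indep_right:
  assumes "\<And>E y. f (E(v := y)) = f E" "\<And>E. \<bar>f E\<bar> \<le> 1"
  shows "separable u v E f"
  unfolding separable_def
  by (rule exI[of _ "\<lambda>x. f (E(u := x))"], rule exI[of _ "\<lambda>_. 1"]) (use assms in simp)

lemma rows_upd: "rows (E(w := x)) i = (if fst w = i then x * (\<Prod>l\<in>UNIV - {snd w}. E (i, l)) else rows E i)"
proof (cases "fst w = i")
  case True
  have "rows (E(w := x)) i = (E(w := x)) (i, snd w) * (\<Prod>l\<in>UNIV - {snd w}. (E(w := x)) (i, l))"
    unfolding rows_def by (rule prod.remove) auto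
  also have "(\<Prod>l\<in>UNIV - {snd w}. (E(w := x)) (i, l)) = (\<Prod>l\<in>UNIV - {snd w}. E (i, l))"
    using True by (cases w) (auto intro!: prod.cong)
  finally have r: "rows (E(w := x)) i = (E(w := x)) (i, snd w) * (\<Prod>l\<in>UNIV - {snd w}. E (i, l))" .
  have "(i, snd w) = w" using True by (cases w) auto
  then have "(E(w := x)) (i, snd w) = x" by simp
  then show ?thesis unfolding r using True by (simp del: fun_upd_apply)
next
  case False
  then show ?thesis unfolding rows_def by (cases w) (auto intro!: prod.cong)
qed

lemma rows_upd_1:
  assumes "E w = 1"
  shows "rows (E(w := x)) (fst w) = x * rows E (fst w)"
proof -
  have "rows E (fst w) = E (fst w, snd w) * (\<Prod>l\<in>UNIV - {snd w}. E (fst w, l))"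
    unfolding rows_def by (rule prod.remove) auto
  then show ?thesis using assms by (simp add: rows_upd)
qed

text \<open>In a block, \<open>a\<close> fixes the dyadic ranges of the rows and \<open>L\<close> is the set of labels whose variables
  exceed \<open>V\<close>.\<close>

locale block =
  fixes \<kappa> :: "idx \<Rightarrow> idx \<Rightarrow> int" and a :: "idx \<Rightarrow> nat" and V :: nat and L :: "label set"
begin

definition single :: "label \<Rightarrow> nat \<Rightarrow> real" where
  "single w n = of_bool (odd n \<and> squarefree n \<and> (V < n \<longleftrightarrow> w \<in> L)) *
     ((1/4) ^ card (prime_factors n) * jac (\<kappa> (fst w) (snd w)) n)"

definition inbox :: "idx \<Rightarrow> nat \<Rightarrow> bool" where
  "inbox i r \<longleftrightarrow> 2 ^ a i \<le> r \<and> r < 2 ^ (a i + 1)"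

definition pairf :: "label \<times> label \<Rightarrow> (label \<Rightarrow> nat) \<Rightarrow> real" where
  "pairf x E = (if fst x \<noteq> snd x then of_bool (coprime (E (fst x)) (E (snd x))) else 1) *
     (if depends (fst x) (snd x) then jac (int (E (snd x))) (E (fst x)) else 1)"

definition T :: "(label \<Rightarrow> nat) \<Rightarrow> real" where
  "T E = (\<Prod>w\<in>UNIV. single w (E w)) * (\<Prod>i\<in>UNIV. of_bool (inbox i (rows E i))) * (\<Prod>x\<in>UNIV. pairf x E)"

text \<open>Squarefreeness of the whole product means that each variable is squarefree and that they
  are pairwise coprime. The indicator of the block thus becomes a product of factors that see one
  variable, one row or one pair, which is the form needed for separating two variables.\<close>

lemma T_eq: "T E = of_bool (valid_tuple (rows E) \<and> (\<forall>i. inbox i (rows E i)) \<and> {u. V < E u} = L) * char_term \<kappa> E"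
proof -
  let ?s = "\<forall>w. odd (E w) \<and> squarefree (E w)" and ?c = "\<forall>w w'. w \<noteq> w' \<longrightarrow> coprime (E w) (E w')"
  have rE: "(\<Prod>i\<in>UNIV. rows E i) = (\<Prod>w\<in>UNIV. E w)" unfolding rows_def prod_UNIV_pairs ..
  have val: "valid_tuple (rows E) \<longleftrightarrow> ?s \<and> ?c"
  proof
    assume "valid_tuple (rows E)"
    then have v: "odd (\<Prod>w\<in>UNIV. E w)" "squarefree (\<Prod>w\<in>UNIV. E w)" unfolding valid_tuple_def rE by auto
    have "odd (E w)" for w using v(1) even_prod_iff[of UNIV E, OF finite] by blast
    then show "?s \<and> ?c" using squarefree_prodD[OF v(2)] by blast
  next
    assume sc: "?s \<and> ?c"
    have "odd (\<Prod>w\<in>UNIV. E w)" using sc even_prod_iff[of UNIV E, OF finite] by blast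
    moreover have "squarefree (\<Prod>w\<in>UNIV. E w)"
      by (rule squarefree_prod_coprime) (use sc in blast)+
    ultimately show "valid_tuple (rows E)" unfolding valid_tuple_def rE by simp
  qed
  have "(\<Prod>w\<in>UNIV. single w (E w)) = of_bool (\<forall>w\<in>UNIV. odd (E w) \<and> squarefree (E w) \<and> (V < E w \<longleftrightarrow> w \<in> L)) *
      (\<Prod>w\<in>UNIV. (1/4) ^ card (prime_factors (E w)) * jac (\<kappa> (fst w) (snd w)) (E w))"
    unfolding single_def prod.distrib prod_of_bool[OF finite] by (rule refl)
  moreover have "(\<Prod>x\<in>UNIV. pairf x E) = of_bool (\<forall>x\<in>UNIV. fst x \<noteq> snd x \<longrightarrow> coprime (E (fst x)) (E (snd x))) *
     (\<Prod>u\<in>UNIV. \<Prod>v\<in>UNIV. if depends u v then jac (int (E v)) (E u) else 1)"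
  proof -
    have "(if A then of_bool B else (1::real)) = of_bool (A \<longrightarrow> B)" for A B by simp
    then have "(\<Prod>x\<in>UNIV. pairf x E) = (\<Prod>x\<in>UNIV. of_bool (fst x \<noteq> snd x \<longrightarrow> coprime (E (fst x)) (E (snd x)))) *
      (\<Prod>x\<in>UNIV. if depends (fst x) (snd x) then jac (int (E (snd x))) (E (fst x)) else 1)"
      unfolding pairf_def prod.distrib by simp
    also have "(\<Prod>x\<in>UNIV. if depends (fst x) (snd x) then jac (int (E (snd x))) (E (fst x)) else 1)
       = (\<Prod>u\<in>UNIV. \<Prod>v\<in>UNIV. if depends u v then jac (int (E v)) (E u) else 1)"
      by (simp add: prod.cartesian_product case_prod_unfold)
    finally show ?thesis by (simp only: prod_of_bool[OF finite])
  qed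
  moreover have "(\<Prod>i\<in>UNIV. of_bool (inbox i (rows E i)) :: real) = of_bool (\<forall>i\<in>UNIV. inbox i (rows E i))"
    by (rule prod_of_bool) simp
  moreover have "char_term \<kappa> E = (\<Prod>w\<in>UNIV. (1/4) ^ card (prime_factors (E w)) * jac (\<kappa> (fst w) (snd w)) (E w)) *
     (\<Prod>u\<in>UNIV. \<Prod>v\<in>UNIV. if depends u v then jac (int (E v)) (E u) else 1)"
    unfolding char_term_def by (rule prod.distrib)
  moreover have "(valid_tuple (rows E) \<and> (\<forall>i. inbox i (rows E i)) \<and> {u. V < E u} = L) \<longleftrightarrow>
     (\<forall>w\<in>UNIV. odd (E w) \<and> squarefree (E w) \<and> (V < E w \<longleftrightarrow> w \<in> L)) \<and> (\<forall>i\<in>UNIV. inbox i (rows E i)) \<and>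
     (\<forall>x\<in>UNIV. fst x \<noteq> snd x \<longrightarrow> coprime (E (fst x)) (E (snd x)))"
    (is "?A \<longleftrightarrow> ?B")
  proof
    assume ?A then show ?B unfolding val by blast
  next
    assume B: ?B
    then have "?c" by (metis UNIV_I fst_conv snd_conv)
    then show ?A unfolding val using B by blast
  qed
  ultimately show ?thesis unfolding T_def by simp
qed

lemma abs_single_le: "\<bar>single w n\<bar> \<le> 1"
  unfolding single_def abs_mult
  by (intro mult_le_one) (auto simp: abs_jac_le power_le_one)

lemma abs_pairf_le: "\<bar>pairf x E\<bar> \<le> 1"
  unfolding pairf_def abs_mult by (intro mult_le_one) (auto simp: abs_jac_le)

text \<open>The row conditions do not see both variables since the rows differ; only the pair
  factors of \<open>(u, v)\<close> and \<open>(v, u)\<close> do.\<close>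

lemma T_separates:
  assumes uv: "fst u \<noteq> fst v" "depends u v" "\<not> depends v u"
  shows "\<exists>\<alpha> \<beta>. (\<forall>x. \<bar>\<alpha> x\<bar> \<le> 1) \<and> (\<forall>y. \<bar>\<beta> y\<bar> \<le> 1) \<and>
     (\<forall>x y. T (E(u := x, v := y)) = \<alpha> x * \<beta> y * jac (int y) x)"
proof -
  have ne: "u \<noteq> v" using uv by auto
  define H where "H E = (\<Prod>w\<in>UNIV. single w (E w)) * (\<Prod>i\<in>UNIV. of_bool (inbox i (rows E i)))
      * (\<Prod>x\<in>UNIV - {(u, v), (v, u)}. pairf x E)" for E
  have TH: "T E = H E * jac (int (E v)) (E u)" for E
  proof -
    have "(\<Prod>x\<in>UNIV. pairf x E) = (\<Prod>x\<in>UNIV - {(u, v), (v, u)}. pairf x E) * (\<Prod>x\<in>{(u, v), (v, u)}. pairf x E)"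
      by (rule prod.subset_diff) auto
    also have "(\<Prod>x\<in>{(u, v), (v, u)}. pairf x E) = of_bool (coprime (E u) (E v)) * jac (int (E v)) (E u)"
      using ne uv by (simp add: pairf_def coprime_commute)
    finally have P: "(\<Prod>x\<in>UNIV. pairf x E) = (\<Prod>x\<in>UNIV - {(u, v), (v, u)}. pairf x E) *
       (of_bool (coprime (E u) (E v)) * jac (int (E v)) (E u))" .
    \<comment> \<open>The coprimality indicator would couple the two variables, but the symbol
      vanishes on pairs that are not coprime and absorbs it. The value 0 at \<open>u\<close> is
      treated apart; there \<open>single\<close> vanishes already.\<close>
    show ?thesis
    proof (cases "E u = 0")
      case True
      then have "single u (E u) = 0" by (simp add: single_def)
      then have "(\<Prod>w\<in>UNIV. single w (E w)) = 0" by (intro prod_zero bexI[of _ u]) auto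
      then show ?thesis unfolding T_def H_def by simp
    next
      case False
      then have "of_bool (coprime (E u) (E v)) * jac (int (E v)) (E u) = jac (int (E v)) (E u)"
        using jac_eq_0_iff[of "E u" "int (E v)"] by (auto simp: coprime_commute)
      then show ?thesis unfolding T_def H_def P by simp
    qed
  qed
  have "separable u v E H"
    unfolding H_def
  proof (intro separable_mult separable_prod)
    fix w show "separable u v E (\<lambda>E. single w (E w))"
    proof (cases "w = u")
      case True
      then show ?thesis using ne by (intro separable_indep_right) (auto simp: abs_single_le)
    next
      case False
      then show ?thesis using ne by (intro separable_indep_left) (auto simp: abs_single_le)
    qed
  next
    fix i show "separable u v E (\<lambda>E. of_bool (inbox i (rows E i)))"
    proof (cases "i = fst u")
      case True
      then show ?thesis using uv by (intro separable_indep_right) (auto simp: rows_upd)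
    next
      case False
      then show ?thesis using ne by (intro separable_indep_left) (auto simp: rows_upd)
    qed
  next
    fix x assume x: "x \<in> UNIV - {(u, v), (v, u)}"
    show "separable u v E (pairf x)"
    proof (cases "fst x = u \<or> snd x = u")
      case True
      then have "fst x \<noteq> v" "snd x \<noteq> v" using x ne by (cases x; auto)+
      then show ?thesis by (intro separable_indep_right abs_pairf_le) (auto simp: pairf_def)
    next
      case False
      then show ?thesis using ne by (intro separable_indep_left abs_pairf_le) (auto simp: pairf_def)
    qed
  qed
  then obtain \<alpha> \<beta> where "\<And>x. \<bar>\<alpha> x\<bar> \<le> 1" "\<And>y. \<bar>\<beta> y\<bar> \<le> 1" "\<And>x y. H (E(u := x, v := y)) = \<alpha> x * \<beta> y"
    unfolding separable_def by blast
  then show ?thesis using ne by (intro exI[of _ \<alpha>] exI[of _ \<beta>]) (simp add: TH)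
qed

lemma T_nonzeroD:
  assumes "T E \<noteq> 0"
  shows "odd (E w)" "squarefree (E w)" "V < E w \<longleftrightarrow> w \<in> L" "rows E i < 2 ^ (a i + 1)"
proof -
  have "(\<Prod>w\<in>UNIV. single w (E w)) \<noteq> 0" "(\<Prod>i\<in>UNIV. of_bool (inbox i (rows E i)) :: real) \<noteq> 0"
    using assms unfolding T_def by auto
  then have "single w (E w) \<noteq> 0" "of_bool (inbox i (rows E i)) \<noteq> (0::real)"
    by (metis UNIV_I finite prod_zero_iff)+
  then show "odd (E w)" "squarefree (E w)" "V < E w \<longleftrightarrow> w \<in> L" "rows E i < 2 ^ (a i + 1)"
    by (auto simp: single_def inbox_def split: if_splits)
qed

text \<open>The value 1 at \<open>u\<close> and \<open>v\<close> makes \<open>rows E\<close> the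
  remaining part of the two rows, so the dyadic conditions confine the variables to \<open>M\<close>
  and \<open>N\<close>. Membership in \<open>L\<close> keeps them above \<open>V\<close>: either a
  range is empty, or both \<open>M\<close> and \<open>N\<close> exceed \<open>V\<close> and the
  bilinear saving is at least that of \<open>V powr (- 1/8)\<close>.\<close>

lemma block_pair_bound:
  assumes uv: "fst u \<noteq> fst v" "depends u v" "\<not> depends v u" and uL: "u \<in> L" "v \<in> L" and V: "V \<ge> 1"
    and K: "\<And>i. 2 ^ (a i + 1) \<le> K"
    and E1: "E u = 1" "E v = 1" and Epos: "\<And>w. E w \<ge> 1"
  shows "\<bar>\<Sum>x\<in>{1..K}. \<Sum>y\<in>{1..K}. T (E(u := x, v := y))\<bar>
    \<le> 4 * harm (K ^ 4) ^ 8 * real V powr (- 1/8) *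
       (2 ^ (a (fst u) + 1) / real (rows E (fst u))) * (2 ^ (a (fst v) + 1) / real (rows E (fst v)))"
proof -
  have ne: "u \<noteq> v" using uv by auto
  define ru where "ru = rows E (fst u)"
  define rv where "rv = rows E (fst v)"
  define M where "M = 2 ^ (a (fst u) + 1) div ru"
  define N where "N = 2 ^ (a (fst v) + 1) div rv"
  have r0: "rows E i \<ge> 1" for i
    unfolding rows_def using Epos by (simp add: Suc_le_eq prod_pos)
  then have r: "ru \<ge> 1" "rv \<ge> 1" unfolding ru_def rv_def by auto
  have ru: "rows (E(u := x, v := y)) (fst u) = x * ru" for x y
    using rows_upd_1[where w=u and E=E and x=x, OF E1(1)] uv by (simp add: rows_upd[of _ v] ru_def)
  have rv: "rows (E(u := x, v := y)) (fst v) = y * rv" for x y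
  proof -
    have "(E(u := x)) v = 1" using E1 ne by simp
    from rows_upd_1[where w=v and E="E(u := x)" and x=y, OF this] show ?thesis using uv by (simp add: rows_upd[of _ u] rv_def)
  qed
  have T0: "x \<in> odd_sqfree M \<and> y \<in> odd_sqfree N \<and> V < x \<and> V < y" if "T (E(u := x, v := y)) \<noteq> 0" for x y
  proof -
    note nz = T_nonzeroD[OF that]
    have "x * ru < 2 ^ (a (fst u) + 1)" "y * rv < 2 ^ (a (fst v) + 1)"
      using nz(4)[of "fst u"] nz(4)[of "fst v"] unfolding ru rv by auto
    then have "x \<le> M" "y \<le> N" unfolding M_def N_def using r by (simp_all add: less_eq_div_iff_mult_less_eq)
    moreover have "odd x" "odd y" "squarefree x" "squarefree y" "V < x" "V < y"
      using nz(1,2,3)[of u] nz(1,2,3)[of v] ne uL by auto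
    ultimately show ?thesis unfolding odd_sqfree_def by auto
  qed
  have MN: "M \<le> K" "N \<le> K" unfolding M_def N_def using K by (meson div_le_dividend le_trans)+
  have sub: "odd_sqfree M \<subseteq> {1..K}" "odd_sqfree N \<subseteq> {1..K}" using MN unfolding odd_sqfree_def by auto
  have S: "(\<Sum>x\<in>{1..K}. \<Sum>y\<in>{1..K}. T (E(u := x, v := y))) = (\<Sum>x\<in>odd_sqfree M. \<Sum>y\<in>odd_sqfree N. T (E(u := x, v := y)))"
  proof -
    have "(\<Sum>x\<in>{1..K}. \<Sum>y\<in>{1..K}. T (E(u := x, v := y))) = (\<Sum>x\<in>odd_sqfree M. \<Sum>y\<in>{1..K}. T (E(u := x, v := y)))"
      using T0 sub by (intro sum.mono_neutral_right) (auto intro!: sum.neutral)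
    also have "\<dots> = (\<Sum>x\<in>odd_sqfree M. \<Sum>y\<in>odd_sqfree N. T (E(u := x, v := y)))"
      using T0 sub by (intro sum.cong refl sum.mono_neutral_right) auto
    finally show ?thesis .
  qed
  have h0: "harm (K ^ 4) \<ge> (0::real)" by (rule harm_nonneg)
  let ?R = "4 * harm (K ^ 4) ^ 8 * real V powr (- 1/8) * (2 ^ (a (fst u) + 1) / real ru) * (2 ^ (a (fst v) + 1) / real rv)"
  show ?thesis
  proof (cases "V < M \<and> V < N")
    case False
    have "(\<Sum>x\<in>odd_sqfree M. \<Sum>y\<in>odd_sqfree N. T (E(u := x, v := y))) = 0"
    proof (intro sum.neutral ballI)
      fix x y assume "x \<in> odd_sqfree M" "y \<in> odd_sqfree N"
      then have "x \<le> M" "y \<le> N" by (auto simp: odd_sqfree_def)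
      then show "T (E(u := x, v := y)) = 0" using T0[of x y] False by fastforce
    qed
    moreover have "0 \<le> ?R" using h0 by simp
    ultimately show ?thesis unfolding S ru_def rv_def by simp
  next
    case True
    obtain \<alpha> \<beta> where ab: "\<And>x. \<bar>\<alpha> x\<bar> \<le> 1" "\<And>y. \<bar>\<beta> y\<bar> \<le> 1"
      "\<And>x y. T (E(u := x, v := y)) = \<alpha> x * \<beta> y * jac (int y) x"
      using T_separates[OF uv, of E] by blast
    have "(\<Sum>x\<in>odd_sqfree M. \<Sum>y\<in>odd_sqfree N. T (E(u := x, v := y)))
        = (\<Sum>y\<in>odd_sqfree N. \<Sum>x\<in>odd_sqfree M. \<beta> y * \<alpha> x * jac (int y) x)"
      unfolding ab(3) by (subst sum.swap) (simp add: mult_ac)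
    then have "\<bar>\<Sum>x\<in>{1..K}. \<Sum>y\<in>{1..K}. T (E(u := x, v := y))\<bar>
        = \<bar>\<Sum>y\<in>odd_sqfree N. \<Sum>x\<in>odd_sqfree M. \<beta> y * \<alpha> x * jac (int y) x\<bar>" by (simp only: S)
    also have "\<dots> \<le> 4 * (real N * real M * harm ((max N M) ^ 4) ^ 8 * real (min N M) powr (- 1/8))"
      by (rule bilinear_jacobi_bound) (use ab True in auto)
    also have "\<dots> \<le> 4 * ((2 ^ (a (fst v) + 1) / real rv) * (2 ^ (a (fst u) + 1) / real ru) * harm (K ^ 4) ^ 8 * real V powr (- 1/8))"
    proof (intro mult_left_mono mult_mono)
      show "real N \<le> 2 ^ (a (fst v) + 1) / real rv" "real M \<le> 2 ^ (a (fst u) + 1) / real ru"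
      proof -
        have "real (N * rv) \<le> real (2 ^ (a (fst v) + 1))" "real (M * ru) \<le> real (2 ^ (a (fst u) + 1))"
          unfolding M_def N_def by (intro of_nat_mono, simp)+
        then show "real N \<le> 2 ^ (a (fst v) + 1) / real rv" "real M \<le> 2 ^ (a (fst u) + 1) / real ru"
          using r by (simp_all add: pos_le_divide_eq)
      qed
      have "(max N M) ^ 4 \<le> K ^ 4" using MN by (intro power_mono) auto
      then show "harm ((max N M) ^ 4) ^ 8 \<le> (harm (K ^ 4) ^ 8 :: real)"
        by (rule power_mono[OF harm_mono harm_nonneg])
      show "real (min N M) powr (- 1/8) \<le> real V powr (- 1/8)"
        using True V by (intro powr_mono2') auto
    qed (auto simp: harm_nonneg)
    also have "\<dots> = ?R" by (simp only: mult_ac)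
    finally show ?thesis unfolding ru_def rv_def .
  qed
qed

end

section \<open>Summation over all sixteen variables\<close>

definition label_family :: "nat \<Rightarrow> (label \<Rightarrow> nat) set" where "label_family K = {E. \<forall>w. E w \<in> {1..K}}"

lemma label_family_eq_PiE: "label_family K = PiE UNIV (\<lambda>_. {1..K})"
  unfolding label_family_def by (auto simp: PiE_UNIV_domain)

lemma finite_label_family [simp]: "finite (label_family K)"
  unfolding label_family_eq_PiE by (rule finite_PiE) auto

lemma sum_inverse_label_family: "(\<Sum>E\<in>label_family K. \<Prod>w\<in>UNIV. 1 / real (E w)) = harm K ^ 16"
proof -
  have "(\<Sum>E\<in>label_family K. \<Prod>w\<in>UNIV. 1 / real (E w)) = (\<Prod>w\<in>(UNIV::label set). \<Sum>n\<in>{1..K}. 1 / real n)"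
    unfolding label_family_eq_PiE by (rule prod_sum_PiE[symmetric]) auto
  also have "\<dots> = harm K ^ 16" by (simp add: harm_def inverse_eq_divide)
  finally show ?thesis .
qed

text \<open>The other fourteen variables are parametrised by families with the placeholder value 1
  at \<open>u\<close> and \<open>v\<close>.\<close>

lemma sum_label_family_split:
  assumes "u \<noteq> v" "K \<ge> 1"
  shows "(\<Sum>E\<in>label_family K. f E) = (\<Sum>E\<in>{E\<in>label_family K. E u = 1 \<and> E v = 1}. \<Sum>x\<in>{1..K}. \<Sum>y\<in>{1..K}. f (E(u := x, v := y)))"
proof -
  let ?R = "{E\<in>label_family K. E u = 1 \<and> E v = 1}"
  have "(\<Sum>E\<in>?R. \<Sum>x\<in>{1..K}. \<Sum>y\<in>{1..K}. f (E(u := x, v := y)))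
      = (\<Sum>z\<in>?R \<times> {1..K} \<times> {1..K}. f ((fst z)(u := fst (snd z), v := snd (snd z))))"
    by (simp add: sum.cartesian_product case_prod_unfold)
  also have "\<dots> = (\<Sum>E\<in>label_family K. f E)"
    by (rule sum.reindex_bij_witness[where j="\<lambda>z. (fst z)(u := fst (snd z), v := snd (snd z))"
          and i="\<lambda>E. (E(u := 1, v := 1), E u, E v)"])
      (use assms in \<open>auto simp: label_family_def fun_eq_iff\<close>)
  finally show ?thesis by simp
qed

context block
begin

lemma linked_sum_bound_aux:
  assumes uv: "fst u \<noteq> fst v" "depends u v" "\<not> depends v u" and uL: "u \<in> L" "v \<in> L" and V: "V \<ge> 1"
    and K: "\<And>i. 2 ^ (a i + 1) \<le> K"
  shows "\<bar>\<Sum>E\<in>label_family K. T E\<bar> \<le> 4 * harm (K ^ 4) ^ 24 * real V powr (- 1/8) * (\<Prod>i\<in>UNIV. 2 ^ (a i + 1))"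
proof -
  let ?R = "{E\<in>label_family K. E u = 1 \<and> E v = 1}"
  let ?C = "4 * harm (K ^ 4) ^ 8 * real V powr (- 1/8)"
  let ?q = "\<lambda>E i. 2 ^ (a i + 1) / real (rows E i)"
  have ne: "u \<noteq> v" using uv by auto
  have K1: "K \<ge> 1" using K[of i1] by (metis le_trans one_le_numeral one_le_power)
  have C0: "0 \<le> ?C" by (simp add: harm_nonneg)
  have inner: "\<bar>\<Sum>x\<in>{1..K}. \<Sum>y\<in>{1..K}. T (E(u := x, v := y))\<bar> \<le> ?C * (\<Prod>i\<in>UNIV. ?q E i)"
    if E: "E \<in> ?R" for E
  proof (cases "\<exists>j. j \<noteq> fst u \<and> j \<noteq> fst v \<and> 2 ^ (a j + 1) \<le> rows E j")
    case True
    then obtain j where j: "j \<noteq> fst u" "j \<noteq> fst v" "2 ^ (a j + 1) \<le> rows E j" by blast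
    have "T (E(u := x, v := y)) = 0" for x y
    proof (rule ccontr)
      assume "T (E(u := x, v := y)) \<noteq> 0"
      from T_nonzeroD(4)[OF this, of j] show False using j by (simp add: rows_upd split: if_splits)
    qed
    moreover have "0 \<le> ?C * (\<Prod>i\<in>UNIV. ?q E i)" by (intro mult_nonneg_nonneg C0 prod_nonneg) auto
    ultimately show ?thesis by simp
  next
    \<comment> \<open>Every row other than those of \<open>u\<close> and \<open>v\<close> is within
      its dyadic bound, so its quotient \<open>?q\<close> is at least 1 and may be inserted; the
      bound then treats the four rows alike.\<close>
    case False
    have Ew: "E w \<ge> 1" for w using E by (auto simp: label_family_def)
    have r0: "rows E i \<ge> 1" for i
      unfolding rows_def using Ew by (simp add: Suc_le_eq prod_pos)
    have "(\<Prod>i\<in>UNIV. ?q E i) = (\<Prod>i\<in>UNIV - {fst u, fst v}. ?q E i) * (\<Prod>i\<in>{fst u, fst v}. ?q E i)"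
      by (rule prod.subset_diff) auto
    also have "(\<Prod>i\<in>{fst u, fst v}. ?q E i) = ?q E (fst u) * ?q E (fst v)" using uv by simp
    finally have P: "(\<Prod>i\<in>UNIV. ?q E i) = (\<Prod>i\<in>UNIV - {fst u, fst v}. ?q E i) * (?q E (fst u) * ?q E (fst v))" .
    have "1 \<le> (\<Prod>i\<in>UNIV - {fst u, fst v}. ?q E i)"
    proof (rule prod_ge_1)
      fix j assume "j \<in> UNIV - {fst u, fst v}"
      then have "rows E j < 2 ^ (a j + 1)" using False by (auto simp: not_le)
      then have "real (rows E j) \<le> 2 ^ (a j + 1)" by (metis less_imp_le of_nat_le_iff of_nat_numeral of_nat_power)
      then show "1 \<le> ?q E j" using r0[of j] by (simp add: pos_le_divide_eq)
    qed
    then have "1 * (?q E (fst u) * ?q E (fst v)) \<le> (\<Prod>i\<in>UNIV. ?q E i)"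
      unfolding P by (intro mult_right_mono) auto
    then have "?C * (?q E (fst u) * ?q E (fst v)) \<le> ?C * (\<Prod>i\<in>UNIV. ?q E i)"
      using C0 by (intro mult_left_mono) auto
    moreover have "\<bar>\<Sum>x\<in>{1..K}. \<Sum>y\<in>{1..K}. T (E(u := x, v := y))\<bar> \<le> ?C * ?q E (fst u) * ?q E (fst v)"
      by (rule block_pair_bound[OF uv uL V K]) (use E Ew in auto)
    ultimately show ?thesis by (simp only: mult.assoc)
  qed
  have "\<bar>\<Sum>E\<in>label_family K. T E\<bar> = \<bar>\<Sum>E\<in>?R. \<Sum>x\<in>{1..K}. \<Sum>y\<in>{1..K}. T (E(u := x, v := y))\<bar>"
    by (simp only: sum_label_family_split[OF ne K1])
  also have "\<dots> \<le> (\<Sum>E\<in>?R. ?C * (\<Prod>i\<in>UNIV. ?q E i))"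
    by (rule order_trans[OF sum_abs sum_mono]) (rule inner)
  also have "\<dots> \<le> (\<Sum>E\<in>label_family K. ?C * (\<Prod>i\<in>UNIV. ?q E i))"
    by (rule sum_mono2) (auto intro!: mult_nonneg_nonneg prod_nonneg simp: harm_nonneg)
  also have "\<dots> = (\<Sum>E\<in>label_family K. ?C * (\<Prod>i\<in>UNIV. 2 ^ (a i + 1)) * (\<Prod>w\<in>UNIV. 1 / real (E w)))"
  proof (intro sum.cong refl)
    fix E
    have "(\<Prod>i\<in>UNIV. ?q E i) = (\<Prod>i\<in>UNIV. 2 ^ (a i + 1)) * (\<Prod>i\<in>UNIV. 1 / real (rows E i))"
      by (simp only: prod.distrib[symmetric] times_divide_eq_right mult_1_right)
    also have "(\<Prod>i\<in>UNIV. 1 / real (rows E i)) = (\<Prod>w\<in>UNIV. 1 / real (E w))"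
      unfolding rows_def prod_UNIV_pairs by (simp add: prod_dividef)
    finally show "?C * (\<Prod>i\<in>UNIV. ?q E i) = ?C * (\<Prod>i\<in>UNIV. 2 ^ (a i + 1)) * (\<Prod>w\<in>UNIV. 1 / real (E w))"
      by (simp only: mult.assoc)
  qed
  also have "\<dots> = ?C * (\<Prod>i\<in>UNIV. 2 ^ (a i + 1)) * harm K ^ 16"
    unfolding sum_distrib_left[symmetric] sum_inverse_label_family ..
  also have "\<dots> \<le> ?C * (\<Prod>i\<in>UNIV. 2 ^ (a i + 1)) * harm (K ^ 4) ^ 16"
  proof (intro mult_left_mono power_mono harm_mono)
    show "K \<le> K ^ 4" using K1 by (simp add: self_le_power)
  qed (auto intro!: mult_nonneg_nonneg prod_nonneg simp: harm_nonneg)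
  also have "\<dots> = 4 * (harm (K ^ 4) ^ 8 * harm (K ^ 4) ^ 16) * real V powr (- 1/8) * (\<Prod>i\<in>UNIV. 2 ^ (a i + 1))"
    by (simp only: mult_ac)
  also have "harm (K ^ 4) ^ 8 * harm (K ^ 4) ^ 16 = (harm (K ^ 4) ^ 24 :: real)" by (simp flip: power_add)
  finally show ?thesis .
qed

lemma linked_sum_bound:
  assumes uv: "linked u v" and uL: "u \<in> L" "v \<in> L" and V: "V \<ge> 1"
    and K: "\<And>i. 2 ^ (a i + 1) \<le> K"
  shows "\<bar>\<Sum>E\<in>label_family K. T E\<bar> \<le> 4 * harm (K ^ 4) ^ 24 * real V powr (- 1/8) * (\<Prod>i\<in>UNIV. 2 ^ (a i + 1))"
proof (cases "depends u v")
  case True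
  then show ?thesis using linked_sum_bound_aux[of u v K] uv uL V K unfolding linked_def by blast
next
  case False
  then show ?thesis using linked_sum_bound_aux[of v u K] uv uL V K unfolding linked_def by (metis (no_types))
qed

end

section \<open>Counting descent tuples\<close>

text \<open>Identifying \<open>idx\<close> with the field of four elements and writing \<open>\<omega>\<close> for a generator of its
  multiplicative group, the class of \<open>(i, l)\<close> is \<open>l + \<omega> i\<close>.\<close>

definition omega_shift :: "idx \<Rightarrow> idx" where "omega_shift i = (snd i, fst i \<noteq> snd i)"

definition label_class :: "label \<Rightarrow> idx" where
  "label_class w = (fst (snd w) \<noteq> fst (omega_shift (fst w)), snd (snd w) \<noteq> snd (omega_shift (fst w)))"

text \<open>The single label of class \<open>c\<close> in the row \<open>\<sigma> c\<close>.\<close>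

definition class_label :: "(idx \<Rightarrow> idx) \<Rightarrow> idx \<Rightarrow> label" where
  "class_label \<sigma> c = (\<sigma> c, (fst c \<noteq> fst (omega_shift (\<sigma> c)), snd c \<noteq> snd (omega_shift (\<sigma> c))))"

text \<open>A label \<open>(i, l)\<close> has no dependence on a row \<open>j \<noteq> i\<close>
  exactly when \<open>l\<close> is \<open>i\<close> or \<open>j\<close>. An affine change of
  coordinates takes the two rows to 0 and 1; then for a common class \<open>c\<close> the first
  label fails to depend on the second if \<open>c\<close> is 0 or 1, and the second on the first for
  the other two values of \<open>c\<close>. So exactly one dependence holds in each case.\<close>

lemma linked_of_same_class:
  assumes "label_class u = label_class v" "fst u \<noteq> fst v"
  shows "linked u v"
proof -
  define c1 c2 where "c1 = fst (label_class u)" and "c2 = snd (label_class u)"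
  obtain a b a' b' where ab: "fst u = (a, b)" "fst v = (a', b')" by (metis surj_pair)
  have "snd w = (fst (label_class w) \<noteq> snd (fst w), snd (label_class w) \<noteq> (fst (fst w) \<noteq> snd (fst w)))" for w
    by (cases w) (auto simp: label_class_def omega_shift_def)
  then have uv: "snd u = (c1 \<noteq> b, c2 \<noteq> (a \<noteq> b))" "snd v = (c1 \<noteq> b', c2 \<noteq> (a' \<noteq> b'))"
    using assms(1) by (simp_all only: ab c1_def c2_def fst_conv snd_conv)
  have "(a, b) \<noteq> (a', b')" using assms(2) ab by simp
  then show ?thesis unfolding linked_def depends_def dep_def ab uv
    by (cases a; cases b; cases a'; cases b'; cases c1; cases c2) simp_all
qed

lemma class_label_iff: "fst w = \<sigma> (label_class w) \<longleftrightarrow> w = class_label \<sigma> (label_class w)"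
proof
  assume h: "fst w = \<sigma> (label_class w)"
  have "snd w = (fst (label_class w) \<noteq> fst (omega_shift (fst w)), snd (label_class w) \<noteq> snd (omega_shift (fst w)))"
    by (cases w) (auto simp: label_class_def prod_eq_iff)
  then show "w = class_label \<sigma> (label_class w)" unfolding class_label_def h[symmetric] by (simp add: prod_eq_iff)
next
  assume "w = class_label \<sigma> (label_class w)"
  then show "fst w = \<sigma> (label_class w)" unfolding class_label_def by (metis fst_conv)
qed

lemma label_class_class_label: "label_class (class_label \<sigma> c) = c"
  by (cases c) (auto simp: label_class_def class_label_def)

lemma inj_class_label: "inj (class_label \<sigma>)"
  by (metis label_class_class_label injI)

section \<open>Families in which no two linked variables are large\<close>

definition spread :: "nat \<Rightarrow> (label \<Rightarrow> nat) \<Rightarrow> bool" where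
  "spread V E \<longleftrightarrow> \<not> (\<exists>u v. linked u v \<and> V < E u \<and> V < E v)"

text \<open>Large variables of one class must share their row and therefore coincide, so a choice of
  one row for each class covers all large variables.\<close>

lemma spreadD:
  assumes "spread V E"
  shows "\<exists>\<sigma>. \<forall>w. w \<notin> range (class_label \<sigma>) \<longrightarrow> E w \<le> V"
proof -
  \<comment> \<open>The row of a large variable of class \<open>c\<close>; for a class without one
    the value is arbitrary.\<close>
  define \<sigma> where "\<sigma> c = (SOME i. \<exists>w. label_class w = c \<and> fst w = i \<and> V < E w)" for c
  have "E w \<le> V" if w: "w \<notin> range (class_label \<sigma>)" for w
  proof (rule ccontr)
    assume "\<not> E w \<le> V"
    then have big: "V < E w" by simp
    then have "\<exists>i w'. label_class w' = label_class w \<and> fst w' = i \<and> V < E w'" by blast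
    then have "\<exists>w'. label_class w' = label_class w \<and> fst w' = \<sigma> (label_class w) \<and> V < E w'" unfolding \<sigma>_def by (rule someI_ex)
    then obtain w' where w': "label_class w' = label_class w" "fst w' = \<sigma> (label_class w)" "V < E w'" by blast
    have "fst w \<noteq> \<sigma> (label_class w)" using w class_label_iff[of w \<sigma>] by blast
    then have "linked w' w" using w' by (intro linked_of_same_class) auto
    then show False using assms w'(3) big unfolding spread_def by blast
  qed
  then show ?thesis by blast
qed

text \<open>Squarefreeness excludes the product 0, which a single zero factor would produce with all
  others unbounded.\<close>

lemma finite_bounded_products:
  "finite {e :: 'l::finite \<Rightarrow> nat. squarefree (\<Prod>l\<in>UNIV. e l) \<and> (\<Prod>l\<in>UNIV. e l) \<le> N}"
proof (rule finite_subset)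
  show "{e :: 'l \<Rightarrow> nat. squarefree (\<Prod>l\<in>UNIV. e l) \<and> (\<Prod>l\<in>UNIV. e l) \<le> N} \<subseteq> PiE UNIV (\<lambda>_. {..N})"
  proof
    fix e :: "'l \<Rightarrow> nat"
    assume "e \<in> {e. squarefree (\<Prod>l\<in>UNIV. e l) \<and> (\<Prod>l\<in>UNIV. e l) \<le> N}"
    then have e: "squarefree (\<Prod>l\<in>UNIV. e l)" "(\<Prod>l\<in>UNIV. e l) \<le> N" by simp_all
    have "e c \<le> N" for c
    proof -
      have "(\<Prod>l\<in>UNIV. e l) \<noteq> 0" using e(1) by (metis not_squarefree_0)
      moreover have "e c dvd (\<Prod>l\<in>UNIV. e l)" by (rule dvd_prodI) auto
      ultimately have "e c \<le> (\<Prod>l\<in>UNIV. e l)" by (intro dvd_imp_le) auto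
      then show ?thesis using e(2) by linarith
    qed
    then show "e \<in> PiE UNIV (\<lambda>_. {..N})" by (simp add: PiE_UNIV_domain)
  qed
qed (auto intro: finite_PiE)

text \<open>The \<open>4 ^ \<omega>(q)\<close> ordered factorizations of \<open>q\<close> into four factors cancel the weight exactly, so no
  mean value theorem for multiplicative functions is needed.\<close>

lemma sum_factorization_weights:
  "(\<Sum>e\<in>{e :: idx \<Rightarrow> nat. squarefree (\<Prod>c\<in>UNIV. e c) \<and> (\<Prod>c\<in>UNIV. e c) \<le> Z}.
      (1/4) ^ card (prime_factors (\<Prod>c\<in>UNIV. e c))) \<le> real Z"
proof -
  define Q where "Q = {q\<in>{1..Z}. squarefree q}"
  define S where "S = {e :: idx \<Rightarrow> nat. squarefree (\<Prod>c\<in>UNIV. e c) \<and> (\<Prod>c\<in>UNIV. e c) \<le> Z}"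
  have fin: "finite S" unfolding S_def by (rule finite_bounded_products)
  have "(\<Sum>e\<in>S. (1/4) ^ card (prime_factors (\<Prod>c\<in>UNIV. e c)))
      = (\<Sum>q\<in>Q. \<Sum>e\<in>{e\<in>S. (\<Prod>c\<in>UNIV. e c) = q}. (1/4) ^ card (prime_factors (\<Prod>c\<in>UNIV. e c)) :: real)"
  proof (rule sum.group[symmetric])
    show "(\<lambda>e. \<Prod>c\<in>UNIV. e c) ` S \<subseteq> Q"
    proof (rule image_subsetI)
      fix e assume "e \<in> S"
      then have e: "squarefree (\<Prod>c\<in>UNIV. e c)" "(\<Prod>c\<in>UNIV. e c) \<le> Z" by (auto simp: S_def)
      then have "(\<Prod>c\<in>UNIV. e c) \<noteq> 0" by (metis not_squarefree_0)
      then show "(\<Prod>c\<in>UNIV. e c) \<in> Q" using e unfolding Q_def by (simp add: Suc_le_eq)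
    qed
  qed (use fin in \<open>auto simp: Q_def\<close>)
  also have "\<dots> = (\<Sum>q\<in>Q. 1)"
  proof (intro sum.cong refl)
    fix q assume q: "q \<in> Q"
    then have sq: "squarefree q" "q \<le> Z" by (auto simp: Q_def)
    have "{e\<in>S. (\<Prod>c\<in>UNIV. e c) = q} = {e. (\<Prod>c\<in>UNIV. e c) = q}" using sq unfolding S_def by auto
    then have "(\<Sum>e\<in>{e\<in>S. (\<Prod>c\<in>UNIV. e c) = q}. (1/4) ^ card (prime_factors (\<Prod>c\<in>UNIV. e c)))
        = (\<Sum>e\<in>{e :: idx \<Rightarrow> nat. (\<Prod>c\<in>UNIV. e c) = q}. (1/4 :: real) ^ card (prime_factors q))"
      by (intro sum.cong) auto
    also have "\<dots> = real (4 ^ card (prime_factors q)) * (1/4) ^ card (prime_factors q)"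
      using card_factorizations[OF sq(1), where 'l=idx] by simp
    also have "\<dots> = 1" by (simp add: power_one_over)
    finally show "(\<Sum>e\<in>{e\<in>S. (\<Prod>c\<in>UNIV. e c) = q}. (1/4) ^ card (prime_factors (\<Prod>c\<in>UNIV. e c))) = (1::real)" .
  qed
  also have "\<dots> \<le> real Z"
  proof -
    have "card Q \<le> card {1..Z}" by (rule card_mono) (auto simp: Q_def)
    then show ?thesis by simp
  qed
  finally show ?thesis unfolding S_def .
qed

definition omega_weight :: "(label \<Rightarrow> nat) \<Rightarrow> real" where
  "omega_weight E = (\<Prod>w\<in>UNIV. (1/4) ^ card (prime_factors (E w)))"

lemma card_prime_factors_prod:
  fixes e :: "'l::finite \<Rightarrow> nat"
  assumes "squarefree (\<Prod>l\<in>UNIV. e l)"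
  shows "card (prime_factors (\<Prod>l\<in>UNIV. e l)) = (\<Sum>l\<in>UNIV. card (prime_factors (e l)))"
proof -
  have p0: "(\<Prod>l\<in>UNIV. e l) \<noteq> 0" using assms by (metis not_squarefree_0)
  then have e0: "e l \<noteq> 0" for l by (metis UNIV_I finite prod_zero_iff)
  have "prime_factors (\<Prod>l\<in>UNIV. e l) = (\<Union>l\<in>UNIV. prime_factors (e l))"
    using p0 e0 by (auto simp: in_prime_factors_iff prime_dvd_prod_iff)
  then have "card (prime_factors (\<Prod>l\<in>UNIV. e l)) = card (\<Union>l\<in>UNIV. prime_factors (e l))" by (simp only:)
  also have "\<dots> = (\<Sum>l\<in>UNIV. card (prime_factors (e l)))"
  proof (rule card_UN_disjoint)
    show "\<forall>i\<in>UNIV. \<forall>j\<in>UNIV. i \<noteq> j \<longrightarrow> prime_factors (e i) \<inter> prime_factors (e j) = {}"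
    proof (intro ballI impI)
      fix i j :: 'l assume "i \<noteq> j"
      then have "coprime (e i) (e j)" using squarefree_prodD(2)[OF assms] by blast
      then show "prime_factors (e i) \<inter> prime_factors (e j) = {}"
        by (auto simp: in_prime_factors_iff) (metis coprime_common_divisor not_prime_unit)
    qed
  qed auto
  finally show ?thesis .
qed

text \<open>Off the four chosen labels all variables are at most \<open>V\<close>. Once they are
  fixed with product \<open>P\<close>, the four chosen ones have product at most
  \<open>Y div P\<close> and contribute at most \<open>Y / P\<close> in total; summing
  \<open>1 / P\<close> over the fixed ones gives the power of \<open>harm V\<close>.\<close>

lemma sum_spread_fixed:
  assumes V: "V \<ge> 1"
  shows "(\<Sum>E\<in>{E\<in>label_family K. squarefree (\<Prod>w\<in>UNIV. E w) \<and> (\<Prod>w\<in>UNIV. E w) \<le> Y \<and> (\<forall>w. w \<notin> range (class_label \<sigma>) \<longrightarrow> E w \<le> V)}. omega_weight E)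
    \<le> real Y * harm V ^ 16"
proof -
  let ?S = "{E\<in>label_family K. squarefree (\<Prod>w\<in>UNIV. E w) \<and> (\<Prod>w\<in>UNIV. E w) \<le> Y \<and> (\<forall>w. w \<notin> range (class_label \<sigma>) \<longrightarrow> E w \<le> V)}"
  let ?B = "range (class_label \<sigma>)"
  define A where "A = PiE UNIV (\<lambda>w. if w \<in> ?B then {1} else {1..V})"
  define P where "P E = (\<Prod>w\<in>UNIV. E w)" for E :: "label \<Rightarrow> nat"
  define C where "C Z = {e :: idx \<Rightarrow> nat. squarefree (\<Prod>c\<in>UNIV. e c) \<and> (\<Prod>c\<in>UNIV. e c) \<le> Z}" for Z
  define g where "g e = ((1/4) ^ card (prime_factors (\<Prod>c\<in>UNIV. e c)) :: real)" for e :: "idx \<Rightarrow> nat"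
  define small where "small E = (\<lambda>w. if w \<in> ?B then 1 else E w)" for E :: "label \<Rightarrow> nat"
  define big where "big E = (\<lambda>c. E (class_label \<sigma> c))" for E :: "label \<Rightarrow> nat"
  have finA: "finite A" unfolding A_def by (rule finite_PiE) auto
  have finC: "finite (C Z)" for Z unfolding C_def by (rule finite_bounded_products)
  have Psplit: "P E = P (small E) * (\<Prod>c\<in>UNIV. big E c)" for E
  proof -
    have "P E = (\<Prod>w\<in>UNIV. small E w * (if w \<in> ?B then E w else 1))"
      unfolding P_def small_def by (intro prod.cong) auto
    also have "\<dots> = P (small E) * (\<Prod>w\<in>UNIV. if w \<in> ?B then E w else 1)"
      unfolding P_def by (rule prod.distrib)
    also have "(\<Prod>w\<in>UNIV. if w \<in> ?B then E w else 1) = (\<Prod>w\<in>?B. E w)"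
      using prod.inter_restrict[of UNIV E ?B] by simp
    also have "\<dots> = (\<Prod>c\<in>UNIV. big E c)"
      by (subst prod.reindex[OF inj_class_label]) (simp add: big_def)
    finally show ?thesis .
  qed
  \<comment> \<open>Only the weight of the four chosen variables is kept, as it has to offset their
    number of factorizations; the rest is at most 1.\<close>
  have wtle: "omega_weight E \<le> g (big E)" if E: "squarefree (\<Prod>w\<in>UNIV. E w)" for E
  proof -
    have sf: "squarefree (\<Prod>c\<in>UNIV. big E c)"
      using E unfolding P_def[symmetric] Psplit[of E] by (rule squarefree_multD)
    have "omega_weight E = (\<Prod>w\<in>UNIV - ?B. (1/4) ^ card (prime_factors (E w))) * (\<Prod>w\<in>?B. (1/4) ^ card (prime_factors (E w)))"
      unfolding omega_weight_def by (rule prod.subset_diff) auto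
    also have "\<dots> \<le> 1 * (\<Prod>w\<in>?B. (1/4) ^ card (prime_factors (E w)))"
      by (intro mult_right_mono prod_le_1 prod_nonneg) (auto simp: power_le_one)
    also have "\<dots> = (\<Prod>c\<in>UNIV. (1/4) ^ card (prime_factors (big E c)))"
      by (subst prod.reindex[OF inj_class_label]) (simp add: big_def)
    also have "\<dots> = g (big E)"
      unfolding g_def card_prime_factors_prod[OF sf] by (simp add: power_sum)
    finally show ?thesis .
  qed
  have "(\<Sum>E\<in>?S. omega_weight E) \<le> (\<Sum>E\<in>?S. g (big E))" by (intro sum_mono wtle) auto
  also have "\<dots> = (\<Sum>z\<in>(\<lambda>E. (small E, big E)) ` ?S. g (snd z))"
  proof (subst sum.reindex)
    show "inj_on (\<lambda>E. (small E, big E)) ?S"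
    proof (rule inj_onI, rule ext)
      fix E E' w assume h: "(small E, big E) = (small E', big E')"
      show "E w = E' w"
      proof (cases "w \<in> ?B")
        case True
        then obtain c where "w = class_label \<sigma> c" by blast
        then show ?thesis using h by (auto simp: big_def dest: fun_cong)
      next
        case False
        have "small E w = small E' w" using h by simp
        then show ?thesis using False by (simp add: small_def)
      qed
    qed
  qed simp
  also have "\<dots> \<le> (\<Sum>z\<in>(SIGMA E0:A. C (Y div P E0)). g (snd z))"
  proof (rule sum_mono2)
    show "finite (SIGMA E0:A. C (Y div P E0))" using finA finC by blast
    show "(\<lambda>E. (small E, big E)) ` ?S \<subseteq> (SIGMA E0:A. C (Y div P E0))"
    proof (rule image_subsetI)
      fix E assume E: "E \<in> ?S"
      have "small E w \<in> (if w \<in> ?B then {1} else {1..V})" for w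
        using E by (auto simp: small_def label_family_def)
      then have sA: "small E \<in> A" unfolding A_def by (simp add: PiE_UNIV_domain)
      have sfP: "squarefree (P E)" using E by (simp add: P_def)
      then have "P E \<noteq> 0" by (metis not_squarefree_0)
      then have p0: "P (small E) > 0" unfolding Psplit[of E] by simp
      have "(\<Prod>c\<in>UNIV. big E c) * P (small E) \<le> Y"
        using E Psplit[of E] unfolding P_def by (simp add: mult.commute)
      then have "(\<Prod>c\<in>UNIV. big E c) \<le> Y div P (small E)" using p0 by (simp add: less_eq_div_iff_mult_less_eq)
      moreover have "squarefree (\<Prod>c\<in>UNIV. big E c)"
        using sfP unfolding Psplit[of E] by (rule squarefree_multD)
      ultimately show "(small E, big E) \<in> (SIGMA E0:A. C (Y div P E0))" using sA unfolding C_def by blast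
    qed
  qed (simp add: g_def)
  also have "\<dots> = (\<Sum>E0\<in>A. \<Sum>e\<in>C (Y div P E0). g e)"
    by (subst sum.Sigma) (use finA finC in \<open>auto simp: case_prod_unfold\<close>)
  also have "\<dots> \<le> (\<Sum>E0\<in>A. real Y * (\<Prod>w\<in>UNIV. 1 / real (E0 w)))"
  proof (intro sum_mono)
    fix E0
    have "(\<Sum>e\<in>C (Y div P E0). g e) \<le> real (Y div P E0)"
      unfolding C_def g_def by (rule sum_factorization_weights)
    also have "\<dots> \<le> real Y / real (P E0)"
    proof (cases "P E0 = 0")
      case False
      have "real (P E0 * (Y div P E0)) \<le> real Y" by (intro of_nat_mono) simp
      then show ?thesis using False by (simp add: field_simps)
    qed simp
    also have "\<dots> = real Y * (\<Prod>w\<in>UNIV. 1 / real (E0 w))" by (simp add: P_def prod_dividef)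
    finally show "(\<Sum>e\<in>C (Y div P E0). g e) \<le> real Y * (\<Prod>w\<in>UNIV. 1 / real (E0 w))" .
  qed
  also have "\<dots> = real Y * (\<Prod>w\<in>UNIV. \<Sum>n\<in>(if w \<in> ?B then {1} else {1..V}). 1 / real n)"
    unfolding A_def sum_distrib_left[symmetric] by (subst prod_sum_PiE) auto
  also have "\<dots> \<le> real Y * (\<Prod>w\<in>(UNIV :: label set). harm V)"
  proof (intro mult_left_mono prod_mono conjI)
    fix w :: label
    show "0 \<le> (\<Sum>n\<in>(if w \<in> ?B then {1} else {1..V}). 1 / real n)" by (rule sum_nonneg) simp
    have "(\<Sum>n\<in>(if w \<in> ?B then {1} else {1..V}). 1 / real n) \<le> (\<Sum>n\<in>{1..V}. 1 / real n)"
      using V by (intro sum_mono2) auto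
    then show "(\<Sum>n\<in>(if w \<in> ?B then {1} else {1..V}). 1 / real n) \<le> harm V"
      by (simp add: harm_def inverse_eq_divide)
  qed simp
  also have "\<dots> = real Y * harm V ^ 16" by simp
  finally show ?thesis .
qed

text \<open>A union bound over the 4 ^ 4 = 256 ways to choose a row for each class.\<close>

lemma sum_spread:
  assumes V: "V \<ge> 1"
  shows "(\<Sum>E\<in>{E\<in>label_family K. squarefree (\<Prod>w\<in>UNIV. E w) \<and> (\<Prod>w\<in>UNIV. E w) \<le> Y \<and> spread V E}. omega_weight E)
    \<le> 256 * real Y * harm V ^ 16"
proof -
  let ?S = "{E\<in>label_family K. squarefree (\<Prod>w\<in>UNIV. E w) \<and> (\<Prod>w\<in>UNIV. E w) \<le> Y \<and> spread V E}"
  define A where "A \<sigma> = {E\<in>label_family K. squarefree (\<Prod>w\<in>UNIV. E w) \<and> (\<Prod>w\<in>UNIV. E w) \<le> Y \<and> (\<forall>w. w \<notin> range (class_label \<sigma>) \<longrightarrow> E w \<le> V)}" for \<sigma>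
  have w0: "0 \<le> omega_weight E" for E unfolding omega_weight_def by (intro prod_nonneg) auto
  have "?S \<subseteq> (\<Union>\<sigma>\<in>UNIV. A \<sigma>)"
  proof
    fix E assume E: "E \<in> ?S"
    then obtain \<sigma> where "\<forall>w. w \<notin> range (class_label \<sigma>) \<longrightarrow> E w \<le> V" using spreadD[of V E] by blast
    then show "E \<in> (\<Union>\<sigma>\<in>UNIV. A \<sigma>)" using E unfolding A_def by blast
  qed
  then have "(\<Sum>E\<in>?S. omega_weight E) \<le> (\<Sum>E\<in>(\<Union>\<sigma>\<in>UNIV. A \<sigma>). omega_weight E)"
    using w0 by (intro sum_mono2) (auto simp: A_def)
  also have "\<dots> \<le> (\<Sum>\<sigma>\<in>UNIV. \<Sum>E\<in>A \<sigma>. omega_weight E)"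
  proof -
    have "(\<Union>\<sigma>\<in>UNIV. A \<sigma>) = snd ` (SIGMA \<sigma>:UNIV. A \<sigma>)" by force
    then have "(\<Sum>E\<in>(\<Union>\<sigma>\<in>UNIV. A \<sigma>). omega_weight E) = (\<Sum>E\<in>snd ` (SIGMA \<sigma>:UNIV. A \<sigma>). omega_weight E)"
      by (simp only:)
    also have "\<dots> \<le> (\<Sum>z\<in>(SIGMA \<sigma>:UNIV. A \<sigma>). (omega_weight \<circ> snd) z)"
    proof (rule sum_image_le)
      have "finite (A \<sigma>)" for \<sigma> by (simp add: A_def)
      then show "finite (SIGMA \<sigma>:UNIV. A \<sigma>)" by (intro finite_SigmaI) auto
    qed (rule w0)
    also have "\<dots> = (\<Sum>\<sigma>\<in>UNIV. \<Sum>E\<in>A \<sigma>. omega_weight E)"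
      by (subst sum.Sigma) (auto simp: A_def case_prod_unfold)
    finally show ?thesis .
  qed
  also have "\<dots> \<le> (\<Sum>\<sigma>\<in>(UNIV :: (idx \<Rightarrow> idx) set). real Y * harm V ^ 16)"
    unfolding A_def by (intro sum_mono sum_spread_fixed V)
  also have "\<dots> = 256 * real Y * harm V ^ 16" by (simp add: card_fun)
  finally show ?thesis .
qed

lemma abs_char_term_le: "\<bar>char_term \<kappa> E\<bar> \<le> omega_weight E"
proof -
  have "\<bar>char_term \<kappa> E\<bar> = (\<Prod>u\<in>UNIV. \<bar>((1/4) ^ card (prime_factors (E u)) * jac (\<kappa> (fst u) (snd u)) (E u))
      * (\<Prod>v\<in>UNIV. if depends u v then jac (int (E v)) (E u) else 1)\<bar>)" unfolding char_term_def by (rule abs_prod)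
  also have "\<dots> \<le> omega_weight E" unfolding omega_weight_def
  proof (intro prod_mono conjI)
    fix u
    have "\<bar>\<Prod>v\<in>UNIV. if depends u v then jac (int (E v)) (E u) else 1\<bar> = (\<Prod>v\<in>UNIV. \<bar>if depends u v then jac (int (E v)) (E u) else 1\<bar>)"
      by (rule abs_prod)
    also have "\<dots> \<le> 1" by (intro prod_le_1) (auto simp: abs_jac_le)
    finally have 1: "\<bar>\<Prod>v\<in>UNIV. if depends u v then jac (int (E v)) (E u) else 1\<bar> \<le> 1" .
    have "\<bar>jac (\<kappa> (fst u) (snd u)) (E u)\<bar> * \<bar>\<Prod>v\<in>UNIV. if depends u v then jac (int (E v)) (E u) else 1\<bar> \<le> 1"
      by (intro mult_le_one abs_jac_le 1) auto
    then have "(1/4) ^ card (prime_factors (E u)) * (\<bar>jac (\<kappa> (fst u) (snd u)) (E u)\<bar> * \<bar>\<Prod>v\<in>UNIV. if depends u v then jac (int (E v)) (E u) else 1\<bar>)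
        \<le> (1/4) ^ card (prime_factors (E u)) * 1"
      by (intro mult_left_mono) auto
    then show "\<bar>((1/4) ^ card (prime_factors (E u)) * jac (\<kappa> (fst u) (snd u)) (E u))
      * (\<Prod>v\<in>UNIV. if depends u v then jac (int (E v)) (E u) else 1)\<bar> \<le> (1/4) ^ card (prime_factors (E u))"
      by (simp add: abs_mult mult.assoc)
  qed simp
  finally show ?thesis .
qed

text \<open>Linked variables lie in different rows, so the dyadic constraints on the rows do not couple them.\<close>

definition dyadic_box :: "(idx \<Rightarrow> nat) \<Rightarrow> (idx \<Rightarrow> nat) set" where
  "dyadic_box a = {D. valid_tuple D \<and> (\<forall>i. 2 ^ a i \<le> D i \<and> D i < 2 ^ (a i + 1))}"

lemma finite_dyadic_box [simp]: "finite (dyadic_box a)"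
proof (rule finite_subset)
  show "dyadic_box a \<subseteq> PiE UNIV (\<lambda>i. {..<2 ^ (a i + 1)})" by (auto simp: dyadic_box_def PiE_UNIV_domain)
qed (auto intro: finite_PiE)

lemma dyadic_box_unique:
  assumes "D \<in> dyadic_box a" "D \<in> dyadic_box b" shows "a = b"
proof
  fix i
  have "(2::nat) ^ a i < 2 ^ (b i + 1)" "(2::nat) ^ b i < 2 ^ (a i + 1)"
    using assms unfolding dyadic_box_def by (metis (mono_tags, lifting) le_less_trans mem_Collect_eq)+
  then show "a i = b i" by (simp add: power_strict_increasing_iff del: power_Suc)
qed

lemma prod_rows: "(\<Prod>i\<in>UNIV. rows E i) = (\<Prod>w\<in>UNIV. E w)"
  unfolding rows_def prod_UNIV_pairs ..

lemma rows_dyadic_box_label_family: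
  assumes "rows E \<in> dyadic_box a" "\<And>i. 2 ^ (a i + 1) \<le> K"
  shows "E \<in> label_family K"
proof -
  have "E w \<in> {1..K}" for w
  proof -
    have r: "rows E (fst w) < 2 ^ (a (fst w) + 1)" "0 < rows E (fst w)"
    proof -
      have b: "2 ^ a (fst w) \<le> rows E (fst w)" "rows E (fst w) < 2 ^ (a (fst w) + 1)"
        using assms(1) unfolding dyadic_box_def by blast+
      have "0 < (2::nat) ^ a (fst w)" by simp
      then show "rows E (fst w) < 2 ^ (a (fst w) + 1)" "0 < rows E (fst w)" using b by linarith+
    qed
    have d: "E w dvd rows E (fst w)" unfolding rows_def by (cases w) (auto intro: dvd_prodI)
    then have "E w \<le> rows E (fst w)" using r by (intro dvd_imp_le)
    moreover have "E w \<noteq> 0" using d r by auto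
    ultimately show ?thesis using r assms(2)[of "fst w"] by auto
  qed
  then show ?thesis unfolding label_family_def by blast
qed

lemma sum_descent_weight_box:
  assumes K: "\<And>i. 2 ^ (a i + 1) \<le> K"
  shows "(\<Sum>D\<in>dyadic_box a. descent_weight \<kappa> D) = (\<Sum>L\<in>UNIV. \<Sum>E\<in>{E\<in>label_family K. rows E \<in> dyadic_box a \<and> {u. V < E u} = L}. char_term \<kappa> E)"
proof -
  define S where "S = {E\<in>label_family K. rows E \<in> dyadic_box a}"
  have fS: "finite S" by (simp add: S_def)
  have "(\<Sum>D\<in>dyadic_box a. descent_weight \<kappa> D) = (\<Sum>D\<in>dyadic_box a. \<Sum>E\<in>{E\<in>S. rows E = D}. char_term \<kappa> E)"
  proof (intro sum.cong refl)
    fix D assume D: "D \<in> dyadic_box a"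
    then have "valid_tuple D" by (simp add: dyadic_box_def)
    moreover have "{E. \<forall>i. rows E i = D i} = {E\<in>S. rows E = D}"
    proof -
      have "(\<forall>i. rows E i = D i) \<longleftrightarrow> rows E = D" for E by (auto simp: fun_eq_iff)
      moreover have "E \<in> label_family K" if "rows E = D" for E
        by (rule rows_dyadic_box_label_family[where a=a]) (use that D K in auto)
      ultimately show ?thesis using D unfolding S_def by auto
    qed
    ultimately show "descent_weight \<kappa> D = (\<Sum>E\<in>{E\<in>S. rows E = D}. char_term \<kappa> E)" by (simp add: descent_weight_expand)
  qed
  also have "\<dots> = (\<Sum>E\<in>S. char_term \<kappa> E)" by (rule sum.group) (use fS in \<open>auto simp: S_def\<close>)
  also have "\<dots> = (\<Sum>L\<in>UNIV. \<Sum>E\<in>{E\<in>S. {u. V < E u} = L}. char_term \<kappa> E)"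
    by (rule sum.group[symmetric]) (use fS in auto)
  also have "\<dots> = (\<Sum>L\<in>UNIV. \<Sum>E\<in>{E\<in>label_family K. rows E \<in> dyadic_box a \<and> {u. V < E u} = L}. char_term \<kappa> E)"
    by (simp add: S_def conj_assoc)
  finally show ?thesis .
qed

text \<open>The families are sorted by the set \<open>L\<close> of labels above \<open>V\<close>, of
  which there are 2 ^ 16. A set containing a linked pair is handled by cancellation; the remaining
  ones make up the spread families, where absolute values are taken.\<close>

lemma sum_descent_weight_box_le:
  assumes K: "\<And>i. 2 ^ (a i + 1) \<le> K" and V: "V \<ge> 1"
  shows "(\<Sum>D\<in>dyadic_box a. descent_weight \<kappa> D) \<le> 2 ^ 16 * (4 * harm (K ^ 4) ^ 24 * real V powr (- 1/8) * (\<Prod>i\<in>UNIV. 2 ^ (a i + 1)))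
     + (\<Sum>E\<in>{E\<in>label_family K. rows E \<in> dyadic_box a \<and> spread V E}. omega_weight E)"
proof -
  let ?R = "4 * harm (K ^ 4) ^ 24 * real V powr (- 1/8) * (\<Prod>i\<in>UNIV. 2 ^ (a i + 1)) :: real"
  let ?F = "\<lambda>L. {E\<in>label_family K. rows E \<in> dyadic_box a \<and> {u. V < E u} = L}"
  define bad where "bad = {L. \<exists>u v. linked u v \<and> u \<in> L \<and> v \<in> L}"
  have R0: "0 \<le> ?R" by (intro mult_nonneg_nonneg prod_nonneg) (auto simp: harm_nonneg)
  have w0: "0 \<le> omega_weight E" for E unfolding omega_weight_def by (intro prod_nonneg) auto
  have B: "(\<Sum>E\<in>?F L. char_term \<kappa> E) \<le> ?R" if L: "L \<in> bad" for L
  proof -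
    interpret block \<kappa> a V L .
    have "(\<Sum>E\<in>?F L. char_term \<kappa> E) = (\<Sum>E\<in>label_family K. T E)"
      unfolding T_eq by (rule sum.mono_neutral_cong_left) (auto simp: dyadic_box_def inbox_def)
    moreover obtain u v where "linked u v" "u \<in> L" "v \<in> L" using L unfolding bad_def by blast
    then have "\<bar>\<Sum>E\<in>label_family K. T E\<bar> \<le> ?R" using V K by (rule linked_sum_bound)
    ultimately show ?thesis by linarith
  qed
  have "(\<Sum>D\<in>dyadic_box a. descent_weight \<kappa> D) = (\<Sum>L\<in>UNIV. \<Sum>E\<in>?F L. char_term \<kappa> E)" by (rule sum_descent_weight_box[OF K])
  also have "\<dots> \<le> (\<Sum>L\<in>UNIV. ?R + (if L \<in> bad then 0 else \<Sum>E\<in>?F L. omega_weight E))"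
  proof (intro sum_mono)
    fix L
    show "(\<Sum>E\<in>?F L. char_term \<kappa> E) \<le> ?R + (if L \<in> bad then 0 else \<Sum>E\<in>?F L. omega_weight E)"
    proof (cases "L \<in> bad")
      case True then show ?thesis using B by simp
    next
      case False
      have "(\<Sum>E\<in>?F L. char_term \<kappa> E) \<le> (\<Sum>E\<in>?F L. omega_weight E)"
        by (intro sum_mono order_trans[OF abs_ge_self abs_char_term_le])
      then have "(\<Sum>E\<in>?F L. char_term \<kappa> E) \<le> ?R + (\<Sum>E\<in>?F L. omega_weight E)" using R0 by linarith
      then show ?thesis using False by (simp only: if_False)
    qed
  qed
  also have "\<dots> = 2 ^ 16 * ?R + (\<Sum>L\<in>UNIV. if L \<in> bad then 0 else \<Sum>E\<in>?F L. omega_weight E)"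
  proof -
    have "card (UNIV :: label set set) = 2 ^ 16"
      using card_Pow[of "UNIV :: label set"] by (simp add: Pow_UNIV)
    then show ?thesis by (simp add: sum.distrib)
  qed
  also have "(\<Sum>L\<in>UNIV. if L \<in> bad then 0 else \<Sum>E\<in>?F L. omega_weight E) = (\<Sum>L\<in>UNIV. \<Sum>E\<in>{E\<in>{E\<in>label_family K. rows E \<in> dyadic_box a \<and> spread V E}. {u. V < E u} = L}. omega_weight E)"
  proof (intro sum.cong refl)
    fix L
    have "{E\<in>{E\<in>label_family K. rows E \<in> dyadic_box a \<and> spread V E}. {u. V < E u} = L} = (if L \<in> bad then {} else ?F L)"
      unfolding bad_def spread_def by auto
    then show "(if L \<in> bad then 0 else \<Sum>E\<in>?F L. omega_weight E) = (\<Sum>E\<in>{E\<in>{E\<in>label_family K. rows E \<in> dyadic_box a \<and> spread V E}. {u. V < E u} = L}. omega_weight E)"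
      by simp
  qed
  also have "\<dots> = (\<Sum>E\<in>{E\<in>label_family K. rows E \<in> dyadic_box a \<and> spread V E}. omega_weight E)" by (rule sum.group) auto
  finally show ?thesis .
qed

text \<open>Nonnegativity of the weight allows the count in a dyadic box to be replaced by the full
  sum of weights. The upper corner of a box has product at most \<open>16 * X\<close>; this accounts
  for 2 ^ 22 as 2 ^ 16 times 4 times 16 and for 4096 as 256 times 16. At most
  \<open>(log 2 X + 1) ^ 4\<close> boxes are needed.\<close>

proposition card_descent_le:
  assumes k: "good_coeff \<kappa>" and V: "V \<ge> 1" and X: "X \<ge> 1"
  shows "real (card {D. valid_tuple D \<and> (\<Prod>i\<in>UNIV. D i) \<le> X \<and> descent_cond \<kappa> D})
    \<le> real X * (4096 * harm V ^ 16 + 2 ^ 22 * (log 2 (real X) + 1) ^ 4 * harm ((2 * X) ^ 4) ^ 24 * real V powr (- 1/8))"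
proof -
  define A where "A = {a :: idx \<Rightarrow> nat. (\<Prod>i\<in>UNIV. 2 ^ a i) \<le> X}"
  define N where "N = {D. valid_tuple D \<and> (\<Prod>i\<in>UNIV. D i) \<le> X \<and> descent_cond \<kappa> D}"
  define B where "B = nat \<lfloor>log 2 (real X)\<rfloor>"
  define K where "K = 2 * X"
  have aX: "2 ^ a i \<le> X" if "a \<in> A" for a i
  proof -
    have "2 ^ a i dvd (\<Prod>i\<in>UNIV. 2 ^ a i :: nat)" by (rule dvd_prodI) auto
    then have "2 ^ a i \<le> (\<Prod>i\<in>UNIV. 2 ^ a i :: nat)" by (rule dvd_imp_le) (simp add: prod_pos)
    then show ?thesis using that unfolding A_def by simp
  qed
  have aK: "2 ^ (a i + 1) \<le> K" if "a \<in> A" for a i using aX[OF that, of i] by (simp add: K_def)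
  have subA: "A \<subseteq> PiE UNIV (\<lambda>_. {..B})"
  proof
    fix a assume a: "a \<in> A"
    have "a i \<le> B" for i
    proof -
      have "2 ^ a i \<le> real X" using aX[OF a, of i] by (metis of_nat_le_iff of_nat_numeral of_nat_power)
      then have "real (a i) \<le> log 2 (real X)" using X by (simp add: le_log_iff powr_realpow)
      then show ?thesis unfolding B_def by (simp add: le_nat_floor)
    qed
    then show "a \<in> PiE UNIV (\<lambda>_. {..B})" by (simp add: PiE_UNIV_domain)
  qed
  have finA: "finite A" using subA by (rule finite_subset) (auto intro: finite_PiE)
  have cardA: "real (card A) \<le> (log 2 (real X) + 1) ^ 4"
  proof -
    have "card A \<le> card (PiE (UNIV::idx set) (\<lambda>_. {..B}))" using subA by (intro card_mono) (auto intro: finite_PiE)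
    also have "\<dots> = (B + 1) ^ 4" by (simp add: card_PiE)
    finally have "real (card A) \<le> (real B + 1) ^ 4" by (metis of_nat_1 of_nat_add of_nat_le_iff of_nat_power)
    also have "\<dots> \<le> (log 2 (real X) + 1) ^ 4" using X by (intro power_mono) (auto simp: B_def)
    finally show ?thesis .
  qed
  have "N \<subseteq> (\<Union>a\<in>A. {D\<in>dyadic_box a. descent_cond \<kappa> D})"
  proof
    fix D assume D: "D \<in> N"
    then have v: "valid_tuple D" and PX: "(\<Prod>i\<in>UNIV. D i) \<le> X" and c: "descent_cond \<kappa> D" by (auto simp: N_def)
    have D0: "D i > 0" for i using valid_tupleD(1)[OF v, of i] by (rule odd_pos)
    have "\<exists>n. 2 ^ n \<le> D i \<and> D i < 2 ^ (n + 1)" for i using ex_power_ivl1[of 2 "D i"] D0[of i] by auto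
    then obtain a where a: "\<And>i. 2 ^ a i \<le> D i" "\<And>i. D i < 2 ^ (a i + 1)" by metis
    have "(\<Prod>i\<in>UNIV. 2 ^ a i) \<le> (\<Prod>i\<in>UNIV. D i)" by (intro prod_mono) (use a in auto)
    then have "a \<in> A" using PX by (simp add: A_def)
    moreover have "D \<in> dyadic_box a" using a v by (simp add: dyadic_box_def)
    ultimately show "D \<in> (\<Union>a\<in>A. {D\<in>dyadic_box a. descent_cond \<kappa> D})" using c by blast
  qed
  then have "card N \<le> card (\<Union>a\<in>A. {D\<in>dyadic_box a. descent_cond \<kappa> D})" using finA by (intro card_mono) auto
  also have "\<dots> \<le> (\<Sum>a\<in>A. card {D\<in>dyadic_box a. descent_cond \<kappa> D})" using finA by (rule card_UN_le)
  finally have "real (card N) \<le> (\<Sum>a\<in>A. real (card {D\<in>dyadic_box a. descent_cond \<kappa> D}))" by (simp flip: of_nat_sum)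
  also have "\<dots> \<le> (\<Sum>a\<in>A. \<Sum>D\<in>dyadic_box a. descent_weight \<kappa> D)"
  proof (intro sum_mono)
    fix a
    have "real (card {D\<in>dyadic_box a. descent_cond \<kappa> D}) = (\<Sum>D\<in>{D\<in>dyadic_box a. descent_cond \<kappa> D}. descent_weight \<kappa> D)"
      by (simp add: descent_weight_eq_1)
    also have "\<dots> \<le> (\<Sum>D\<in>dyadic_box a. descent_weight \<kappa> D)"
    proof (rule sum_mono2[OF finite_dyadic_box])
      fix D assume "D \<in> dyadic_box a - {D\<in>dyadic_box a. descent_cond \<kappa> D}"
      then have "valid_tuple D" by (simp add: dyadic_box_def)
      then show "0 \<le> descent_weight \<kappa> D" using k by (rule descent_weight_nonneg)
    qed blast
    finally show "real (card {D\<in>dyadic_box a. descent_cond \<kappa> D}) \<le> (\<Sum>D\<in>dyadic_box a. descent_weight \<kappa> D)" .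
  qed
  also have "\<dots> \<le> (\<Sum>a\<in>A. 2 ^ 22 * real X * harm (K ^ 4) ^ 24 * real V powr (- 1/8)
      + (\<Sum>E\<in>{E\<in>label_family K. rows E \<in> dyadic_box a \<and> spread V E}. omega_weight E))"
  proof (intro sum_mono)
    fix a assume a: "a \<in> A"
    have "(\<Prod>i\<in>UNIV. 2 ^ (a i + 1)) = (16 * (\<Prod>i\<in>UNIV. 2 ^ a i) :: real)"
      by (simp add: prod.distrib)
    also have "(\<Prod>i\<in>UNIV. 2 ^ a i :: real) = real (\<Prod>i\<in>UNIV. 2 ^ a i)" by simp
    also have "\<dots> \<le> real X" using a unfolding A_def by (simp only: mem_Collect_eq of_nat_le_iff)
    finally have p: "(\<Prod>i\<in>UNIV. 2 ^ (a i + 1)) \<le> 16 * real X" by simp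
    have "2 ^ 16 * (4 * harm (K ^ 4) ^ 24 * real V powr (- 1/8) * (\<Prod>i\<in>UNIV. 2 ^ (a i + 1)))
       \<le> 2 ^ 16 * (4 * harm (K ^ 4) ^ 24 * real V powr (- 1/8) * (16 * real X))"
      by (intro mult_left_mono p) (auto simp: harm_nonneg)
    also have "\<dots> = 2 ^ 22 * real X * harm (K ^ 4) ^ 24 * real V powr (- 1/8)" by simp
    finally show "(\<Sum>D\<in>dyadic_box a. descent_weight \<kappa> D) \<le> 2 ^ 22 * real X * harm (K ^ 4) ^ 24 * real V powr (- 1/8)
      + (\<Sum>E\<in>{E\<in>label_family K. rows E \<in> dyadic_box a \<and> spread V E}. omega_weight E)"
      using sum_descent_weight_box_le[where a=a and K=K and \<kappa>=\<kappa>, OF aK[OF a] V] by linarith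
  qed
  also have "\<dots> = real (card A) * (2 ^ 22 * real X * harm (K ^ 4) ^ 24 * real V powr (- 1/8))
      + (\<Sum>a\<in>A. \<Sum>E\<in>{E\<in>label_family K. rows E \<in> dyadic_box a \<and> spread V E}. omega_weight E)" by (simp add: sum.distrib)
  also have "\<dots> \<le> (log 2 (real X) + 1) ^ 4 * (2 ^ 22 * real X * harm (K ^ 4) ^ 24 * real V powr (- 1/8))
      + 256 * real (16 * X) * harm V ^ 16"
  proof (intro add_mono mult_right_mono cardA)
    \<comment> \<open>The spread parts of different boxes are disjoint and are put together before
      being estimated. Thus only the part with cancellation pays for the number of boxes.\<close>
    have "(\<Sum>a\<in>A. \<Sum>E\<in>{E\<in>label_family K. rows E \<in> dyadic_box a \<and> spread V E}. omega_weight E)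
       = (\<Sum>E\<in>(\<Union>a\<in>A. {E\<in>label_family K. rows E \<in> dyadic_box a \<and> spread V E}). omega_weight E)"
    proof (rule sum.UNION_disjoint[symmetric])
      show "\<forall>i\<in>A. \<forall>j\<in>A. i \<noteq> j \<longrightarrow> {E\<in>label_family K. rows E \<in> dyadic_box i \<and> spread V E} \<inter> {E\<in>label_family K. rows E \<in> dyadic_box j \<and> spread V E} = {}"
        using dyadic_box_unique by blast
    qed (use finA in auto)
    also have "\<dots> \<le> (\<Sum>E\<in>{E\<in>label_family K. squarefree (\<Prod>w\<in>UNIV. E w) \<and> (\<Prod>w\<in>UNIV. E w) \<le> 16 * X \<and> spread V E}. omega_weight E)"
    proof (rule sum_mono2)
      show "(\<Union>a\<in>A. {E\<in>label_family K. rows E \<in> dyadic_box a \<and> spread V E})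
         \<subseteq> {E\<in>label_family K. squarefree (\<Prod>w\<in>UNIV. E w) \<and> (\<Prod>w\<in>UNIV. E w) \<le> 16 * X \<and> spread V E}"
      proof
        fix E assume "E \<in> (\<Union>a\<in>A. {E\<in>label_family K. rows E \<in> dyadic_box a \<and> spread V E})"
        then obtain a where a: "a \<in> A" "E \<in> label_family K" "rows E \<in> dyadic_box a" "spread V E" by blast
        have "valid_tuple (rows E)" using a(3) by (simp add: dyadic_box_def)
        then have "squarefree (\<Prod>w\<in>UNIV. E w)" unfolding valid_tuple_def prod_rows by blast
        moreover have "(\<Prod>w\<in>UNIV. E w) \<le> (\<Prod>i\<in>UNIV. 2 ^ (a i + 1))"
          unfolding prod_rows[symmetric]
          by (intro prod_mono) (use a(3) in \<open>auto simp: dyadic_box_def intro: less_imp_le\<close>)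
        then have "(\<Prod>w\<in>UNIV. E w) \<le> 16 * X" using a(1) by (simp add: A_def prod.distrib)
        ultimately show "E \<in> {E\<in>label_family K. squarefree (\<Prod>w\<in>UNIV. E w) \<and> (\<Prod>w\<in>UNIV. E w) \<le> 16 * X \<and> spread V E}"
          using a by blast
      qed
    qed (auto simp: omega_weight_def intro: prod_nonneg)
    also have "\<dots> \<le> 256 * real (16 * X) * harm V ^ 16" by (rule sum_spread[OF V])
    finally show "(\<Sum>a\<in>A. \<Sum>E\<in>{E\<in>label_family K. rows E \<in> dyadic_box a \<and> spread V E}. omega_weight E) \<le> 256 * real (16 * X) * harm V ^ 16" .
  qed (auto simp: harm_nonneg)
  also have "\<dots> = real X * (4096 * harm V ^ 16 + 2 ^ 22 * (log 2 (real X) + 1) ^ 4 * harm ((2 * X) ^ 4) ^ 24 * real V powr (- 1/8))"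
    by (simp add: K_def algebra_simps)
  finally show ?thesis unfolding N_def .
qed

section \<open>Comparison of the two counts\<close>

definition two_parts :: "(idx \<Rightarrow> nat) set" where "two_parts = {s. \<forall>k. s k \<in> {1, 2}}"

lemma two_parts_eq_PiE: "two_parts = PiE UNIV (\<lambda>_. {1, 2})"
  unfolding two_parts_def by (auto simp: PiE_UNIV_domain)

lemma finite_two_parts [simp]: "finite two_parts"
  unfolding two_parts_eq_PiE by (rule finite_PiE) auto

lemma card_two_parts: "card two_parts = 16"
  unfolding two_parts_eq_PiE by (simp add: card_PiE flip: numeral_2_eq_2)

text \<open>For fixed \<open>i\<close> every \<open>s k\<close> with \<open>k \<noteq> i\<close>
  occurs for exactly two values of \<open>l\<close>, and the four values of
  \<open>descent_sign\<close> multiply to 1 or 4, so the product of the constants is a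
  square.\<close>

lemma good_coeff_descent_coeff:
  assumes s: "s \<in> two_parts"
  shows "good_coeff (descent_coeff s)"
  unfolding good_coeff_def
proof (intro conjI allI impI)
  fix i
  show "descent_coeff s i i = 1"
    by (cases i rule: idx_cases) (simp_all add: descent_coeff_def descent_sign_def dprod_def dep_def)
next
  fix i :: idx and p :: nat assume p: "prime p" "2 < p"
  let ?L = "\<lambda>a. Legendre a (int p)"
  note LM = Legendre_mult[OF p]
  have L1: "?L 1 = 1" using p by (simp add: Legendre_1)
  have "\<not> int p dvd 2" "\<not> int p dvd -1" using p zdvd_not_zless[of 2 "int p"] by auto
  then have sq: "?L 2 * ?L 2 = 1" "?L (-1) * ?L (-1) = 1"
    using Legendre_cases[of 2 p] Legendre_cases[of "-1" p] Legendre_eq_0_iff[of 2 "int p"] Legendre_eq_0_iff[of "-1" "int p"]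
    by fastforce+
  have L2: "?L (-2) = ?L (-1) * ?L 2" using LM[of "-1" 2] by simp
  have ss: "?L (int (s k)) * ?L (int (s k)) = 1" for k
  proof -
    have "s k = 1 \<or> s k = 2" using s unfolding two_parts_def by blast
    then show ?thesis using L1 sq by auto
  qed
  have "(\<Prod>l\<in>UNIV. ?L (descent_coeff s i l)) = (\<Prod>l\<in>UNIV. ?L (descent_sign i l)) * (\<Prod>l\<in>UNIV. ?L (dprod i l s))"
    unfolding descent_coeff_def by (simp add: LM prod.distrib)
  also have "(\<Prod>l\<in>UNIV. ?L (descent_sign i l)) = 1"
  proof -
    have "a * b * (a * b) = 1" if "a * a = 1" "b * b = 1" for a b :: int
      using that by (metis mult.assoc mult.commute mult_1)
    then show ?thesis
      using sq by (cases i rule: idx_cases) (simp_all add: prod_UNIV_idx descent_sign_def L1 L2 mult_ac)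
  qed
  also have "(\<Prod>l\<in>UNIV. ?L (dprod i l s)) = (\<Prod>k\<in>UNIV. if k = i then 1 else ?L (int (s k)) * ?L (int (s k)))"
    by (cases i rule: idx_cases) (simp_all add: prod_UNIV_idx dprod_def dep_def LM L1 mult_ac)
  also have "\<dots> = 1" by (intro prod.neutral ballI) (simp add: ss)
  finally show "(\<Prod>l\<in>UNIV. ?L (descent_coeff s i l)) = 1" by simp
qed

section \<open>From soluble forms to descent tuples\<close>

lemma rat_sqrt_of_int:
  fixes r :: rat
  assumes "r\<^sup>2 = of_int N"
  shows "\<exists>m. r = of_int m"
proof -
  obtain a b where ab: "quotient_of r = (a, b)" by (cases "quotient_of r")
  have b: "b > 0" "coprime a b" using ab quotient_of_denom_pos quotient_of_coprime by blast+
  have r: "r = of_int a / of_int b" using ab quotient_of_div by blast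
  have "of_int (a\<^sup>2) = (of_int (N * b\<^sup>2) :: rat)"
    using assms b unfolding r by (simp add: power_divide field_simps)
  then have "a\<^sup>2 = N * b\<^sup>2" by (simp only: of_int_eq_iff)
  then have "b\<^sup>2 dvd a\<^sup>2" by simp
  then have "b dvd a" by simp
  then have "is_unit b" using b(2) by (metis coprime_common_divisor dvd_refl)
  then have "b = 1" using b(1) by auto
  then show ?thesis using r by (intro exI[of _ a]) simp
qed

text \<open>The equation is homogeneous if \<open>z\<close> has weight 2: clearing denominators and
  dividing by the gcd multiplies \<open>z\<close> by the square of the scaling factor, and the
  result is an integer because its square is one. All exponents are even, so signs may be
  dropped.\<close>

lemma primitive_solution:
  fixes x y z :: rat and d e :: nat
  assumes nz: "(x, y) \<noteq> (0, 0)" and eq: "z\<^sup>2 = of_nat d * x ^ 4 - of_nat d * (of_nat e)\<^sup>2 * y ^ 4"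
  shows "\<exists>x y z :: nat. coprime x y \<and> z\<^sup>2 + d * e\<^sup>2 * y ^ 4 = d * x ^ 4"
proof -
  obtain a b where ab: "quotient_of x = (a, b)" by (cases "quotient_of x")
  obtain a' b' where ab': "quotient_of y = (a', b')" by (cases "quotient_of y")
  have b: "b > 0" "b' > 0" using ab ab' quotient_of_denom_pos by blast+
  have xy: "x = of_int a / of_int b" "y = of_int a' / of_int b'" using ab ab' quotient_of_div by blast+
  define X where "X = a * b'"
  define Y where "Y = a' * b"
  define q where "q = b * b'"
  have q: "q > 0" using b by (simp add: q_def)
  have xX: "x = of_int X / of_int q" and yY: "y = of_int Y / of_int q"
    using b by (simp_all add: xy X_def Y_def q_def)
  define g where "g = gcd X Y"
  have "X \<noteq> 0 \<or> Y \<noteq> 0" using nz xX yY by auto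
  then have g: "g > 0" by (simp add: g_def)
  obtain u v where uv: "X = u * g" "Y = v * g" "coprime u v"
  proof -
    have "gcd X Y \<noteq> 0" using g by (simp only: g_def)
    from gcd_coprime_exists[OF this] show ?thesis using that unfolding g_def by blast
  qed
  define N where "N = int d * u ^ 4 - int d * (int e)\<^sup>2 * v ^ 4"
  define t where "t = z * (of_int q / of_int g)\<^sup>2"
  have "t\<^sup>2 = z\<^sup>2 * (of_int q / of_int g) ^ 4" by (simp add: t_def power_mult_distrib flip: power_mult)
  also have "\<dots> = of_nat d * (x * (of_int q / of_int g)) ^ 4 - of_nat d * (of_nat e)\<^sup>2 * (y * (of_int q / of_int g)) ^ 4"
    unfolding eq by (simp only: power_mult_distrib left_diff_distrib mult.assoc)
  also have "x * (of_int q / of_int g) = of_int u" using q g by (simp add: xX uv)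
  also have "y * (of_int q / of_int g) = of_int v" using q g by (simp add: yY uv)
  also have "of_nat d * of_int u ^ 4 - of_nat d * (of_nat e)\<^sup>2 * of_int v ^ 4 = (of_int N :: rat)"
    by (simp add: N_def)
  finally have "t\<^sup>2 = of_int N" .
  then obtain m where "t = of_int m" using rat_sqrt_of_int by blast
  then have "of_int (m\<^sup>2) = (of_int N :: rat)" using \<open>t\<^sup>2 = of_int N\<close> by simp
  then have m: "m\<^sup>2 = N" by (simp only: of_int_eq_iff)
  define x' y' z' where "x' = nat \<bar>u\<bar>" and "y' = nat \<bar>v\<bar>" and "z' = nat \<bar>m\<bar>"
  have i: "int x' ^ 4 = u ^ 4" "int y' ^ 4 = v ^ 4" "int z' ^ 2 = m\<^sup>2"
    by (simp_all add: x'_def y'_def z'_def power_even_abs)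
  have "int (z'\<^sup>2 + d * e\<^sup>2 * y' ^ 4) = int (d * x' ^ 4)"
    using m i by (simp add: N_def)
  then have "z'\<^sup>2 + d * e\<^sup>2 * y' ^ 4 = d * x' ^ 4" by (simp only: of_nat_eq_iff)
  moreover have "coprime x' y'" using uv(3) by (simp add: x'_def y'_def coprime_nat_abs_left_iff coprime_nat_abs_right_iff flip: coprime_int_iff)
  ultimately show ?thesis by blast
qed

definition soluble_divisors :: "nat \<Rightarrow> nat set" where
  "soluble_divisors n = {d. d dvd n \<and> (\<exists>x y z :: nat. coprime x y \<and> z\<^sup>2 + d * (n div d)\<^sup>2 * y ^ 4 = d * x ^ 4)}"

lemma finite_soluble_divisors: "n > 0 \<Longrightarrow> finite (soluble_divisors n)"
  by (rule finite_subset[of _ "{d. d dvd n}"]) (auto simp: soluble_divisors_def)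

text \<open>A form is determined by \<open>a\<close>, and \<open>\<bar>a\<bar>\<close>, being
  squarefree, divides \<open>n\<close> as soon as it divides \<open>n\<^sup>2\<close>. The two signs
  of \<open>a\<close> lead to the same equation and cost the factor 2.\<close>

lemma card_FB_sol_le:
  assumes n: "squarefree n" "n > 0"
  shows "card (FB_sol 0 (- (int n)\<^sup>2)) \<le> 2 * card (soluble_divisors n)"
proof -
  have M0: "- (int n)\<^sup>2 \<noteq> 0" using n by simp
  have "card (FB_sol 0 (- (int n)\<^sup>2)) \<le> card ({1, -1 :: int} \<times> soluble_divisors n)"
  proof (rule card_inj_on_le[where f="\<lambda>(a, c). (sgn a, nat \<bar>a\<bar>)"])
    show "finite ({1, -1 :: int} \<times> soluble_divisors n)" using finite_soluble_divisors[OF n(2)] by simp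
    show "inj_on (\<lambda>(a, c). (sgn a, nat \<bar>a\<bar>)) (FB_sol 0 (- (int n)\<^sup>2))"
    proof (rule inj_onI)
      fix P Q assume P: "P \<in> FB_sol 0 (- (int n)\<^sup>2)" and Q: "Q \<in> FB_sol 0 (- (int n)\<^sup>2)"
        and eq: "(\<lambda>(a, c). (sgn a, nat \<bar>a\<bar>)) P = (\<lambda>(a, c). (sgn a, nat \<bar>a\<bar>)) Q"
      obtain a c a' c' where PQ: "P = (a, c)" "Q = (a', c')" by (metis surj_pair)
      have ac: "a * c = - (int n)\<^sup>2" "a' * c' = - (int n)\<^sup>2"
        using P Q unfolding PQ FB_sol_def by (auto simp: mem_FB_iff[OF M0])
      have "sgn a = sgn a'" "\<bar>a\<bar> = \<bar>a'\<bar>" using eq PQ by (auto simp: eq_nat_nat_iff)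
      then have "a = a'" by (metis abs_sgn mult_sgn_abs)
      moreover have "a \<noteq> 0" using ac(1) M0 by auto
      ultimately show "P = Q" using ac PQ by (metis mult_left_cancel)
    qed
    show "(\<lambda>(a, c). (sgn a, nat \<bar>a\<bar>)) ` FB_sol 0 (- (int n)\<^sup>2) \<subseteq> {1, -1 :: int} \<times> soluble_divisors n"
    proof (rule image_subsetI)
      fix P assume P: "P \<in> FB_sol 0 (- (int n)\<^sup>2)"
      obtain a c where Pac: "P = (a, c)" by (cases P)
      have ac: "a * c = - (int n)\<^sup>2" and sfa: "squarefree a" and sol: "soluble 0 a c"
        using P unfolding Pac FB_sol_def by (auto simp: mem_FB_iff[OF M0])
      have a0: "a \<noteq> 0" using ac M0 by auto
      define d where "d = nat \<bar>a\<bar>"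
      have d: "int d = \<bar>a\<bar>" by (simp add: d_def)
      have d0: "d > 0" using a0 by (simp add: d_def)
      have sfd: "squarefree d"
      proof -
        have "squarefree (int d)" using sfa unfolding squarefree_def d by simp
        then show ?thesis by (simp add: squarefree_int_iff)
      qed
      have "int d dvd (int n)\<^sup>2" using ac unfolding d by (metis abs_dvd_iff dvd_minus_iff dvd_triv_left)
      then have "d dvd n\<^sup>2" by (metis of_nat_dvd_iff of_nat_power)
      then have dn: "d dvd n" by (rule squarefree_dvd_of_dvd_square[OF sfd])
      define e where "e = n div d"
      have ne: "n = d * e" using dn by (simp add: e_def)
      have e0: "e > 0" using n ne by (auto intro!: Nat.gr0I)
      obtain x y z :: rat where xyz: "(x, y) \<noteq> (0, 0)" "z\<^sup>2 = of_int a * x ^ 4 + of_int c * y ^ 4"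
        using sol unfolding soluble_def quartic_def by auto
      have "\<exists>x y z :: rat. (x, y) \<noteq> (0, 0) \<and> z\<^sup>2 = of_nat d * x ^ 4 - of_nat d * (of_nat e)\<^sup>2 * y ^ 4"
      proof (cases "a > 0")
        case True
        then have ad: "a = int d" by (simp add: d)
        have "int d * c = int d * (- int d * (int e)\<^sup>2)"
          using ac unfolding ad ne by (simp add: power2_eq_square mult_ac)
        then have "c = - int d * (int e)\<^sup>2" by (subst (asm) mult_left_cancel) (use d0 in auto)
        then show ?thesis using xyz ad by (intro exI[of _ x] exI[of _ y] exI[of _ z]) simp
      next
        case False
        then have ad: "a = - int d" by (simp add: d)
        have "int d * c = int d * (int d * (int e)\<^sup>2)"
          using ac unfolding ad ne by (simp add: power2_eq_square mult_ac)
        then have "c = int d * (int e)\<^sup>2" by (subst (asm) mult_left_cancel) (use d0 in auto)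
        then have z2: "z\<^sup>2 = - of_nat d * x ^ 4 + of_nat d * (of_nat e)\<^sup>2 * y ^ 4" using xyz(2) ad by simp
        \<comment> \<open>Multiplying the equation for \<open>- d\<close> by
          \<open>e\<^sup>2\<close> and exchanging the roles of \<open>x\<close> and \<open>y\<close>
          turns it into the equation for \<open>d\<close>.\<close>
        have "(of_nat e * z)\<^sup>2 = of_nat d * (of_nat e * y) ^ 4 - of_nat d * (of_nat e)\<^sup>2 * x ^ 4"
          unfolding power_mult_distrib z2 by (simp add: algebra_simps power2_eq_square power4_eq_xxxx)
        moreover have "(of_nat e * y, x) \<noteq> (0, 0)" using xyz(1) e0 by auto
        ultimately show ?thesis by blast
      qed
      then have "d \<in> soluble_divisors n"
        unfolding soluble_divisors_def e_def[symmetric] using primitive_solution dn e_def by blast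
      moreover have "sgn a \<in> {1, -1}" using a0 by (auto simp: sgn_if)
      ultimately show "(\<lambda>(a, c). (sgn a, nat \<bar>a\<bar>)) P \<in> {1, -1 :: int} \<times> soluble_divisors n"
        unfolding Pac d_def by simp
    qed
  qed
  also have "\<dots> = 2 * card (soluble_divisors n)" by (simp add: card_cartesian_product)
  finally show ?thesis .
qed

definition descent_tuples :: "(idx \<Rightarrow> nat) \<Rightarrow> nat \<Rightarrow> (idx \<Rightarrow> nat) set" where
  "descent_tuples s X = {D. valid_tuple D \<and> (\<Prod>i\<in>UNIV. D i) \<le> X \<and> descent_cond (descent_coeff s) D}"

lemma finite_descent_tuples [simp]: "finite (descent_tuples s X)"
  by (rule finite_subset[OF _ finite_bounded_products[of X]]) (auto simp: descent_tuples_def valid_tuple_def)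

text \<open>A pair \<open>(s, D)\<close> determines \<open>e\<close> as the product of the last two
  factors and hence \<open>d = n div e\<close>, so every soluble divisor except possibly
  \<open>n\<close> comes from a pair. The divisor \<open>n\<close>, where \<open>e = 1\<close>
  escapes the descent, accounts for the summand 1.\<close>

lemma card_soluble_divisors_le:
  assumes n: "squarefree n" "n > 0" "n \<le> N"
  shows "card (soluble_divisors n) \<le> 1 + (\<Sum>s\<in>two_parts. card {D\<in>descent_tuples s N. n = (\<Prod>k\<in>UNIV. D k) \<or> n = 2 * (\<Prod>k\<in>UNIV. D k)})"
proof -
  define A where "A s = {D\<in>descent_tuples s N. n = (\<Prod>k\<in>UNIV. D k) \<or> n = 2 * (\<Prod>k\<in>UNIV. D k)}" for s
  define h where "h x = n div (fst x i3 * snd x i3 * (fst x i4 * snd x i4))" for x :: "(idx \<Rightarrow> nat) \<times> (idx \<Rightarrow> nat)"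
  have finA: "finite (A s)" for s unfolding A_def by simp
  have "soluble_divisors n \<subseteq> insert n (h ` (SIGMA s:two_parts. A s))"
  proof
    fix d assume "d \<in> soluble_divisors n"
    then obtain x y z where d: "d dvd n" and c: "coprime x y" and eq: "z\<^sup>2 + d * (n div d)\<^sup>2 * y ^ 4 = d * x ^ 4"
      unfolding soluble_divisors_def by blast
    define e where "e = n div d"
    have ne: "n = d * e" using d by (simp add: e_def)
    show "d \<in> insert n (h ` (SIGMA s:two_parts. A s))"
    proof (cases "e = 1")
      case True then show ?thesis using ne by simp
    next
      case False
      have sf: "squarefree (d * e)" using n(1) ne by simp
      obtain s D where sD: "\<forall>k. s k \<in> {1, 2}" "odd (\<Prod>k\<in>UNIV. D k)" "squarefree (\<Prod>k\<in>UNIV. D k)"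
        "e = s i3 * D i3 * (s i4 * D i4)" "d * e = (\<Prod>k\<in>UNIV. D k) \<or> d * e = 2 * (\<Prod>k\<in>UNIV. D k)"
        "descent_cond (descent_coeff s) D"
        using descent[OF sf False c eq[folded e_def]] by blast
      have "(\<Prod>k\<in>UNIV. D k) \<le> N" using sD(5) n(3) unfolding ne[symmetric] by linarith
      then have "D \<in> A s" using sD unfolding A_def descent_tuples_def valid_tuple_def ne by blast
      moreover have "s \<in> two_parts" using sD(1) by (simp add: two_parts_def)
      moreover have "d = h (s, D)"
        using n(2) ne unfolding h_def fst_conv snd_conv sD(4)[symmetric] by (metis mult_eq_0_iff nonzero_mult_div_cancel_right not_gr_zero)
      ultimately show ?thesis by blast
    qed
  qed
  then have "card (soluble_divisors n) \<le> card (insert n (h ` (SIGMA s:two_parts. A s)))"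
    using finA by (intro card_mono) auto
  also have "\<dots> \<le> 1 + card (h ` (SIGMA s:two_parts. A s))" by (simp add: card_insert_le_m1 card_insert_if finA)
  also have "card (h ` (SIGMA s:two_parts. A s)) \<le> card (SIGMA s:two_parts. A s)"
    using finA by (intro card_image_le) auto
  also have "card (SIGMA s:two_parts. A s) = (\<Sum>s\<in>two_parts. card (A s))" using finA by (intro card_SigmaI) auto
  finally show ?thesis unfolding A_def by simp
qed

text \<open>Counted from the side of \<open>D\<close>, which matches at most the two values
  \<open>f D\<close> and \<open>g D\<close>.\<close>

lemma sum_card_product_eq_le:
  assumes "finite S" "finite (T :: 'a set)"
  shows "(\<Sum>n\<in>S. card {D\<in>T. n = f D \<or> n = g D}) \<le> 2 * card T"
proof -
  have "(\<Sum>n\<in>S. card {D\<in>T. n = f D \<or> n = g D}) = (\<Sum>n\<in>S. \<Sum>D\<in>T. if n = f D \<or> n = g D then 1 else 0)"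
    using assms by (simp add: sum.If_cases Int_def)
  also have "\<dots> = (\<Sum>D\<in>T. \<Sum>n\<in>S. if n = f D \<or> n = g D then 1 else 0)" by (rule sum.swap)
  also have "\<dots> = (\<Sum>D\<in>T. card {n\<in>S. n = f D \<or> n = g D})"
    using assms by (simp add: sum.If_cases Int_def)
  also have "\<dots> \<le> (\<Sum>D\<in>T. 2)"
  proof (intro sum_mono)
    fix D
    have "card {n\<in>S. n = f D \<or> n = g D} \<le> card {f D, g D}" by (intro card_mono) auto
    also have "\<dots> \<le> 2" by (simp add: card_insert_if)
    finally show "card {n\<in>S. n = f D \<or> n = g D} \<le> 2" .
  qed
  finally show ?thesis by simp
qed

lemma sum_card_FB_sol_le:
  "(\<Sum>n\<in>sqfree N. card (FB_sol 0 (- (int n)\<^sup>2))) \<le> 2 * N + 4 * (\<Sum>s\<in>two_parts. card (descent_tuples s N))"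
proof -
  let ?A = "\<lambda>s n. {D\<in>descent_tuples s N. n = (\<Prod>k\<in>UNIV. D k) \<or> n = 2 * (\<Prod>k\<in>UNIV. D k)}"
  have "(\<Sum>n\<in>sqfree N. card (FB_sol 0 (- (int n)\<^sup>2))) \<le> (\<Sum>n\<in>sqfree N. 2 * (1 + (\<Sum>s\<in>two_parts. card (?A s n))))"
  proof (intro sum_mono)
    fix n assume "n \<in> sqfree N"
    then have n: "squarefree n" "n > 0" "n \<le> N" by (auto simp: sqfree_def)
    show "card (FB_sol 0 (- (int n)\<^sup>2)) \<le> 2 * (1 + (\<Sum>s\<in>two_parts. card (?A s n)))"
      by (rule order_trans[OF card_FB_sol_le[OF n(1,2)] mult_le_mono2[OF card_soluble_divisors_le[OF n]]])
  qed
  also have "\<dots> = 2 * card (sqfree N) + 2 * (\<Sum>n\<in>sqfree N. \<Sum>s\<in>two_parts. card (?A s n))"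
    by (simp only: distrib_left sum.distrib sum_distrib_left[symmetric]) simp
  also have "(\<Sum>n\<in>sqfree N. \<Sum>s\<in>two_parts. card (?A s n)) = (\<Sum>s\<in>two_parts. \<Sum>n\<in>sqfree N. card (?A s n))"
    by (rule sum.swap)
  also have "2 * card (sqfree N) + 2 * (\<Sum>s\<in>two_parts. \<Sum>n\<in>sqfree N. card (?A s n))
      \<le> 2 * N + 2 * (\<Sum>s\<in>two_parts. 2 * card (descent_tuples s N))"
    by (intro add_mono mult_left_mono card_sqfree_le sum_mono sum_card_product_eq_le) auto
  finally show ?thesis by (simp add: sum_distrib_left mult.assoc)
qed

section \<open>Asymptotic comparison\<close>

lemma harm_le: "n \<ge> 1 \<Longrightarrow> harm n \<le> 1 + ln (real n)"
proof (induction n rule: dec_induct)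
  case base then show ?case by (simp add: harm_def)
next
  case (step n)
  have n: "n \<ge> 1" using step by simp
  have "ln (real n / real (Suc n)) \<le> real n / real (Suc n) - 1"
    using n by (intro ln_le_minus_one) simp
  also have "real n / real (Suc n) - 1 = - inverse (real (Suc n))" by (simp add: field_simps)
  finally have "inverse (real (Suc n)) \<le> ln (real (Suc n)) - ln (real n)" using n by (simp add: ln_div)
  then show ?case using step by (simp add: harm_Suc)
qed

text \<open>The size of \<open>b\<close> is governed by the sixteenth power of a double logarithm,
  which any positive power of the logarithm beats; this is the only property of \<open>c\<close> and
  \<open>\<delta>\<close> that enters.\<close>

lemma sum_card_FB_sol_asymp:
  fixes c \<delta> :: real
  assumes "c > 0" "\<delta> > 0"
  shows "\<exists>b. eventually (\<lambda>N. real (\<Sum>n\<in>sqfree N. card (FB_sol 0 (- (int n)\<^sup>2))) \<le> real N * b N) sequentially \<and>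
     (\<lambda>N. b N / (c * ln (real N) powr \<delta>)) \<longlonglongrightarrow> 0"
proof -
  \<comment> \<open>With exponent 240 the factor \<open>V powr (- 1/8)\<close> is at most
    \<open>ln N powr (- 30)\<close>, which outweighs the 4 + 24 = 28 logarithms from the number of
    boxes and from the harmonic sums.\<close>
  define V where "V N = nat \<lceil>ln (real N) ^ 240\<rceil>" for N :: nat
  define b where "b N = 2 + 64 * (4096 * (1 + ln (ln (real N) ^ 240 + 1)) ^ 16
     + 2 ^ 22 * (log 2 (real N) + 1) ^ 4 * (1 + 4 * ln (2 * real N)) ^ 24 * ln (real N) powr (- 30))" for N :: nat
  have "eventually (\<lambda>N::nat. ln (real N) > 1) sequentially" by real_asymp
  then have "eventually (\<lambda>N. real (\<Sum>n\<in>sqfree N. card (FB_sol 0 (- (int n)\<^sup>2))) \<le> real N * b N) sequentially"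
    using eventually_ge_at_top[of 1]
  proof eventually_elim
    case (elim N)
    have L1: "1 \<le> ln (real N) ^ 240" using elim by (intro one_le_power) simp
    have Vr: "ln (real N) ^ 240 \<le> real (V N)" "real (V N) \<le> ln (real N) ^ 240 + 1"
      using L1 unfolding V_def by (simp_all add: of_nat_nat; linarith)+
    have V1: "V N \<ge> 1" using Vr L1 by linarith
    have hV: "harm (V N) \<le> 1 + ln (ln (real N) ^ 240 + 1)"
    proof -
      have "ln (real (V N)) \<le> ln (ln (real N) ^ 240 + 1)" using Vr V1 by (subst ln_le_cancel_iff) auto
      then show ?thesis using harm_le[OF V1] by linarith
    qed
    have hN: "harm ((2 * N) ^ 4) \<le> 1 + 4 * ln (2 * real N)"
    proof -
      have "harm ((2 * N) ^ 4) \<le> 1 + ln (real ((2 * N) ^ 4))" using elim by (intro harm_le) simp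
      also have "real ((2 * N) ^ 4) = (2 * real N) ^ 4" by simp
      also have "ln ((2 * real N) ^ 4) = 4 * ln (2 * real N)" using elim by (subst ln_realpow) auto
      finally show ?thesis .
    qed
    have Vp: "real (V N) powr (- 1/8) \<le> ln (real N) powr (- 30)"
    proof -
      have "real (V N) powr (- 1/8) \<le> (ln (real N) ^ 240) powr (- 1/8)"
        using Vr L1 by (intro powr_mono2') auto
      also have "\<dots> = ln (real N) powr (- 30)"
      proof -
        have pw: "(l ^ 240) powr (- 1/8) = l powr (- 30)" if "l > 0" for l :: real
        proof -
          have "l ^ 240 = l powr 240" using that by (simp only: powr_numeral)
          moreover have "240 * (- 1/8) = (- 30 :: real)" by simp
          ultimately show ?thesis by (simp only: powr_powr)
        qed
        have "0 < ln (real N)" using elim by linarith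
        then show ?thesis by (rule pw)
      qed
      finally show ?thesis .
    qed
    let ?B = "4096 * (1 + ln (ln (real N) ^ 240 + 1)) ^ 16
     + 2 ^ 22 * (log 2 (real N) + 1) ^ 4 * (1 + 4 * ln (2 * real N)) ^ 24 * ln (real N) powr (- 30)"
    have "real (card (descent_tuples s N)) \<le> real N * ?B" if "s \<in> two_parts" for s
    proof -
      have "real (card (descent_tuples s N)) \<le> real N * (4096 * harm (V N) ^ 16 +
          2 ^ 22 * (log 2 (real N) + 1) ^ 4 * harm ((2 * N) ^ 4) ^ 24 * real (V N) powr (- 1/8))"
        unfolding descent_tuples_def by (rule card_descent_le[OF good_coeff_descent_coeff[OF that] V1 elim(2)])
      also have "\<dots> \<le> real N * ?B"
        using elim by (intro mult_left_mono add_mono mult_mono power_mono hV hN Vp) (auto simp: harm_nonneg)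
      finally show ?thesis .
    qed
    then have "(\<Sum>s\<in>two_parts. real (card (descent_tuples s N))) \<le> (\<Sum>s\<in>two_parts. real N * ?B)" by (intro sum_mono)
    also have "\<dots> = 16 * (real N * ?B)" by (simp add: card_two_parts)
    finally have s: "(\<Sum>s\<in>two_parts. real (card (descent_tuples s N))) \<le> 16 * (real N * ?B)" .
    have "real (\<Sum>n\<in>sqfree N. card (FB_sol 0 (- (int n)\<^sup>2))) \<le> real (2 * N + 4 * (\<Sum>s\<in>two_parts. card (descent_tuples s N)))"
      using sum_card_FB_sol_le[of N] by (simp only: of_nat_le_iff)
    also have "\<dots> = 2 * real N + 4 * (\<Sum>s\<in>two_parts. real (card (descent_tuples s N)))" by simp
    also have "\<dots> \<le> 2 * real N + 4 * (16 * (real N * ?B))" using s by (intro add_left_mono mult_left_mono) auto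
    also have "\<dots> = real N * b N"
    proof -
      have "2 * n + 4 * (16 * (n * B)) = n * (2 + 64 * B)" for n B :: real by (simp add: algebra_simps)
      then show ?thesis by (simp only: b_def)
    qed
    finally show ?case .
  qed
  moreover have "(\<lambda>N. b N / (c * ln (real N) powr \<delta>)) \<longlonglongrightarrow> 0"
    unfolding b_def using assms by real_asymp
  ultimately show ?thesis by blast
qed

lemma ratio_tendsto_0:
  "(\<lambda>N. real (\<Sum>n\<in>sqfree N. card (FB_sol 0 (- (int n)\<^sup>2))) / real (\<Sum>n\<in>sqfree N. card (FB_ls 0 (- (int n)\<^sup>2)))) \<longlonglongrightarrow> 0"
proof -
  obtain c \<delta> where c: "c > 0" "\<delta> > 0" and ls: "eventually (\<lambda>N. c * real N * ln (real N) powr \<delta>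
     \<le> real (\<Sum>n\<in>sqfree N. card (FB_ls 0 (- (int n)\<^sup>2)))) sequentially"
    using sum_card_FB_ls_ge by blast
  obtain b where b: "eventually (\<lambda>N. real (\<Sum>n\<in>sqfree N. card (FB_sol 0 (- (int n)\<^sup>2))) \<le> real N * b N) sequentially"
    "(\<lambda>N. b N / (c * ln (real N) powr \<delta>)) \<longlonglongrightarrow> 0"
    using sum_card_FB_sol_asymp[OF c] by blast
  show ?thesis
  proof (rule tendsto_sandwich[OF _ _ tendsto_const b(2)])
    show "eventually (\<lambda>N. 0 \<le> real (\<Sum>n\<in>sqfree N. card (FB_sol 0 (- (int n)\<^sup>2))) / real (\<Sum>n\<in>sqfree N. card (FB_ls 0 (- (int n)\<^sup>2)))) sequentially"
      by (intro always_eventually allI divide_nonneg_nonneg of_nat_0_le_iff)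
    show "eventually (\<lambda>N. real (\<Sum>n\<in>sqfree N. card (FB_sol 0 (- (int n)\<^sup>2))) / real (\<Sum>n\<in>sqfree N. card (FB_ls 0 (- (int n)\<^sup>2)))
       \<le> b N / (c * ln (real N) powr \<delta>)) sequentially"
      using ls b(1) eventually_gt_at_top[of 1]
    proof eventually_elim
      case (elim N)
      let ?S = "real (\<Sum>n\<in>sqfree N. card (FB_sol 0 (- (int n)\<^sup>2)))" and ?T = "real (\<Sum>n\<in>sqfree N. card (FB_ls 0 (- (int n)\<^sup>2)))"
      have p: "0 < c * real N * ln (real N) powr \<delta>" using c elim(3) by simp
      have "?S / ?T \<le> (real N * b N) / (c * real N * ln (real N) powr \<delta>)"
        by (rule frac_le[OF _ elim(2) p elim(1)]) (use elim(2) order_trans[OF of_nat_0_le_iff] in blast)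
      also have "\<dots> = b N / (c * ln (real N) powr \<delta>)" using elim(3) by simp
      finally show ?case .
    qed
  qed
qed

theorem theorem5p5:
  shows "((\<lambda>X::real.
      real (\<Sum>n\<in>{n::nat. 0 < n \<and> real n < X \<and> squarefree n}. card (FB_sol 0 (- (int n)\<^sup>2)))
    / real (\<Sum>n\<in>{n::nat. 0 < n \<and> real n < X \<and> squarefree n}. card (FB_ls 0 (- (int n)\<^sup>2))))
    \<longlongrightarrow> 0) at_top"
proof -
  \<comment> \<open>The largest integer below \<open>X\<close>, since the bound on \<open>n\<close>
    is strict; for \<open>X \<le> 1\<close> it is 0 and the range is empty.\<close>
  define N where "N X = nat (\<lceil>X\<rceil> - 1)" for X :: real
  have "{n::nat. 0 < n \<and> real n < X \<and> squarefree n} = sqfree (N X)" for X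
  proof -
    have "real n < X \<longleftrightarrow> n \<le> N X" if "n > 0" for n
      using that unfolding N_def by (auto simp: less_ceiling_iff nat_le_iff le_nat_iff) linarith+
    then show ?thesis by (auto simp: sqfree_def)
  qed
  moreover have "filterlim N sequentially at_top"
    unfolding filterlim_at_top
  proof
    fix M :: nat
    show "eventually (\<lambda>X. M \<le> N X) at_top"
      using eventually_gt_at_top[of "real M + 1"]
    proof eventually_elim
      case (elim X)
      then have "int M \<le> \<lceil>X\<rceil> - 1" by linarith
      then show ?case unfolding N_def by linarith
    qed
  qed
  ultimately show ?thesis
    using filterlim_compose[OF ratio_tendsto_0, of N at_top] by simp
qed

end
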